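(* Let $Q=R/P$ be a rational function with $R,P\in\mathbb{C}[z]$, $\gcd(R,P)=1$, where $P$ has degree $d\ge 2$ and distinct zeroes $z_1,\dotsc,z_d$; put $S=\{z_1,\dotsc,z_d\}$ and $Q_n:=Q^{(n)}$. Then: (i) the zero-counting measures $\mu_n$ of $Q_n$, $n=1,2,\dotsc$, converge (weakly, as measures/distributions) to the probability measure $\mu_S$; (ii) the logarithmic potentials $L_{\mu_n}(z)=\int\log|z-t|\,\mathrm{d}\mu_n(t)$ converge in $L^1_{loc}(\mathbb{C})$ to the logarithmic potential of $\mu_S$, and this logarithmic potential equals $$\Psi(z)=\frac{1}{d-1}\Big(\log|\tilde P(z)|+\max_{i=1,\dotsc,d}\log|z-z_i|^{-1}\Big),\qquad \tilde P(z)=\prod_{i=1}^d(z-z_i)$$ (equivalently, for all $z\in\mathbb{C}$, $\Psi(z)=\frac{1}{d-1}\max_{i}\sum_{j\ne i}\log|z-z_j|$).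
   Context: For a rational function $F$ with zeroes $a_1,\dotsc,a_N$ (counted with multiplicity), its zero-counting measure is $\frac1N\sum_{k=1}^N\delta_{a_k}$. Voronoi diagram of $S=\{z_1,\dotsc,z_d\}$: let $\Phi(z)=\min_i|z-z_i|$; the cells are $V_i=\{z:\Phi(z)=|z-z_i|\}$, and $V_{ij}=\{z:\Phi(z)=|z-z_i|=|z-z_j|\}$ ($i\neq j$), a closed (possibly empty) segment of the line $|z-z_i|=|z-z_j|$. The measure $\mu_S$ is defined as $\mu_S=\sum_{i<j}\mu_{ij}|_{V_{ij}}$, where $\mu_{ij}=\frac{1}{2(d-1)\pi}\frac{|z_i-z_j|}{|(z-z_i)(z-z_j)|}\,\mathrm{d}s$ on the line $|z-z_i|=|z-z_j|$, with $\mathrm{d}s$ Euclidean arc-length measure. *)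

theory Defs
  imports "HOL-Analysis.Analysis" "HOL-Computational_Algebra.Computational_Algebra" "HOL-Computational_Algebra.Field_as_Ring"
begin

text \<open>A rational function N/D is represented by the pair (N, D) of complex polynomials.
  Its derivative is given by the quotient rule.\<close>

definition rderiv :: "complex poly \<times> complex poly \<Rightarrow> complex poly \<times> complex poly" where
  "rderiv F = (pderiv (fst F) * snd F - fst F * pderiv (snd F), snd F * snd F)"

definition Qn :: "complex poly \<Rightarrow> complex poly \<Rightarrow> nat \<Rightarrow> complex poly \<times> complex poly" where
  "Qn R P n = (rderiv ^^ n) (R, P)"

text \<open>Numerator of the rational function N/D in lowest terms: its zeros (with multiplicity)
  are the zeros of the rational function.\<close>
definition red_numer :: "complex poly \<times> complex poly \<Rightarrow> complex poly" where
  "red_numer F = fst F div gcd (fst F) (snd F)"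

definition zc_int :: "complex poly \<times> complex poly \<Rightarrow> (complex \<Rightarrow> real) \<Rightarrow> real" where
  "zc_int F f = (let N = red_numer F in
     (\<Sum>a\<in>{z. poly N z = 0}. real (order a N) * f a) / real (degree N))"

definition zc_pot :: "complex poly \<times> complex poly \<Rightarrow> complex \<Rightarrow> real" where
  "zc_pot F z = zc_int F (\<lambda>t. ln (cmod (z - t)))"

definition Phi :: "complex set \<Rightarrow> complex \<Rightarrow> real" where
  "Phi S z = Min ((\<lambda>c. cmod (z - c)) ` S)"

definition vor_edge :: "complex set \<Rightarrow> complex \<Rightarrow> complex \<Rightarrow> complex set" where
  "vor_edge S a b = {z. Phi S z = cmod (z - a) \<and> Phi S z = cmod (z - b)}"

text \<open>Arc-length parametrisation of the bisector line |z-a| = |z-b|.\<close>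
definition bisector :: "complex \<Rightarrow> complex \<Rightarrow> real \<Rightarrow> complex" where
  "bisector a b t = (a + b) / 2 + complex_of_real t * \<i> * (b - a) / complex_of_real (cmod (b - a))"

definition mu_weight :: "complex set \<Rightarrow> complex \<Rightarrow> complex \<Rightarrow> complex \<Rightarrow> real" where
  "mu_weight S a b z =
     1 / (2 * (real (card S) - 1) * pi) * (cmod (a - b) / cmod ((z - a) * (z - b)))"

text \<open>Integral of f against mu_S = sum_{i<j} mu_ij restricted to V_ij.  The sum over
  unordered pairs {i<j} is written as half the (symmetric) sum over ordered pairs.\<close>
definition muS_int :: "complex set \<Rightarrow> (complex \<Rightarrow> real) \<Rightarrow> real" where
  "muS_int S f = (\<Sum>(a, b)\<in>{(a, b). a \<in> S \<and> b \<in> S \<and> a \<noteq> b}.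
      LINT t|lborel. indicator {t. bisector a b t \<in> vor_edge S a b} t *
         (mu_weight S a b (bisector a b t) * f (bisector a b t))) / 2"

text \<open>Psi(z) = 1/(d-1) max_i sum_{j<>i} log|z-z_j|, written as the log of the max of
  the products (well defined also at the points z_i).\<close>
definition Psi :: "complex set \<Rightarrow> complex \<Rightarrow> real" where
  "Psi S z = ln (Max ((\<lambda>i. \<Prod>j\<in>S - {i}. cmod (z - j)) ` S)) / (real (card S) - 1)"

end

(*  All potentials are compared through Jensen's formula: for u = log|. - t|, and for u = Psi_S with
    mass mu_S, the mean of u over a circle |z - w| = R minus u(w) equals the integral of
    log^+(R / |w - t|) over the mass.  For Psi_S this is Green's formula.  With f = log(|. - w| / R)
    cut off at 0, the integral of grad f . grad u is computed twice by Fubini: along the lines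
    through w, giving the circle mean, and, since (d - 1) grad Psi_S is the sum over the sites a of
    (grad log|. - a|) restricted to the complement of the cell of a, along the rays from each a
    beyond the cell of a, giving the edge integrals that define mu_S.  Letting R tend to infinity
    yields the mass and the potential of mu_S.

    The numerator of Q^(n) is a constant times W_n = sum_i c_i prod_{j /= i} (z - z_j)^(n+1) for
    large n.  Off the Voronoi edges a single summand dominates, so (1 / deg W_n) log|W_n / lc W_n|
    tends to Psi_S.  A uniform bound from above and a uniformly small truncation error from below
    improve this to L^1_loc.  A test function is approximated by its convolution with
    log^+(delta / |.|), whose integrals against both measures are, by Jensen's formula, determined
    by the potentials. *)
theory Submission
  imports Defs "HOL-Probability.Sinc_Integral" "HOL-Real_Asymp.Real_Asymp"
begin

section \<open>Integration along the lines through a point\<close>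

text \<open>The gradient of \<open>Psi S\<close> jumps across the edges, and these may be empty,
  unbounded or end in vertices. Second derivatives and boundary curves are therefore avoided: only
  derivatives along almost every line through a point occur, and exceptional slopes form null sets.
  Two facts make the computation along rays work. The cell of a site \<open>a\<close> is convex and
  contains \<open>a\<close>, so a ray from \<open>a\<close> leaves it at most once. If the rays are
  written \<open>a + s * v\<close> with \<open>s = 1\<close> on the bisector with \<open>b\<close>,
  and p = (b - a)/2, then the area element s |p| cancels the decay of grad log|. - a| = v / (s
  |v|^2). What remains is the derivative in \<open>s\<close> of the other function times |p| /
  |v|^2, a factor independent of \<open>s\<close>; since |v| is the distance of the bisector point
  to both \<open>a\<close> and \<open>b\<close>, this factor is the weight of mu_S up to
  normalisation. That mu_S has finite mass and integrates logarithms is not known beforehand. The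
  truncated kernels \<open>kap R\<close> are integrable by the computation itself, and monotone
  convergence along the radii 2^n supplies the rest.\<close>

lemma lborel_complex_eq:
  "(lborel :: complex measure) = distr (lborel \<Otimes>\<^sub>M lborel) borel (\<lambda>(x, y). Complex x y)"
proof (rule lborel_eqI)
  have [measurable]: "(\<lambda>(x, y). Complex x y) \<in> borel_measurable (lborel \<Otimes>\<^sub>M lborel)"
    unfolding Complex_eq by (simp add: split_beta)
  fix l u :: complex assume le: "\<And>b. b \<in> Basis \<Longrightarrow> l \<bullet> b \<le> u \<bullet> b"
  have le': "Re l \<le> Re u" "Im l \<le> Im u" using le[of 1] le[of \<i>] by (auto simp: Basis_complex_def)
  have "(\<lambda>(x, y). Complex x y) -` box l u \<inter> space (lborel \<Otimes>\<^sub>M lborel)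
      = {Re l<..<Re u} \<times> {Im l<..<Im u}"
    by (auto simp: box_def Basis_complex_def space_pair_measure)
  then have "emeasure (distr (lborel \<Otimes>\<^sub>M lborel) borel (\<lambda>(x, y). Complex x y)) (box l u)
     = emeasure (lborel \<Otimes>\<^sub>M lborel) ({Re l<..<Re u} \<times> {Im l<..<Im u})"
    by (simp add: emeasure_distr)
  also have "\<dots> = ennreal (Re u - Re l) * ennreal (Im u - Im l)"
    using le' by (subst lborel.emeasure_pair_measure_Times) auto
  also have "\<dots> = (\<Prod>b\<in>Basis. (u - l) \<bullet> b)"
    using le' by (simp add: Basis_complex_def ennreal_mult'')
  finally show "emeasure (distr (lborel \<Otimes>\<^sub>M lborel) borel (\<lambda>(x, y). Complex x y)) (box l u) =
      (\<Prod>b\<in>Basis. (u - l) \<bullet> b)" .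
qed simp

lemma borel_measurable_Complex [measurable (raw)]:
  assumes "f \<in> borel_measurable M" "g \<in> borel_measurable M"
  shows "(\<lambda>x. Complex (f x) (g x)) \<in> borel_measurable M"
  unfolding Complex_eq using assms by measurable

lemma nn_integral_complex:
  fixes g :: "complex \<Rightarrow> ennreal"
  assumes [measurable]: "g \<in> borel_measurable borel"
  shows "(\<integral>\<^sup>+z. g z \<partial>lborel) = (\<integral>\<^sup>+x. \<integral>\<^sup>+y. g (Complex x y) \<partial>lborel \<partial>lborel)"
  by (subst lborel_complex_eq, subst nn_integral_distr)
     (simp_all add: split_beta lborel.nn_integral_fst[symmetric])

lemma nn_integral_complex':
  fixes g :: "complex \<Rightarrow> ennreal"
  assumes [measurable]: "g \<in> borel_measurable borel"
  shows "(\<integral>\<^sup>+z. g z \<partial>lborel) = (\<integral>\<^sup>+y. \<integral>\<^sup>+x. g (Complex x y) \<partial>lborel \<partial>lborel)"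
  by (subst nn_integral_complex, simp, subst lborel_pair.Fubini') simp_all

text \<open>A rotation is a product of affine substitutions in one variable: first x for fixed y,
  then y for fixed x. The identity \<open>A\<^sup>2 + B\<^sup>2 = 1\<close> makes the coefficient of
  y after the first one \<open>1/A\<close>, so the two factors cancel. For \<open>A = 0\<close> the
  rotation exchanges the coordinates up to sign.\<close>

lemma nn_integral_rotate:
  fixes g :: "complex \<Rightarrow> ennreal"
  assumes [measurable]: "g \<in> borel_measurable borel" and e: "cmod e = 1"
  shows "(\<integral>\<^sup>+z. g (e * z) \<partial>lborel) = (\<integral>\<^sup>+z. g z \<partial>lborel)"
proof -
  define A B where "A = Re e" and "B = Im e"
  have AB: "A\<^sup>2 + B\<^sup>2 = 1" using e by (simp add: A_def B_def cmod_def)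
  have mult: "e * Complex x y = Complex (A * x - B * y) (A * y + B * x)" for x y
    by (simp add: complex_eq_iff A_def B_def)
  show ?thesis
  proof (cases "A = 0")
    case False
    have "(\<integral>\<^sup>+z. g (e * z) \<partial>lborel) = (\<integral>\<^sup>+y. \<integral>\<^sup>+x. g (Complex (A*x - B*y) (A*y + B*x)) \<partial>lborel \<partial>lborel)"
      by (subst nn_integral_complex') (simp_all add: mult)
    also have "\<dots> = (\<integral>\<^sup>+y. \<bar>1/A\<bar> * (\<integral>\<^sup>+x. g (Complex x ((B*x)/A + (1/A)*y)) \<partial>lborel) \<partial>lborel)"
    proof (rule nn_integral_cong)
      fix y
      have "(\<integral>\<^sup>+x. g (Complex (A*x - B*y) (A*y + B*x)) \<partial>lborel)
        = \<bar>1/A\<bar> * (\<integral>\<^sup>+x. g (Complex (A*(B*y/A + (1/A)*x) - B*y) (A*y + B*(B*y/A + (1/A)*x))) \<partial>lborel)"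
        using False by (intro nn_integral_real_affine) auto
      also have "(\<lambda>x. g (Complex (A*(B*y/A + (1/A)*x) - B*y) (A*y + B*(B*y/A + (1/A)*x))))
          = (\<lambda>x. g (Complex x ((B*x)/A + (1/A)*y)))"
      proof -
        have "A * y + B * (B * y / A + 1 / A * x) = B * x / A + 1 / A * y" for x
        proof -
          have "A * (A * y + B * (B * y / A + 1 / A * x)) = (A\<^sup>2 + B\<^sup>2) * y + B * x"
            using False by (simp add: field_simps power2_eq_square)
          then show ?thesis using False unfolding AB by (simp add: field_simps)
        qed
        moreover have "A * (B * y / A + 1 / A * x) - B * y = x" for x
          using False by (simp add: field_simps)
        ultimately show ?thesis by simp
      qed
      finally show "(\<integral>\<^sup>+x. g (Complex (A*x - B*y) (A*y + B*x)) \<partial>lborel) =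
         \<bar>1/A\<bar> * (\<integral>\<^sup>+x. g (Complex x ((B*x)/A + (1/A)*y)) \<partial>lborel)" .
    qed
    also have "\<dots> = \<bar>1/A\<bar> * (\<integral>\<^sup>+y. \<integral>\<^sup>+x. g (Complex x ((B*x)/A + (1/A)*y)) \<partial>lborel \<partial>lborel)"
      by (subst nn_integral_cmult) auto
    also have "\<dots> = \<bar>1/A\<bar> * (\<integral>\<^sup>+x. \<integral>\<^sup>+y. g (Complex x ((B*x)/A + (1/A)*y)) \<partial>lborel \<partial>lborel)"
      by (subst lborel_pair.Fubini') simp_all
    also have "\<dots> = (\<integral>\<^sup>+x. \<bar>1/A\<bar> * (\<integral>\<^sup>+y. g (Complex x ((B*x)/A + (1/A)*y)) \<partial>lborel) \<partial>lborel)"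
      by (subst nn_integral_cmult) auto
    also have "\<dots> = (\<integral>\<^sup>+x. \<integral>\<^sup>+y. g (Complex x y) \<partial>lborel \<partial>lborel)"
      using False by (intro nn_integral_cong nn_integral_real_affine[symmetric]) auto
    also have "\<dots> = (\<integral>\<^sup>+z. g z \<partial>lborel)" by (rule nn_integral_complex[symmetric]) simp
    finally show ?thesis .
  next
    case True
    with AB have B: "B\<^sup>2 = 1" "\<bar>B\<bar> = 1" "B \<noteq> 0" by (auto simp: power2_eq_1_iff)
    have "(\<integral>\<^sup>+z. g (e * z) \<partial>lborel) = (\<integral>\<^sup>+x. \<integral>\<^sup>+y. g (Complex (- B*y) (B*x)) \<partial>lborel \<partial>lborel)"
      by (subst nn_integral_complex) (simp_all add: mult True)
    also have "\<dots> = (\<integral>\<^sup>+x. \<integral>\<^sup>+y. g (Complex y (B*x)) \<partial>lborel \<partial>lborel)"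
    proof (rule nn_integral_cong)
      fix x
      show "(\<integral>\<^sup>+y. g (Complex (- B*y) (B*x)) \<partial>lborel) = (\<integral>\<^sup>+y. g (Complex y (B*x)) \<partial>lborel)"
        using nn_integral_real_affine[of "\<lambda>y. g (Complex y (B*x))" "-B" 0] B by simp
    qed
    also have "\<dots> = (\<integral>\<^sup>+y. \<integral>\<^sup>+x. g (Complex y (B*x)) \<partial>lborel \<partial>lborel)"
      by (subst lborel_pair.Fubini') simp_all
    also have "\<dots> = (\<integral>\<^sup>+y. \<integral>\<^sup>+x. g (Complex y x) \<partial>lborel \<partial>lborel)"
    proof (rule nn_integral_cong)
      fix x
      show "(\<integral>\<^sup>+y. g (Complex x (B*y)) \<partial>lborel) = (\<integral>\<^sup>+y. g (Complex x y) \<partial>lborel)"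
        using nn_integral_real_affine[of "\<lambda>y. g (Complex x y)" "B" 0] B by simp
    qed
    also have "\<dots> = (\<integral>\<^sup>+z. g z \<partial>lborel)" by (rule nn_integral_complex[symmetric]) simp
    finally show ?thesis .
  qed
qed

lemma nn_integral_translate:
  fixes g :: "'a::euclidean_space \<Rightarrow> ennreal"
  assumes [measurable]: "g \<in> borel_measurable borel"
  shows "(\<integral>\<^sup>+z. g (c + z) \<partial>lborel) = (\<integral>\<^sup>+z. g z \<partial>lborel)"
proof -
  have "(\<integral>\<^sup>+z. g z \<partial>lborel) = (\<integral>\<^sup>+z. g z \<partial>distr lborel borel ((+) c))"
    by (simp add: lborel_distr_plus)
  also have "\<dots> = (\<integral>\<^sup>+z. g (c + z) \<partial>lborel)" by (rule nn_integral_distr) auto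
  finally show ?thesis ..
qed

text \<open>The plane is swept by the lines through \<open>c\<close>, parametrised by where they meet the line
  through \<open>c + p\<close> perpendicular to \<open>p\<close>; this replaces polar coordinates and needs only linear
  substitutions in one variable.\<close>

definition pencil :: "complex \<Rightarrow> complex \<Rightarrow> real \<Rightarrow> real \<Rightarrow> complex" where
  "pencil c p t s = c + of_real s * (p + of_real t * (\<i> * p / of_real (cmod p)))"

lemma pencil_measurable [measurable]:
  "(\<lambda>(t, s). pencil c p t s) \<in> borel_measurable (lborel \<Otimes>\<^sub>M lborel)"
  unfolding pencil_def by (simp add: split_beta)

text \<open>With \<open>c\<close> moved to 0 and \<open>p\<close> turned onto the positive real
  axis, the point is \<open>Complex (h * s) (s * t)\<close>: x = h s contributes the factor
  \<open>h\<close>, and y = s t, for fixed \<open>s \<noteq> 0\<close>, the factor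
  \<open>\<bar>s\<bar>\<close>.\<close>

lemma nn_integral_pencil:
  fixes g :: "complex \<Rightarrow> ennreal"
  assumes [measurable]: "g \<in> borel_measurable borel" and p: "p \<noteq> 0"
  shows "(\<integral>\<^sup>+z. g z \<partial>lborel) =
    (\<integral>\<^sup>+t. \<integral>\<^sup>+s. ennreal (\<bar>s\<bar> * cmod p) * g (pencil c p t s) \<partial>lborel \<partial>lborel)"
proof -
  define h e where "h = cmod p" and "e = p / of_real (cmod p)"
  have h: "h > 0" and e: "cmod e = 1" and pe: "p = of_real h * e"
    using p by (auto simp: h_def e_def norm_divide)
  have "(\<integral>\<^sup>+z. g z \<partial>lborel) = (\<integral>\<^sup>+z. g (c + e * z) \<partial>lborel)"
    using nn_integral_rotate[of "\<lambda>z. g (c + z)" e] nn_integral_translate[of g c] e by simp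
  also have "\<dots> = (\<integral>\<^sup>+x. \<integral>\<^sup>+y. g (c + e * Complex x y) \<partial>lborel \<partial>lborel)"
    by (rule nn_integral_complex) simp
  also have "\<dots> = ennreal \<bar>h\<bar> * (\<integral>\<^sup>+s. \<integral>\<^sup>+y. g (c + e * Complex (0 + h * s) y) \<partial>lborel \<partial>lborel)"
    using h by (intro nn_integral_real_affine) auto
  also have "\<dots> = ennreal h * (\<integral>\<^sup>+s. \<integral>\<^sup>+t. ennreal \<bar>s\<bar> * g (c + e * Complex (h * s) (s * t)) \<partial>lborel \<partial>lborel)"
  proof -
    have "(\<integral>\<^sup>+s. \<integral>\<^sup>+y. g (c + e * Complex (0 + h * s) y) \<partial>lborel \<partial>lborel)
        = (\<integral>\<^sup>+s. \<integral>\<^sup>+t. ennreal \<bar>s\<bar> * g (c + e * Complex (h * s) (s * t)) \<partial>lborel \<partial>lborel)"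
    proof (rule nn_integral_cong_AE)
      show "AE s in lborel. (\<integral>\<^sup>+y. g (c + e * Complex (0 + h * s) y) \<partial>lborel)
        = (\<integral>\<^sup>+t. ennreal \<bar>s\<bar> * g (c + e * Complex (h * s) (s * t)) \<partial>lborel)"
        using AE_lborel_singleton[of "0::real"]
      proof eventually_elim
        fix s :: real assume s: "s \<noteq> 0"
        show "(\<integral>\<^sup>+y. g (c + e * Complex (0 + h * s) y) \<partial>lborel)
          = (\<integral>\<^sup>+t. ennreal \<bar>s\<bar> * g (c + e * Complex (h * s) (s * t)) \<partial>lborel)"
          using nn_integral_real_affine[of "\<lambda>y. g (c + e * Complex (0 + h * s) y)" s 0] s
          by (simp add: nn_integral_cmult)
      qed
    qed
    then show ?thesis using h by simp
  qed
  also have "\<dots> = (\<integral>\<^sup>+s. \<integral>\<^sup>+t. ennreal (\<bar>s\<bar> * h) * g (c + e * Complex (h * s) (s * t)) \<partial>lborel \<partial>lborel)"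
    using h by (simp add: nn_integral_cmult[symmetric] ennreal_mult mult_ac)
  also have "\<dots> = (\<integral>\<^sup>+t. \<integral>\<^sup>+s. ennreal (\<bar>s\<bar> * h) * g (c + e * Complex (h * s) (s * t)) \<partial>lborel \<partial>lborel)"
    by (subst lborel_pair.Fubini') simp_all
  also have "(\<lambda>t s. g (c + e * Complex (h * s) (s * t))) = (\<lambda>t s. g (pencil c p t s))"
  proof -
    have "c + e * Complex (h * s) (s * t) = pencil c p t s" for s t
      unfolding pencil_def h_def[symmetric] using h by (simp add: pe Complex_eq algebra_simps)
    then show ?thesis by simp
  qed
  finally show ?thesis unfolding h_def .
qed

text \<open>As an identity of measures the substitution also applies to Bochner integrals of signed
  functions.\<close>

lemma lborel_eq_distr_pencil:
  assumes p: "p \<noteq> 0"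
  shows "(lborel :: complex measure) =
    distr (density (lborel \<Otimes>\<^sub>M lborel) (\<lambda>(t, s). ennreal (\<bar>s\<bar> * cmod p))) borel (\<lambda>(t, s). pencil c p t s)"
    (is "_ = distr ?D borel ?f")
proof (rule measure_eqI)
  fix A :: "complex set" assume "A \<in> sets lborel"
  then have [measurable]: "A \<in> sets borel" by simp
  have "emeasure lborel A = (\<integral>\<^sup>+z. indicator A z \<partial>lborel)" by simp
  also have "\<dots> = (\<integral>\<^sup>+t. \<integral>\<^sup>+s. ennreal (\<bar>s\<bar> * cmod p) * indicator A (pencil c p t s) \<partial>lborel \<partial>lborel)"
    by (rule nn_integral_pencil) (use p in auto)
  also have "\<dots> = (\<integral>\<^sup>+x. (\<lambda>(t, s). ennreal (\<bar>s\<bar> * cmod p) * indicator A (pencil c p t s)) x \<partial>(lborel \<Otimes>\<^sub>M lborel))"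
    by (subst lborel.nn_integral_fst[symmetric]) (auto simp: split_beta)
  also have "\<dots> = (\<integral>\<^sup>+x. indicator A x \<partial>distr ?D borel ?f)"
    by (subst nn_integral_distr) (auto simp: nn_integral_density split_beta intro!: nn_integral_cong)
  finally show "emeasure lborel A = emeasure (distr ?D borel ?f) A" by simp
qed simp

lemma integrable_pencil:
  fixes G :: "complex \<Rightarrow> real"
  assumes p: "p \<noteq> 0" and G: "integrable lborel G"
  shows "integrable (lborel \<Otimes>\<^sub>M lborel) (\<lambda>(t, s). \<bar>s\<bar> * cmod p * G (pencil c p t s))"
    and "(LBINT z. G z) = (LBINT t. LBINT s. \<bar>s\<bar> * cmod p * G (pencil c p t s))"
proof -
  have [measurable]: "G \<in> borel_measurable borel" using G by auto
  let ?D = "density (lborel \<Otimes>\<^sub>M lborel) (\<lambda>(t, s). ennreal (\<bar>s\<bar> * cmod p))"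
  let ?f = "\<lambda>(t, s). pencil c p t s"
  have "integrable (distr ?D borel ?f) G"
    using G lborel_eq_distr_pencil[OF p, of c] by simp
  then have "integrable ?D (\<lambda>x. G (?f x))" by (subst (asm) integrable_distr_eq) auto
  then show 1: "integrable (lborel \<Otimes>\<^sub>M lborel) (\<lambda>(t, s). \<bar>s\<bar> * cmod p * G (pencil c p t s))"
    unfolding split_beta by (subst (asm) integrable_density) (auto simp: split_beta)
  have "(LBINT z. G z) = (LINT z|distr ?D borel ?f. G z)"
    using lborel_eq_distr_pencil[OF p, of c] by simp
  also have "\<dots> = (LINT x|?D. G (?f x))" by (subst integral_distr) auto
  also have "\<dots> = (LINT x|(lborel \<Otimes>\<^sub>M lborel). (\<lambda>(t, s). \<bar>s\<bar> * cmod p * G (pencil c p t s)) x)"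
    unfolding split_beta by (subst integral_density) (auto simp: split_beta)
  also have "\<dots> = (LBINT t. LBINT s. \<bar>s\<bar> * cmod p * G (pencil c p t s))"
    using lborel_pair.integral_fst'[OF 1] by simp
  finally show "(LBINT z. G z) = (LBINT t. LBINT s. \<bar>s\<bar> * cmod p * G (pencil c p t s))" .
qed

section \<open>Jensen's formula for the logarithm\<close>

text \<open>This is the density of the angle in terms of the slope; half a turn has length
  \<open>pi\<close>.\<close>

lemma integrable_cauchy: "integrable lborel (\<lambda>y::real. inverse (1 + y\<^sup>2))"
  and integral_cauchy: "(LBINT y. inverse (1 + y\<^sup>2)) = pi"
proof -
  show "integrable lborel (\<lambda>y::real. inverse (1 + y\<^sup>2))"
    using integrable_inverse_1_plus_square by (simp add: set_integrable_def)
  show "(LBINT y. inverse (1 + y\<^sup>2)) = pi"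
    using LBINT_inverse_1_plus_square
    by (simp add: interval_lebesgue_integral_def set_lebesgue_integral_def)
qed

lemma AE_lborel_finite: "finite F \<Longrightarrow> AE x in lborel. x \<notin> (F :: 'a::euclidean_space set)"
proof (induction rule: finite_induct)
  case (insert a F)
  then show ?case using AE_lborel_singleton[of a] by auto
qed simp

text \<open>Integrability of \<open>D\<close> is a hypothesis because Fubini provides it on almost
  every line; \<open>F\<close> collects the kinks.\<close>

lemma FTC_open_interval:
  fixes \<phi> D :: "real \<Rightarrow> real"
  assumes "a \<le> b" "continuous_on {a..b} \<phi>" "finite F"
    and D: "\<And>x. x \<in> {a<..<b} - F \<Longrightarrow> (\<phi> has_real_derivative D x) (at x)"
    and I: "set_integrable lborel {a<..<b} D"
  shows "(LBINT x:{a<..<b}. D x) = \<phi> b - \<phi> a"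
proof -
  have "(D has_integral (\<phi> b - \<phi> a)) {a..b}"
    by (rule fundamental_theorem_of_calculus_interior_strong[OF \<open>finite F\<close>])
       (use assms in \<open>auto simp: has_real_derivative_iff_has_vector_derivative\<close>)
  then have "integral {a<..<b} D = \<phi> b - \<phi> a"
    by (simp add: has_integral_Icc_iff_Ioo integral_unique)
  then show ?thesis using set_borel_integral_eq_integral(2)[OF I] by simp
qed

lemma ball_borel_measurable [measurable]: "ball w R \<in> sets borel"
  by simp

lemma borel_measurable_cnj [measurable (raw)]:
  "f \<in> borel_measurable M \<Longrightarrow> (\<lambda>x. cnj (f x)) \<in> borel_measurable M"
  by (rule measurable_compose[of f M borel]) (auto intro!: borel_measurable_continuous_onI continuous_intros)

text \<open>The unit vector of slope \<open>y\<close> in the right half-plane; together with its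
  negative it covers every direction except the vertical ones.\<close>

definition dir :: "real \<Rightarrow> complex" where
  "dir y = (1 + \<i> * of_real y) / of_real (sqrt (1 + y\<^sup>2))"

lemma cmod_one_plus [simp]: "cmod (1 + \<i> * of_real y) = sqrt (1 + y\<^sup>2)"
  by (simp add: cmod_def)

lemma norm_dir [simp]: "cmod (dir y) = 1"
proof -
  have "sqrt (1 + y\<^sup>2) > 0" by (simp add: add_pos_nonneg)
  then show ?thesis by (simp add: dir_def norm_divide)
qed

lemma dir_measurable [measurable]: "dir \<in> borel_measurable borel"
  unfolding dir_def by simp

text \<open>\<open>jensen R u w\<close> integrates to \<open>2 * pi\<close> times (mean of \<open>u\<close> over the circle
  \<open>|z - w| = R\<close>, minus \<open>u w\<close>): antipodal points of the circle are paired and \<open>y\<close> is the slope.\<close>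

definition jensen :: "real \<Rightarrow> (complex \<Rightarrow> real) \<Rightarrow> complex \<Rightarrow> real \<Rightarrow> real" where
  "jensen R u w y =
     (u (w + of_real R * dir y) + u (w - of_real R * dir y) - 2 * u w) * inverse (1 + y\<^sup>2)"

text \<open>Complex numbers serve as plane vectors with inner product \<open>Re (cnj a * b)\<close>;
  this is the inner product of \<open>V\<close> with the gradient of log|. - w|, restricted to the
  disc.\<close>

definition radial :: "real \<Rightarrow> complex \<Rightarrow> (complex \<Rightarrow> complex) \<Rightarrow> complex \<Rightarrow> real" where
  "radial R w V z = indicator (ball w R) z * (Re (cnj (z - w) * V z) / (cmod (z - w))\<^sup>2)"

text \<open>The finite set admits the kinks of \<open>kap\<close> on a circle and of
  \<open>psi0\<close> on the bisectors; continuity across them is what the fundamental theorem still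
  needs.\<close>

definition primitive_on_line :: "(complex \<Rightarrow> real) \<Rightarrow> (complex \<Rightarrow> complex) \<Rightarrow> complex \<Rightarrow> complex \<Rightarrow> bool" where
  "primitive_on_line u V w q \<longleftrightarrow> continuous_on UNIV (\<lambda>x. u (w + of_real x * q)) \<and>
     (\<exists>F. finite F \<and> (\<forall>x. x \<notin> F \<longrightarrow>
       ((\<lambda>x. u (w + of_real x * q)) has_real_derivative Re (cnj q * V (w + of_real x * q))) (at x)))"

text \<open>On the line of slope \<open>y\<close> the Jacobian \<open>\<bar>s\<bar>\<close> turns
  the integrand into sgn(s) times the derivative of \<open>u\<close> along the line, divided by
  \<open>1 + y\<^sup>2\<close>. Each half of the line contributes the value of \<open>u\<close> at
  its end minus \<open>u w\<close>, and the two together are \<open>jensen\<close>.\<close>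

lemma line_green:
  fixes u :: "complex \<Rightarrow> real" and V :: "complex \<Rightarrow> complex"
  assumes R: "R > 0" and [measurable]: "u \<in> borel_measurable borel"
    and J: "integrable lborel (radial R w V)"
    and ae: "AE y in lborel. primitive_on_line u V w (1 + \<i> * of_real y)"
  shows "integrable lborel (jensen R u w)"
    and "(LBINT y. jensen R u w y) = (LBINT z. radial R w V z)"
proof -
  let ?J = "radial R w V"
  have P: "pencil w 1 y s = w + of_real s * (1 + \<i> * of_real y)" for y s
    by (simp add: pencil_def mult_ac)
  have int: "integrable (lborel \<Otimes>\<^sub>M lborel) (\<lambda>(t, s). \<bar>s\<bar> * cmod 1 * ?J (pencil w 1 t s))"
    by (rule integrable_pencil) (use J in auto)
  have eq: "(LBINT z. ?J z) = (LBINT t. LBINT s. \<bar>s\<bar> * cmod 1 * ?J (pencil w 1 t s))"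
    by (rule integrable_pencil) (use J in auto)
  have ae_eq: "AE y in lborel. (LBINT s. \<bar>s\<bar> * cmod 1 * ?J (pencil w 1 y s)) = jensen R u w y"
    using ae lborel_pair.AE_integrable_fst'[OF int]
  proof eventually_elim
    fix y assume A: "primitive_on_line u V w (1 + \<i> * of_real y)"
      and B: "integrable lborel (\<lambda>s. (\<lambda>(t, s). \<bar>s\<bar> * cmod 1 * ?J (pencil w 1 t s)) (y, s))"
    define q where "q = 1 + \<i> * of_real y"
    define \<phi> where "\<phi> = (\<lambda>x. u (w + of_real x * q))"
    define D where "D = (\<lambda>x. Re (cnj q * V (w + of_real x * q)))"
    define \<rho> where "\<rho> = sqrt (1 + y\<^sup>2)"
    have \<rho>: "\<rho> > 0" "\<rho>\<^sup>2 = 1 + y\<^sup>2" "cmod q = \<rho>" by (auto simp: \<rho>_def q_def add_pos_nonneg)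
    \<comment> \<open>The parameter \<open>x\<close> runs along the line with speed
      \<open>\<rho>\<close>, so the disc is met exactly for
      \<open>\<bar>x\<bar> < r\<close>.\<close>
    define r where "r = R / \<rho>"
    have r: "r > 0" using R \<rho> by (simp add: r_def)
    from A obtain F where cont: "continuous_on UNIV \<phi>" and F: "finite F"
      and der: "\<And>x. x \<notin> F \<Longrightarrow> (\<phi> has_real_derivative D x) (at x)"
      unfolding primitive_on_line_def \<phi>_def D_def q_def by auto
    have form: "\<bar>s\<bar> * cmod 1 * ?J (pencil w 1 y s) =
      (indicator {0<..<r} s * D s - indicator {-r<..<0} s * D s) / \<rho>\<^sup>2" for s
    proof (cases "s = 0")
      case False
      have in_ball: "w + of_real s * q \<in> ball w R \<longleftrightarrow> \<bar>s\<bar> < r"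
        using \<rho> by (simp add: dist_norm norm_mult r_def field_simps)
      have "?J (pencil w 1 y s) = indicator {-r<..<r} s * (Re (cnj (of_real s * q) * V (w + of_real s * q)) / (\<bar>s\<bar> * \<rho>)\<^sup>2)"
        unfolding radial_def P q_def[symmetric] using in_ball \<rho>
        by (auto simp: indicator_def norm_mult abs_less_iff)
      also have "Re (cnj (of_real s * q) * V (w + of_real s * q)) = s * D s"
        by (simp add: D_def algebra_simps)
      also have "s * D s / (\<bar>s\<bar> * \<rho>)\<^sup>2 = D s / (s * \<rho>\<^sup>2)"
        using False by (simp add: power2_eq_square power_mult_distrib divide_simps)
      finally show ?thesis using False
        by (auto simp: indicator_def abs_if field_simps)
    qed simp
    have Bi: "integrable lborel (\<lambda>s. (indicator {0<..<r} s * D s - indicator {-r<..<0} s * D s) / \<rho>\<^sup>2)"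
      using B by (simp only: split_conv form)
    have I1: "set_integrable lborel {0<..<r} D"
    proof -
      have "integrable lborel (\<lambda>s. indicator {0<..<r} s *\<^sub>R (\<rho>\<^sup>2 * ((indicator {0<..<r} s * D s - indicator {-r<..<0} s * D s) / \<rho>\<^sup>2)))"
        using Bi by (intro integrable_mult_indicator integrable_mult_right) auto
      also have "(\<lambda>s. indicator {0<..<r} s *\<^sub>R (\<rho>\<^sup>2 * ((indicator {0<..<r} s * D s - indicator {-r<..<0} s * D s) / \<rho>\<^sup>2)))
         = (\<lambda>s. indicator {0<..<r} s *\<^sub>R D s)" using \<rho> by (auto simp: indicator_def fun_eq_iff)
      finally show ?thesis unfolding set_integrable_def .
    qed
    have I2: "set_integrable lborel {-r<..<0} D"
    proof -
      have "integrable lborel (\<lambda>s. indicator {-r<..<0} s *\<^sub>R (- \<rho>\<^sup>2 * ((indicator {0<..<r} s * D s - indicator {-r<..<0} s * D s) / \<rho>\<^sup>2)))"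
        using Bi by (intro integrable_mult_indicator integrable_mult_right) auto
      also have "(\<lambda>s. indicator {-r<..<0} s *\<^sub>R (- \<rho>\<^sup>2 * ((indicator {0<..<r} s * D s - indicator {-r<..<0} s * D s) / \<rho>\<^sup>2)))
         = (\<lambda>s. indicator {-r<..<0} s *\<^sub>R D s)" using \<rho>(1) by (auto simp: indicator_def fun_eq_iff)
      finally show ?thesis unfolding set_integrable_def .
    qed
    have E1: "(LBINT x:{0<..<r}. D x) = \<phi> r - \<phi> 0"
      by (rule FTC_open_interval[OF _ _ F _ I1]) (use r der continuous_on_subset[OF cont] in auto)
    have E2: "(LBINT x:{-r<..<0}. D x) = \<phi> 0 - \<phi> (-r)"
      by (rule FTC_open_interval[OF _ _ F _ I2]) (use r der continuous_on_subset[OF cont] in auto)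
    have "(LBINT s. \<bar>s\<bar> * cmod 1 * ?J (pencil w 1 y s))
       = (LBINT s. (indicator {0<..<r} s * D s - indicator {-r<..<0} s * D s) / \<rho>\<^sup>2)"
      by (simp only: form)
    also have "\<dots> = ((LBINT x:{0<..<r}. D x) - (LBINT x:{-r<..<0}. D x)) / \<rho>\<^sup>2"
      using I1 I2 by (simp add: set_integrable_def set_lebesgue_integral_def)
    also have "\<dots> = (\<phi> r + \<phi> (-r) - 2 * \<phi> 0) * inverse (1 + y\<^sup>2)"
      unfolding E1 E2 by (simp add: \<rho> divide_inverse algebra_simps)
    also have "\<dots> = jensen R u w y"
    proof -
      have "of_real R * dir y = of_real r * q"
        by (simp add: dir_def q_def r_def \<rho>_def)
      then show ?thesis by (simp add: jensen_def \<phi>_def)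
    qed
    finally show "(LBINT s. \<bar>s\<bar> * cmod 1 * ?J (pencil w 1 y s)) = jensen R u w y" .
  qed
  have [measurable]: "jensen R u w \<in> borel_measurable borel"
    unfolding jensen_def by measurable
  have iy: "integrable lborel (\<lambda>y. LBINT s. \<bar>s\<bar> * cmod 1 * ?J (pencil w 1 y s))"
    using lborel_pair.integrable_fst'[OF int] by simp
  show "integrable lborel (jensen R u w)"
    by (rule Bochner_Integration.integrable_cong_AE_imp[OF iy]) (use ae_eq in \<open>auto simp: eq_commute\<close>)
  show "(LBINT y. jensen R u w y) = (LBINT z. radial R w V z)"
    unfolding eq by (intro integral_cong_AE) (use iy ae_eq in \<open>auto simp: eq_commute\<close>)
qed

text \<open>The positive part of \<open>ln (R / x)\<close>; the junk value \<open>kap R 0 = 0\<close>, where the limit is infinite, only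
  matters on null sets.\<close>

definition kap :: "real \<Rightarrow> real \<Rightarrow> real" where
  "kap R x = max 0 (ln (R / x))"

lemma kap_nonneg [simp]: "kap R x \<ge> 0" by (simp add: kap_def)

lemma kap_measurable [measurable]: "kap R \<in> borel_measurable borel"
  unfolding kap_def by measurable

lemma kap_eq: "x > 0 \<Longrightarrow> R > 0 \<Longrightarrow> kap R x = (if x < R then ln R - ln x else 0)"
  by (auto simp: kap_def ln_div max_def)

lemma kap_eq_0: "R > 0 \<Longrightarrow> x \<ge> R \<Longrightarrow> kap R x = 0"
  using kap_eq[of x R] by auto

lemma kap_le: "R > 0 \<Longrightarrow> x \<ge> 0 \<Longrightarrow> kap R x \<le> R / x"
  using ln_less_self[of "R / x"] by (cases "x = 0") (auto simp: kap_def intro: less_imp_le)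

text \<open>The Jacobian cancels the singularity: on each line the integrand becomes
  \<open>1 / \<rho>\<close> on an interval of length \<open>2 * R / \<rho>\<close>.\<close>

lemma nn_integral_inverse_ball:
  assumes R: "R > 0"
  shows "(\<integral>\<^sup>+z. ennreal (indicator (ball w R) z / cmod (z - w)) \<partial>lborel) \<le> ennreal (2 * R * pi)"
proof -
  have "(\<integral>\<^sup>+z. ennreal (indicator (ball w R) z / cmod (z - w)) \<partial>lborel)
    = (\<integral>\<^sup>+t. \<integral>\<^sup>+s. ennreal (\<bar>s\<bar> * cmod 1) * ennreal (indicator (ball w R) (pencil w 1 t s) / cmod (pencil w 1 t s - w)) \<partial>lborel \<partial>lborel)"
    by (rule nn_integral_pencil) auto
  also have "\<dots> \<le> (\<integral>\<^sup>+t. ennreal (2 * R * inverse (1 + t\<^sup>2)) \<partial>lborel)"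
  proof (rule nn_integral_mono)
    fix t :: real
    define \<rho> where "\<rho> = sqrt (1 + t\<^sup>2)"
    have \<rho>: "\<rho> > 0" "\<rho>\<^sup>2 = 1 + t\<^sup>2" by (auto simp: \<rho>_def add_pos_nonneg)
    have m: "cmod (pencil w 1 t s - w) = \<bar>s\<bar> * \<rho>" for s
      using cmod_one_plus[of t] by (simp add: pencil_def norm_mult \<rho>_def mult.commute)
    have "(\<integral>\<^sup>+s. ennreal (\<bar>s\<bar> * cmod 1) * ennreal (indicator (ball w R) (pencil w 1 t s) / cmod (pencil w 1 t s - w)) \<partial>lborel)
       \<le> (\<integral>\<^sup>+s. ennreal (1 / \<rho>) * indicator {-(R/\<rho>)..R/\<rho>} s \<partial>lborel)"
    proof (rule nn_integral_mono)
      fix s :: real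
      have ind: "indicator (ball w R) (pencil w 1 t s) = (indicator {-(R/\<rho>)<..<R/\<rho>} s :: real)"
      proof -
        have "pencil w 1 t s \<in> ball w R \<longleftrightarrow> \<bar>s\<bar> < R / \<rho>"
          using \<rho> m[of s] by (simp add: dist_norm norm_minus_commute pos_less_divide_eq)
        then show ?thesis by (auto simp: indicator_def)
      qed
      then have "\<bar>s\<bar> * cmod 1 * (indicator (ball w R) (pencil w 1 t s) / cmod (pencil w 1 t s - w)) \<le> (1/\<rho>) * indicator {-(R/\<rho>)..R/\<rho>} s"
        unfolding ind m using \<rho> by (auto simp: indicator_def)
      then have "ennreal (\<bar>s\<bar> * cmod 1 * (indicator (ball w R) (pencil w 1 t s) / cmod (pencil w 1 t s - w)))
         \<le> ennreal ((1/\<rho>) * indicator {-(R/\<rho>)..R/\<rho>} s)" by (rule ennreal_leI)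
      moreover have "ennreal ((1/\<rho>) * indicator {-(R/\<rho>)..R/\<rho>} s) = ennreal (1 / \<rho>) * indicator {-(R/\<rho>)..R/\<rho>} s"
        by (auto simp: indicator_def)
      ultimately show "ennreal (\<bar>s\<bar> * cmod 1) * ennreal (indicator (ball w R) (pencil w 1 t s) / cmod (pencil w 1 t s - w))
         \<le> ennreal (1 / \<rho>) * indicator {-(R/\<rho>)..R/\<rho>} s"
        by (subst ennreal_mult[symmetric]) auto
    qed
    also have "\<dots> = ennreal (1 / \<rho>) * ennreal (2 * R / \<rho>)"
      using \<rho> R by (simp add: nn_integral_cmult)
    also have "\<dots> = ennreal (2 * R * inverse (1 + t\<^sup>2))"
      unfolding \<rho>(2)[symmetric] using \<rho>(1) R by (simp add: ennreal_mult[symmetric] power2_eq_square divide_inverse mult_ac)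
    finally show "(\<integral>\<^sup>+s. ennreal (\<bar>s\<bar> * cmod 1) * ennreal (indicator (ball w R) (pencil w 1 t s) / cmod (pencil w 1 t s - w)) \<partial>lborel)
       \<le> ennreal (2 * R * inverse (1 + t\<^sup>2))" .
  qed
  also have "\<dots> = ennreal (LBINT t. 2 * R * inverse (1 + t\<^sup>2))"
    using R integrable_cauchy by (intro nn_integral_eq_integral) (auto intro!: add_nonneg_nonneg)
  also have "\<dots> = ennreal (2 * R * pi)" by (simp add: integral_cauchy)
  finally show ?thesis .
qed

lemma integrable_inverse_ball: "integrable lborel (\<lambda>z. indicator (ball w R) z / cmod (z - w))"
proof (cases "R > 0")
  case True
  show ?thesis
  proof (rule integrableI_bounded)
    have "(\<integral>\<^sup>+z. ennreal (norm (indicator (ball w R) z / cmod (z - w))) \<partial>lborel) \<le> ennreal (2 * R * pi)"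
      using nn_integral_inverse_ball[OF True, of w] by (simp add: abs_divide)
    also have "\<dots> < \<infinity>" by simp
    finally show "(\<integral>\<^sup>+z. ennreal (norm (indicator (ball w R) z / cmod (z - w))) \<partial>lborel) < \<infinity>" .
  qed simp
next
  case False
  then have "ball w R = {}" by simp
  show ?thesis unfolding \<open>ball w R = {}\<close> by simp
qed

lemma integrable_kap: "R > 0 \<Longrightarrow> integrable lborel (\<lambda>z. kap R (cmod (z - w)))"
proof (rule Bochner_Integration.integrable_bound)
  assume R: "R > 0"
  show "integrable lborel (\<lambda>z. R * (indicator (ball w R) z / cmod (z - w)))"
    by (intro integrable_mult_right integrable_inverse_ball)
  show "AE z in lborel. norm (kap R (cmod (z - w))) \<le> norm (R * (indicator (ball w R) z / cmod (z - w)))"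
    using kap_le[OF R] kap_eq_0[OF R] R
    by (auto simp: indicator_def dist_norm norm_minus_commute abs_mult)
qed measurable

section \<open>Derivatives of the logarithm and of its truncation along a line\<close>

lemma ln_cmod_deriv:
  assumes "c + of_real s * v \<noteq> w"
  shows "((\<lambda>s. ln (cmod (c + of_real s * v - w))) has_real_derivative
     Re (cnj v * (c + of_real s * v - w)) / (cmod (c + of_real s * v - w))\<^sup>2) (at s)"
proof -
  define N where "N = (\<lambda>s. (Re c + s * Re v - Re w)\<^sup>2 + (Im c + s * Im v - Im w)\<^sup>2)"
  have N: "(cmod (c + of_real s * v - w))\<^sup>2 = N s" for s
    by (simp add: N_def cmod_power2)
  have pos: "N s > 0" using assms unfolding N[symmetric] by simp
  have ln: "ln (cmod (c + of_real s * v - w)) = ln (N s) / 2" for s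
    unfolding N[symmetric] by (cases "c + of_real s * v = w") (simp_all add: ln_realpow)
  define E where "E = (Re c + s * Re v - Re w) * Re v + (Im c + s * Im v - Im w) * Im v"
  have dN: "(N has_real_derivative 2 * E) (at s)"
    unfolding N_def E_def by (auto intro!: derivative_eq_intros simp: algebra_simps)
  have "((\<lambda>s. ln (N s) / 2) has_real_derivative E / N s) (at s)"
    using pos by (auto intro!: derivative_eq_intros dN)
  also have "E = Re (cnj v * (c + of_real s * v - w))"
    by (simp add: E_def algebra_simps)
  finally show ?thesis unfolding ln N by simp
qed

lemma kap_deriv:
  assumes ne: "c + of_real s * v \<noteq> w" and R: "R > 0" "cmod (c + of_real s * v - w) \<noteq> R"
  shows "((\<lambda>s. kap R (cmod (c + of_real s * v - w))) has_real_derivative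
     - (indicator (ball w R) (c + of_real s * v) * (Re (cnj v * (c + of_real s * v - w)) / (cmod (c + of_real s * v - w))\<^sup>2))) (at s)"
proof -
  define f where "f = (\<lambda>s. cmod (c + of_real s * v - w))"
  have cont: "isCont f s" unfolding f_def by (intro continuous_intros)
  have pos: "f s > 0" using ne by (simp add: f_def)
  have ball: "c + of_real s * v \<in> ball w R \<longleftrightarrow> f s < R"
    by (simp add: f_def dist_norm norm_minus_commute)
  have ep: "eventually (\<lambda>x. f x > 0) (nhds s)"
    using cont pos by (auto simp: continuous_within order_tendsto_iff eventually_nhds_conv_at)
  show ?thesis
  proof (cases "f s < R")
    case True
    have "eventually (\<lambda>x. f x < R) (nhds s)"
      using cont True by (auto simp: continuous_within order_tendsto_iff eventually_nhds_conv_at)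
    with ep have e: "eventually (\<lambda>x. kap R (f x) = ln R - ln (f x)) (nhds s)"
      by eventually_elim (simp add: kap_eq R)
    have "((\<lambda>x. ln R - ln (f x)) has_real_derivative - (Re (cnj v * (c + of_real s * v - w)) / (f s)\<^sup>2)) (at s)"
      unfolding f_def using DERIV_diff[OF DERIV_const ln_cmod_deriv[OF ne], of "ln R"] by simp
    then have "((\<lambda>x. kap R (f x)) has_real_derivative - (Re (cnj v * (c + of_real s * v - w)) / (f s)\<^sup>2)) (at s)"
      using e by (subst DERIV_cong_ev[OF refl e refl])
    then show ?thesis using True ball by (simp add: f_def)
  next
    case False
    then have "f s > R" using R by (simp add: f_def)
    then have "eventually (\<lambda>x. f x > R) (nhds s)"
      using cont by (auto simp: continuous_within order_tendsto_iff eventually_nhds_conv_at)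
    with ep have e: "eventually (\<lambda>x. kap R (f x) = 0) (nhds s)"
      by eventually_elim (simp add: kap_eq R)
    have "((\<lambda>x. kap R (f x)) has_real_derivative 0) (at s)"
      by (subst DERIV_cong_ev[OF refl e refl]) simp
    then show ?thesis using False ball by (simp add: f_def)
  qed
qed

lemma continuous_on_kap_line:
  assumes "\<And>s. s \<in> A \<Longrightarrow> c + of_real s * v \<noteq> w" "R > 0"
  shows "continuous_on A (\<lambda>s. kap R (cmod (c + of_real s * v - w)))"
  unfolding kap_def using assms by (intro continuous_intros) auto

lemma finite_line_circle:
  assumes "v \<noteq> 0"
  shows "finite {s. cmod (c + of_real s * v - w) = R}"
proof -
  define p :: "real poly" where
    "p = [: (cmod (c - w))\<^sup>2 - R\<^sup>2, 2 * Re (cnj v * (c - w)), (cmod v)\<^sup>2 :]"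
  have "p \<noteq> 0" using assms by (simp add: p_def)
  then have "finite {s. poly p s = 0}" by (rule poly_roots_finite)
  moreover have "poly p s = 0" if "cmod (c + of_real s * v - w) = R" for s
  proof -
    have "(cmod (c + of_real s * v - w))\<^sup>2 = (cmod (c - w))\<^sup>2 + s * (2 * Re (cnj v * (c - w))) + s\<^sup>2 * (cmod v)\<^sup>2"
      by (simp only: cmod_power2) (simp add: power2_eq_square algebra_simps)
    then show ?thesis using that by (simp add: p_def power2_eq_square algebra_simps)
  qed
  ultimately show ?thesis by (elim finite_subset[rotated]) auto
qed

text \<open>A point other than \<open>w\<close> rules out one slope. If
  \<open>Re (t - w) = 0\<close>, the quotient is the default 0 and no line of the family reaches
  \<open>t\<close> anyway.\<close>

lemma AE_line_avoids:
  assumes "t \<noteq> w"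
  shows "AE y in lborel. \<forall>x. w + of_real x * (1 + \<i> * of_real y) \<noteq> t"
  using AE_lborel_singleton[of "Im (t - w) / Re (t - w)"]
proof eventually_elim
  fix y assume y: "y \<noteq> Im (t - w) / Re (t - w)"
  show "\<forall>x. w + of_real x * (1 + \<i> * of_real y) \<noteq> t"
  proof (intro allI notI)
    fix x assume "w + of_real x * (1 + \<i> * of_real y) = t"
    then have "t - w = of_real x * (1 + \<i> * of_real y)" by auto
    then have "Re (t - w) = x" "Im (t - w) = x * y" by (auto simp: complex_eq_iff)
    with y assms show False by (cases "x = 0") (auto simp: complex_eq_iff)
  qed
qed

lemma radial_measurable [measurable]:
  assumes [measurable]: "V \<in> borel_measurable borel"
  shows "radial R w V \<in> borel_measurable borel"
  unfolding radial_def by measurable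

lemma abs_radial_le:
  "\<bar>radial R w V z\<bar> \<le> indicator (ball w R) z / cmod (z - w) * cmod (V z)"
proof (cases "z = w")
  case False
  have "\<bar>Re (cnj (z - w) * V z)\<bar> \<le> cmod (z - w) * cmod (V z)"
    using abs_Re_le_cmod[of "cnj (z - w) * V z"] by (simp add: norm_mult del: complex_cnj_diff)
  then have "\<bar>Re (cnj (z - w) * V z)\<bar> / (cmod (z - w))\<^sup>2 \<le> cmod (z - w) * cmod (V z) / (cmod (z - w))\<^sup>2"
    by (intro divide_right_mono) auto
  also have "\<dots> = cmod (V z) / cmod (z - w)"
    using False by (simp add: power2_eq_square)
  finally show ?thesis by (auto simp: radial_def indicator_def abs_mult)
qed (simp add: radial_def)

text \<open>The kernel is at most 1/(x y) with x, y the distances to \<open>w\<close> and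
  \<open>t\<close>. Since x + y >= 2 \<delta> > 0, this product of singularities is bounded by a
  multiple of the sum 1/x + 1/y, and each summand is locally integrable.\<close>

lemma integrable_radial_log:
  assumes ne: "w \<noteq> t" and R: "R > 0"
  shows "integrable lborel (radial R w (\<lambda>z. (z - t) / of_real ((cmod (z - t))\<^sup>2)))"
proof (rule Bochner_Integration.integrable_bound)
  define \<delta> where "\<delta> = cmod (w - t) / 2"
  have \<delta>: "\<delta> > 0" using ne by (simp add: \<delta>_def)
  let ?B = "\<lambda>z. (indicator (ball w R) z / cmod (z - w) + indicator (ball t (R + 2 * \<delta>)) z / cmod (z - t)) / \<delta>"
  show "integrable lborel ?B"
    by (intro Bochner_Integration.integrable_divide Bochner_Integration.integrable_add integrable_inverse_ball)
  show "AE z in lborel. norm (radial R w (\<lambda>z. (z - t) / of_real ((cmod (z - t))\<^sup>2)) z) \<le> norm (?B z)"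
  proof (rule AE_I2)
    fix z
    have V: "cmod ((z - t) / of_real ((cmod (z - t))\<^sup>2)) = 1 / cmod (z - t)"
      unfolding norm_divide norm_of_real by (simp add: power2_eq_square)
    have "\<bar>radial R w (\<lambda>z. (z - t) / of_real ((cmod (z - t))\<^sup>2)) z\<bar>
        \<le> indicator (ball w R) z / cmod (z - w) * (1 / cmod (z - t))"
      using abs_radial_le[of R w "\<lambda>z. (z - t) / of_real ((cmod (z - t))\<^sup>2)" z] unfolding V .
    also have "\<dots> \<le> ?B z"
    proof (cases "z \<in> ball w R")
      case True
      have tri: "2 * \<delta> \<le> cmod (z - w) + cmod (z - t)"
        using norm_triangle_ineq4[of "z - t" "z - w"] by (simp add: \<delta>_def)
      have zt: "z \<in> ball t (R + 2 * \<delta>)"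
        using True norm_triangle_ineq[of "z - w" "w - t"] by (simp add: \<delta>_def dist_norm norm_minus_commute)
      have "1 / (x * y) \<le> (1 / x + 1 / y) / \<delta>" if "2 * \<delta> \<le> x + y" "x \<ge> 0" "y \<ge> 0" for x y
      proof (cases "x = 0 \<or> y = 0")
        case True then show ?thesis using that \<delta> by auto
      next
        case False
        then have "x > 0" "y > 0" using that by auto
        then show ?thesis using that \<delta> by (simp add: field_simps)
      qed
      from this[OF tri] show ?thesis using True zt by simp
    qed (use \<delta> in \<open>auto simp: indicator_def\<close>)
    also have "\<dots> \<le> \<bar>?B z\<bar>" by (rule abs_ge_self)
    finally show "norm (radial R w (\<lambda>z. (z - t) / of_real ((cmod (z - t))\<^sup>2)) z) \<le> norm (?B z)" by simp
  qed
qed simp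

lemma jensen_log:
  assumes ne: "w \<noteq> t" and R: "R > 0"
  shows "integrable lborel (jensen R (\<lambda>z. ln (cmod (z - t))) w)"
    and "(LBINT y. jensen R (\<lambda>z. ln (cmod (z - t))) w y) = 2 * pi * kap R (cmod (w - t))"
proof -
  let ?V = "\<lambda>z. (z - t) / of_real ((cmod (z - t))\<^sup>2)"
  have ae: "AE y in lborel. primitive_on_line (\<lambda>z. ln (cmod (z - t))) ?V w (1 + \<i> * of_real y)"
    using AE_line_avoids[OF ne[symmetric]]
  proof eventually_elim
    fix y assume y: "\<forall>x. w + of_real x * (1 + \<i> * of_real y) \<noteq> t"
    then have "continuous_on UNIV (\<lambda>x. ln (cmod (w + of_real x * (1 + \<i> * of_real y) - t)))"
      by (intro continuous_intros) auto
    moreover have "((\<lambda>x. ln (cmod (w + of_real x * (1 + \<i> * of_real y) - t))) has_real_derivative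
            Re (cnj (1 + \<i> * of_real y) * ?V (w + of_real x * (1 + \<i> * of_real y)))) (at x)" for x
      using ln_cmod_deriv[of w x "1 + \<i> * of_real y" t] y by (simp del: of_real_power)
    ultimately show "primitive_on_line (\<lambda>z. ln (cmod (z - t))) ?V w (1 + \<i> * of_real y)"
      unfolding primitive_on_line_def by (intro conjI exI[of _ "{}"]) auto
  qed
  note J1 = integrable_radial_log[OF ne R]
  show "integrable lborel (jensen R (\<lambda>z. ln (cmod (z - t))) w)"
    by (rule line_green(1)[OF R _ J1 ae]) measurable
  have I1: "(LBINT y. jensen R (\<lambda>z. ln (cmod (z - t))) w y) = (LBINT z. radial R w ?V z)"
    by (rule line_green(2)[OF R _ J1 ae]) measurable

  text \<open>The kernel is symmetric in the two centres: integrate it again along the lines through \<open>t\<close>.\<close>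
  define R2 where "R2 = R + cmod (w - t)"
  have R2: "R2 > 0" using R ne by (simp add: R2_def add_pos_nonneg)
  let ?V2 = "\<lambda>z. - (indicator (ball w R) z * ((z - w) / of_real ((cmod (z - w))\<^sup>2)))"
  have sym: "radial R2 t ?V2 z = - radial R w ?V z" for z
  proof (cases "z \<in> ball w R")
    case True
    then have "z \<in> ball t R2"
      using norm_triangle_ineq[of "z - w" "w - t"] by (simp add: R2_def dist_norm norm_minus_commute)
    moreover have "Re (cnj (z - t) * (z - w)) = Re (cnj (z - w) * (z - t))" by (simp add: algebra_simps)
    moreover have "Re (a * (b / of_real c)) = Re (a * b) / c" for a b c
      by (metis Re_divide_of_real times_divide_eq_right)
    ultimately show ?thesis using True
      by (simp add: radial_def del: of_real_power complex_cnj_diff times_complex.sel)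
  qed (simp add: radial_def)
  have J2: "integrable lborel (radial R2 t ?V2)" unfolding sym[abs_def] using J1 by simp
  have ae2: "AE y in lborel. primitive_on_line (\<lambda>z. kap R (cmod (z - w))) ?V2 t (1 + \<i> * of_real y)"
    using AE_line_avoids[OF ne]
  proof eventually_elim
    fix y assume y: "\<forall>x. t + of_real x * (1 + \<i> * of_real y) \<noteq> w"
    define q where "q = 1 + \<i> * of_real y"
    have q: "q \<noteq> 0" by (simp add: q_def complex_eq_iff)
    have "((\<lambda>x. kap R (cmod (t + of_real x * q - w))) has_real_derivative
            Re (cnj q * ?V2 (t + of_real x * q))) (at x)"
      if "x \<notin> {s. cmod (t + of_real s * q - w) = R}" for x
    proof -
      have "Re (cnj q * ?V2 (t + of_real x * q)) = - (indicator (ball w R) (t + of_real x * q) * (Re (cnj q * (t + of_real x * q - w)) / (cmod (t + of_real x * q - w))\<^sup>2))"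
        by (cases "t + of_real x * q \<in> ball w R") (simp_all add: Re_divide_of_real del: of_real_power)
      then show ?thesis using kap_deriv[of t x q w R] y R that by (simp add: q_def)
    qed
    then show "primitive_on_line (\<lambda>z. kap R (cmod (z - w))) ?V2 t (1 + \<i> * of_real y)"
      unfolding primitive_on_line_def q_def[symmetric] using finite_line_circle[OF q] y R
      by (intro conjI exI[of _ "{s. cmod (t + of_real s * q - w) = R}"] continuous_on_kap_line) (auto simp: q_def)
  qed
  have I2: "(LBINT y. jensen R2 (\<lambda>z. kap R (cmod (z - w))) t y) = (LBINT z. radial R2 t ?V2 z)"
    by (rule line_green(2)[OF R2 _ J2 ae2]) measurable
  \<comment> \<open>Points at distance \<open>R2\<close> from \<open>t\<close> have distance at
    least \<open>R\<close> from \<open>w\<close>, where \<open>kap R\<close> vanishes; only the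
    value at the centre \<open>t\<close> survives.\<close>
  have "jensen R2 (\<lambda>z. kap R (cmod (z - w))) t y = (- 2 * kap R (cmod (t - w))) * inverse (1 + y\<^sup>2)" for y
  proof -
    have "kap R (cmod (t + of_real R2 * dir y - w)) = 0" "kap R (cmod (t - of_real R2 * dir y - w)) = 0"
    proof (rule_tac [!] kap_eq_0[OF R])
      have "R2 = cmod (of_real R2 * dir y)" using R2 by (simp add: norm_mult)
      also have "\<dots> \<le> cmod (t + of_real R2 * dir y - w) + cmod (w - t)"
        using norm_triangle_ineq[of "t + of_real R2 * dir y - w" "w - t"] by simp
      finally show "R \<le> cmod (t + of_real R2 * dir y - w)" by (simp add: R2_def)
      have "R2 = cmod (of_real R2 * dir y)" using R2 by (simp add: norm_mult)
      also have "\<dots> \<le> cmod (t - of_real R2 * dir y - w) + cmod (w - t)"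
        using norm_triangle_ineq[of "t - of_real R2 * dir y - w" "w - t"] by simp
      finally show "R \<le> cmod (t - of_real R2 * dir y - w)" by (simp add: R2_def)
    qed
    then show ?thesis by (simp add: jensen_def)
  qed
  then have "(LBINT y. jensen R2 (\<lambda>z. kap R (cmod (z - w))) t y)
      = (LBINT y. (- 2 * kap R (cmod (t - w))) * inverse (1 + y\<^sup>2))" by simp
  then have "(LBINT z. radial R2 t ?V2 z) = (- 2 * kap R (cmod (t - w))) * pi"
    unfolding I2 by (simp add: integral_cauchy)
  then show "(LBINT y. jensen R (\<lambda>z. ln (cmod (z - t))) w y) = 2 * pi * kap R (cmod (w - t))"
    unfolding I1 sym by (simp add: norm_minus_commute)
qed

section \<open>Jensen's formula for the Voronoi potential\<close>

lemma continuous_on_Max_image: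
  fixes f :: "'i \<Rightarrow> 'a::topological_space \<Rightarrow> real"
  assumes "finite I" "I \<noteq> {}" "\<And>i. i \<in> I \<Longrightarrow> continuous_on A (f i)"
  shows "continuous_on A (\<lambda>x. Max ((\<lambda>i. f i x) ` I))"
  using assms
proof (induction rule: finite_ne_induct)
  case (insert i I)
  have "(\<lambda>x. Max ((\<lambda>i. f i x) ` insert i I)) = (\<lambda>x. max (f i x) (Max ((\<lambda>i. f i x) ` I)))"
    using insert by (auto simp: fun_eq_iff)
  then show ?case using insert by (auto intro!: continuous_on_max)
qed simp

lemma AE_Re_mult_ne_0:
  assumes "c \<noteq> 0"
  shows "AE z in lborel. Re ((z - a) * c) \<noteq> 0"
proof -
  have eq: "{z. Re ((z - a) * c) = 0} = {z. cnj c \<bullet> z = cnj c \<bullet> a}"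
    by (auto simp: inner_complex_def algebra_simps)
  have "negligible {z. cnj c \<bullet> z = cnj c \<bullet> a}"
    using assms by (intro negligible_hyperplane) auto
  then have "{z. Re ((z - a) * c) = 0} \<in> null_sets lebesgue"
    unfolding eq negligible_iff_null_sets .
  moreover have "{z. Re ((z - a) * c) = 0} \<in> sets lborel"
    unfolding eq by (auto intro!: borel_closed closed_hyperplane)
  ultimately have "{z. Re ((z - a) * c) = 0} \<in> null_sets lborel"
    by (simp add: null_sets_completion_iff)
  then show ?thesis by (auto dest: AE_not_in)
qed

text \<open>Division by \<open>e\<close> moves the two points to 0 and 1, whose bisector is Re =
  1/2. The right-hand side is linear in \<open>v\<close>, which makes it easy to follow along
  rays.\<close>

lemma cmod_diff_less_iff:
  assumes "e \<noteq> 0"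
  shows "cmod (v - e) < cmod v \<longleftrightarrow> 1 < 2 * Re (v / e)"
proof -
  have eq: "(cmod (q - 1))\<^sup>2 = (cmod q)\<^sup>2 + 1 - 2 * Re q" for q
    by (simp only: cmod_power2) (simp add: power2_eq_square algebra_simps)
  have "cmod (v - e) < cmod v \<longleftrightarrow> cmod (v / e - 1) < cmod (v / e)"
    using assms by (simp add: field_simps norm_divide diff_divide_distrib[symmetric])
  also have "\<dots> \<longleftrightarrow> (cmod (v / e - 1))\<^sup>2 < (cmod (v / e))\<^sup>2"
    by (metis norm_ge_zero power2_less_imp_less power_strict_mono zero_less_numeral)
  also have "\<dots> \<longleftrightarrow> 1 < 2 * Re (v / e)" unfolding eq by auto
  finally show ?thesis .
qed

section \<open>The Voronoi potential and the splitting of its gradient by edges\<close>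

locale sites =
  fixes S :: "complex set"
  assumes fin [simp]: "finite S" and card2: "card S \<ge> 2"
begin

lemma S_ne [simp]: "S \<noteq> {}" using card2 by auto

abbreviation "\<omega> \<equiv> real (card S) - 1"

lemma omega_pos: "\<omega> > 0" using card2 by simp

definition psi0 :: "complex \<Rightarrow> real" where
  "psi0 z = ln (Max ((\<lambda>i. \<Prod>j\<in>S - {i}. cmod (z - j)) ` S))"

lemma Psi_eq_psi0: "Psi S z = psi0 z / \<omega>"
  by (simp add: Psi_def psi0_def)

lemma ex_nearest: "\<exists>i\<in>S. \<forall>b\<in>S. cmod (z - i) \<le> cmod (z - b)"
proof -
  have "Min ((\<lambda>c. cmod (z - c)) ` S) \<in> (\<lambda>c. cmod (z - c)) ` S" by (intro Min_in) auto
  then obtain i where "i \<in> S" "Min ((\<lambda>c. cmod (z - c)) ` S) = cmod (z - i)" by blast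
  then show ?thesis by (metis Min_le fin finite_imageI imageI)
qed

text \<open>Two of the products share all factors but one, so omitting the smallest factor leaves
  the largest product.\<close>

lemma Max_prod_nearest:
  assumes i: "i \<in> S" "\<And>b. b \<in> S \<Longrightarrow> cmod (z - i) \<le> cmod (z - b)"
  shows "Max ((\<lambda>i. \<Prod>j\<in>S - {i}. cmod (z - j)) ` S) = (\<Prod>j\<in>S - {i}. cmod (z - j))"
proof (rule Max_eqI)
  fix x assume "x \<in> (\<lambda>i. \<Prod>j\<in>S - {i}. cmod (z - j)) ` S"
  then obtain k where k: "k \<in> S" "x = (\<Prod>j\<in>S - {k}. cmod (z - j))" by auto
  show "x \<le> (\<Prod>j\<in>S - {i}. cmod (z - j))"
  proof (cases "k = i")
    case False
    have "x = cmod (z - i) * (\<Prod>j\<in>S - {k} - {i}. cmod (z - j))"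
      unfolding k using i False by (intro prod.remove) auto
    also have "\<dots> \<le> cmod (z - k) * (\<Prod>j\<in>S - {k} - {i}. cmod (z - j))"
      using i k by (intro mult_right_mono prod_nonneg) auto
    also have "S - {k} - {i} = S - {i} - {k}" by auto
    also have "cmod (z - k) * (\<Prod>j\<in>S - {i} - {k}. cmod (z - j)) = (\<Prod>j\<in>S - {i}. cmod (z - j))"
      using k False by (intro prod.remove[symmetric]) auto
    finally show ?thesis .
  qed (use k in simp)
qed (use i in auto)

text \<open>Only the nearest site can coincide with \<open>z\<close>, and its factor is the omitted
  one. Hence \<open>psi0\<close> is finite and continuous even at the sites.\<close>

lemma Max_prod_pos: "Max ((\<lambda>i. \<Prod>j\<in>S - {i}. cmod (z - j)) ` S) > 0"
proof -
  obtain i where i: "i \<in> S" "\<And>b. b \<in> S \<Longrightarrow> cmod (z - i) \<le> cmod (z - b)"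
    using ex_nearest by blast
  have "z \<noteq> j" if "j \<in> S - {i}" for j
  proof
    assume "z = j"
    then show False using i(2)[of j] that by auto
  qed
  then have "(\<Prod>j\<in>S - {i}. cmod (z - j)) > 0" by (intro prod_pos) auto
  moreover have "Max ((\<lambda>i. \<Prod>j\<in>S - {i}. cmod (z - j)) ` S) = (\<Prod>j\<in>S - {i}. cmod (z - j))"
    using i by (rule Max_prod_nearest)
  ultimately show ?thesis by (simp only:)
qed

lemma continuous_on_psi0: "continuous_on A psi0"
  unfolding psi0_def using Max_prod_pos
  by (intro continuous_on_ln continuous_on_Max_image continuous_intros) (auto simp: less_imp_neq[symmetric])

lemma continuous_on_Psi: "continuous_on A (Psi S)"
  unfolding Psi_eq_psi0[abs_def] by (intro continuous_intros continuous_on_psi0) (use omega_pos in auto)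

lemma psi0_measurable [measurable]: "psi0 \<in> borel_measurable borel"
  by (intro borel_measurable_continuous_onI continuous_on_psi0)

lemma Psi_measurable [measurable]: "Psi S \<in> borel_measurable borel"
  by (intro borel_measurable_continuous_onI continuous_on_Psi)

definition outside :: "complex \<Rightarrow> complex \<Rightarrow> bool" where
  "outside a z \<longleftrightarrow> (\<exists>b\<in>S. cmod (z - b) < cmod (z - a))"

text \<open>Off the edges the sites with \<open>outside a z\<close> are all but the nearest one, and
  this is the gradient of \<open>psi0\<close>.\<close>

definition grad :: "complex \<Rightarrow> complex" where
  "grad z = (\<Sum>a\<in>S. if outside a z then (z - a) / of_real ((cmod (z - a))\<^sup>2) else 0)"

text \<open>Without a tie the nearest site \<open>i\<close> stays nearest close by, and
  \<open>psi0\<close> is locally the smooth sum of logarithms over the other sites.\<close>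

lemma psi0_line_deriv:
  assumes ne: "\<And>a b. a \<in> S \<Longrightarrow> b \<in> S \<Longrightarrow> a \<noteq> b \<Longrightarrow>
      cmod (w + of_real x * q - a) \<noteq> cmod (w + of_real x * q - b)"
  shows "((\<lambda>x. psi0 (w + of_real x * q)) has_real_derivative Re (cnj q * grad (w + of_real x * q))) (at x)"
proof -
  define z where "z = w + of_real x * q"
  obtain i where i: "i \<in> S" "\<And>b. b \<in> S \<Longrightarrow> cmod (z - i) \<le> cmod (z - b)"
    using ex_nearest by blast
  have strict: "cmod (z - i) < cmod (z - b)" if "b \<in> S - {i}" for b
    using i(2)[of b] ne[of i b] that i(1) unfolding z_def[symmetric] by force
  have ev: "eventually (\<lambda>x. cmod (w + of_real x * q - i) < cmod (w + of_real x * q - b)) (nhds x)"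
    if "b \<in> S - {i}" for b
  proof -
    have "isCont (\<lambda>x. cmod (w + of_real x * q - b) - cmod (w + of_real x * q - i)) x"
      by (intro continuous_intros)
    then have "eventually (\<lambda>x. cmod (w + of_real x * q - b) - cmod (w + of_real x * q - i) > 0) (at x)"
      unfolding isCont_def by (rule order_tendstoD(1)) (use strict[OF that] in \<open>simp add: z_def\<close>)
    then show ?thesis
      using strict[OF that] by (auto simp: eventually_nhds_conv_at z_def)
  qed
  have "eventually (\<lambda>x. \<forall>b\<in>S - {i}. cmod (w + of_real x * q - i) < cmod (w + of_real x * q - b)) (nhds x)"
    using ev by (auto simp: eventually_ball_finite_distrib)
  then have e: "eventually (\<lambda>x. psi0 (w + of_real x * q) = (\<Sum>j\<in>S - {i}. ln (cmod (w + of_real x * q - j)))) (nhds x)"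
  proof eventually_elim
    fix x assume A: "\<forall>b\<in>S - {i}. cmod (w + of_real x * q - i) < cmod (w + of_real x * q - b)"
    then have "psi0 (w + of_real x * q) = ln (\<Prod>j\<in>S - {i}. cmod (w + of_real x * q - j))"
      unfolding psi0_def using i(1) by (subst Max_prod_nearest[of i]) (auto intro: less_imp_le)
    also have "\<dots> = (\<Sum>j\<in>S - {i}. ln (cmod (w + of_real x * q - j)))"
    proof (intro ln_prod)
      fix j assume "j \<in> S - {i}"
      then have "cmod (w + of_real x * q - j) > 0"
        using A by (meson le_less_trans norm_ge_zero)
      then show "cmod (w + of_real x * q - j) \<noteq> 0" by simp
    qed simp
    finally show "psi0 (w + of_real x * q) = (\<Sum>j\<in>S - {i}. ln (cmod (w + of_real x * q - j)))" .
  qed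
  have zj: "z \<noteq> j" if "j \<in> S - {i}" for j
    using strict[OF that] by auto
  have "((\<lambda>x. \<Sum>j\<in>S - {i}. ln (cmod (w + of_real x * q - j))) has_real_derivative
      (\<Sum>j\<in>S - {i}. Re (cnj q * (z - j)) / (cmod (z - j))\<^sup>2)) (at x)"
    unfolding z_def using zj by (intro DERIV_sum ln_cmod_deriv) (auto simp: z_def)
  also have "(\<Sum>j\<in>S - {i}. Re (cnj q * (z - j)) / (cmod (z - j))\<^sup>2) = Re (cnj q * grad z)"
  proof -
    have "outside j z \<longleftrightarrow> j \<noteq> i" if "j \<in> S" for j
      using i strict[of j] that by (force simp: outside_def)
    then have "grad z = (\<Sum>j\<in>S - {i}. (z - j) / of_real ((cmod (z - j))\<^sup>2))"
      unfolding grad_def by (intro sum.mono_neutral_cong_right) auto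
    then show ?thesis
      by (simp add: sum_distrib_left Re_divide_of_real del: of_real_power times_complex.sel)
  qed
  finally show ?thesis unfolding z_def by (subst DERIV_cong_ev[OF refl e refl])
qed

text \<open>The squared distances to \<open>a\<close> and \<open>b\<close> differ by an affine
  function of \<open>x\<close> that is constant only if the line is parallel to their bisector.
  Excluding these finitely many slopes leaves at most one tie per pair.\<close>

lemma AE_psi0_line:
  "AE y in lborel. primitive_on_line psi0 grad w (1 + \<i> * of_real y)"
proof -
  have "finite ((\<lambda>(a, b). - Re (a - b) / Im (a - b)) ` (S \<times> S))" by simp
  from AE_lborel_finite[OF this] show ?thesis
  proof eventually_elim
    fix y assume y: "y \<notin> (\<lambda>(a, b). - Re (a - b) / Im (a - b)) ` (S \<times> S)"
    define q where "q = 1 + \<i> * of_real y"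
    have nz: "Re (cnj q * (a - b)) \<noteq> 0" if "a \<in> S" "b \<in> S" "a \<noteq> b" for a b
    proof
      assume "Re (cnj q * (a - b)) = 0"
      then have *: "Re (a - b) + y * Im (a - b) = 0" by (simp add: q_def)
      then have "Im (a - b) \<noteq> 0" using that by (auto simp: complex_eq_iff)
      with * have "y = - Re (a - b) / Im (a - b)" by (simp add: field_simps)
      with y that show False by force
    qed
    define F where "F = (\<Union>a\<in>S. \<Union>b\<in>S - {a}. {x. cmod (w + of_real x * q - a) = cmod (w + of_real x * q - b)})"
    have "finite {x. cmod (w + of_real x * q - a) = cmod (w + of_real x * q - b)}"
      if "a \<in> S" "b \<in> S - {a}" for a b
    proof (rule finite_subset)
      show "{x. cmod (w + of_real x * q - a) = cmod (w + of_real x * q - b)}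
        \<subseteq> {((cmod (w - a))\<^sup>2 - (cmod (w - b))\<^sup>2) / (2 * Re (cnj q * (a - b)))}"
      proof safe
        fix x assume "cmod (w + of_real x * q - a) = cmod (w + of_real x * q - b)"
        then have "(cmod (w + of_real x * q - a))\<^sup>2 = (cmod (w + of_real x * q - b))\<^sup>2" by simp
        then have "x * (2 * Re (cnj q * (a - b))) = (cmod (w - a))\<^sup>2 - (cmod (w - b))\<^sup>2"
          by (simp only: cmod_power2) (simp add: power2_eq_square algebra_simps)
        then show "x = ((cmod (w - a))\<^sup>2 - (cmod (w - b))\<^sup>2) / (2 * Re (cnj q * (a - b)))"
          using nz[of a b] that by (auto simp: eq_divide_eq simp del: times_complex.sel)
      qed
    qed simp
    then have "finite F" by (auto simp: F_def)
    moreover have "((\<lambda>x. psi0 (w + of_real x * q)) has_real_derivative Re (cnj q * grad (w + of_real x * q))) (at x)"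
      if "x \<notin> F" for x
      by (rule psi0_line_deriv) (use that in \<open>auto simp: F_def\<close>)
    moreover have "continuous_on UNIV (\<lambda>x. psi0 (w + of_real x * q))"
      by (rule continuous_on_compose2[OF continuous_on_psi0[of UNIV]]) (auto intro!: continuous_intros)
    ultimately show "primitive_on_line psi0 grad w (1 + \<i> * of_real y)"
      unfolding primitive_on_line_def q_def[symmetric] by blast
  qed
qed

text \<open>Inversion at \<open>a\<close> turns the bisectors with the other sites into half-planes: a ray leaves the
  cell of \<open>a\<close> through the edge shared with \<open>b\<close> iff \<open>b\<close> maximises \<open>Re ((z - a) / (b - a))\<close>.\<close>

definition behind :: "complex \<Rightarrow> complex \<Rightarrow> complex \<Rightarrow> bool" where
  "behind a b z \<longleftrightarrow> 1 < 2 * Re ((z - a) / (b - a)) \<and>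
     (\<forall>c\<in>S - {a}. Re ((z - a) / (c - a)) \<le> Re ((z - a) / (b - a)))"

definition gradE :: "complex \<Rightarrow> complex \<Rightarrow> complex \<Rightarrow> complex" where
  "gradE a b z = (if behind a b z then (z - a) / of_real ((cmod (z - a))\<^sup>2) else 0)"

lemma outside_iff:
  assumes "a \<in> S"
  shows "outside a z \<longleftrightarrow> (\<exists>b\<in>S - {a}. 1 < 2 * Re ((z - a) / (b - a)))"
proof -
  have "cmod (z - b) < cmod (z - a) \<longleftrightarrow> 1 < 2 * Re ((z - a) / (b - a))" if "b \<in> S - {a}" for b
    using cmod_diff_less_iff[of "b - a" "z - a"] that by simp
  then show ?thesis unfolding outside_def by (metis DiffD1 DiffI empty_iff insert_iff less_irrefl)
qed

text \<open>Off a null set the maximiser in \<open>behind\<close> is unique, so if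
  \<open>outside a z\<close> holds, exactly one \<open>b\<close> satisfies
  \<open>behind a b z\<close>; otherwise none does.\<close>

lemma AE_grad_eq: "AE z in lborel. grad z = (\<Sum>a\<in>S. \<Sum>b\<in>S - {a}. gradE a b z)"
proof -
  have "AE z in lborel. \<forall>a\<in>S. \<forall>b\<in>S - {a}. \<forall>c\<in>S - {a}. b \<noteq> c \<longrightarrow> Re ((z - a) / (b - a)) \<noteq> Re ((z - a) / (c - a))"
  proof (intro AE_finite_allI)
    fix a b c assume *: "a \<in> S" "b \<in> S - {a}" "c \<in> S - {a}"
    show "AE z in lborel. b \<noteq> c \<longrightarrow> Re ((z - a) / (b - a)) \<noteq> Re ((z - a) / (c - a))"
    proof (cases "b = c")
      case False
      \<comment> \<open>A tie means that \<open>z - a\<close> times this nonzero constant has real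
        part 0, which describes a line through \<open>a\<close>.\<close>
      then have "1 / (b - a) - 1 / (c - a) \<noteq> 0" using * by (simp add: divide_inverse)
      from AE_Re_mult_ne_0[OF this, of a] show ?thesis
        by eventually_elim (simp add: right_diff_distrib del: times_complex.sel)
    qed simp
  qed auto
  then show ?thesis
  proof eventually_elim
    fix z assume ties: "\<forall>a\<in>S. \<forall>b\<in>S - {a}. \<forall>c\<in>S - {a}. b \<noteq> c \<longrightarrow> Re ((z - a) / (b - a)) \<noteq> Re ((z - a) / (c - a))"
    have "(if outside a z then (z - a) / of_real ((cmod (z - a))\<^sup>2) else 0) = (\<Sum>b\<in>S - {a}. gradE a b z)"
      if a: "a \<in> S" for a
    proof (cases "outside a z")
      case False
      then have "gradE a b z = 0" if "b \<in> S - {a}" for b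
        using outside_iff[OF a, of z] that by (auto simp: gradE_def behind_def)
      then show ?thesis using False by (simp del: Diff_iff)
    next
      case True
      have ne: "S - {a} \<noteq> {}" using True outside_iff[OF a] by auto
      define M where "M = Max ((\<lambda>b. Re ((z - a) / (b - a))) ` (S - {a}))"
      have "M \<in> (\<lambda>b. Re ((z - a) / (b - a))) ` (S - {a})"
        unfolding M_def using ne by (intro Max_in) auto
      then obtain b where b: "b \<in> S - {a}" "M = Re ((z - a) / (b - a))" by auto
      have le: "Re ((z - a) / (c - a)) \<le> Re ((z - a) / (b - a))" if "c \<in> S - {a}" for c
        unfolding b(2)[symmetric] M_def using that by (intro Max_ge) auto
      obtain c where "c \<in> S - {a}" "1 < 2 * Re ((z - a) / (c - a))" using True outside_iff[OF a] by blast
      with le[of c] have "1 < 2 * Re ((z - a) / (b - a))" by linarith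
      then have bb: "behind a b z" using le unfolding behind_def by blast
      have "\<not> behind a c z" if "c \<in> S - {a} - {b}" for c
        using le[of c] ties a b that by (force simp: behind_def)
      then have "(\<Sum>c\<in>S - {a} - {b}. gradE a c z) = 0"
        by (intro sum.neutral) (auto simp: gradE_def)
      then have "(\<Sum>c\<in>S - {a}. gradE a c z) = gradE a b z"
        using b by (subst sum.remove[of _ b]) auto
      then show ?thesis using True bb by (simp add: gradE_def)
    qed
    then show "grad z = (\<Sum>a\<in>S. \<Sum>b\<in>S - {a}. gradE a b z)"
      unfolding grad_def by (intro sum.cong) auto
  qed
qed

lemma gradE_measurable [measurable]: "gradE a b \<in> borel_measurable borel"
proof -
  have [measurable]: "Measurable.pred borel (\<lambda>z. \<forall>c\<in>S - {a}. Re ((z - a) / (c - a)) \<le> Re ((z - a) / (b - a)))"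
    by (intro pred_intros_finite) auto
  show ?thesis unfolding gradE_def behind_def by measurable
qed

text \<open>Beyond the bisector with \<open>b\<close> the distance to \<open>a\<close> exceeds half
  of \<open>cmod (b - a)\<close>, so the pole at \<open>a\<close> is never approached. The radial
  integrals therefore converge for every centre \<open>w\<close>, even on an edge or at a
  site.\<close>

lemma cmod_gradE_le:
  assumes "a \<noteq> b"
  shows "cmod (gradE a b z) \<le> 2 / cmod (b - a)"
proof (cases "behind a b z")
  case True
  then have "1 < 2 * Re ((z - a) / (b - a))" by (simp add: behind_def)
  also have "\<dots> \<le> 2 * (cmod (z - a) / cmod (b - a))"
    using complex_Re_le_cmod[of "(z - a) / (b - a)"] by (simp only: norm_divide)
  finally have *: "cmod (b - a) < 2 * cmod (z - a)" using assms by (simp add: field_simps)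
  have "cmod (gradE a b z) = cmod (z - a) / (cmod (z - a))\<^sup>2"
    using True unfolding gradE_def by (simp only: if_True norm_divide norm_of_real) simp
  also have "\<dots> = 1 / cmod (z - a)" by (simp add: power2_eq_square)
  also have "\<dots> \<le> 2 / cmod (b - a)"
  proof -
    have "cmod (z - a) > 0" using * by (smt (verit) norm_ge_zero)
    then show ?thesis using * assms by (simp add: field_simps)
  qed
  finally show ?thesis .
qed (simp add: gradE_def)

lemma integrable_radial_gradE:
  assumes "a \<noteq> b"
  shows "integrable lborel (radial R w (gradE a b))"
proof (rule Bochner_Integration.integrable_bound)
  show "integrable lborel (\<lambda>z. indicator (ball w R) z / cmod (z - w) * (2 / cmod (b - a)))"
    by (intro integrable_mult_left integrable_inverse_ball)
  show "AE z in lborel. norm (radial R w (gradE a b) z) \<le> norm (indicator (ball w R) z / cmod (z - w) * (2 / cmod (b - a)))"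
  proof (rule AE_I2)
    fix z
    have "\<bar>radial R w (gradE a b) z\<bar> \<le> indicator (ball w R) z / cmod (z - w) * cmod (gradE a b z)"
      by (rule abs_radial_le)
    also have "\<dots> \<le> indicator (ball w R) z / cmod (z - w) * (2 / cmod (b - a))"
      using cmod_gradE_le[OF assms] by (intro mult_left_mono) auto
    finally show "norm (radial R w (gradE a b) z) \<le> norm (indicator (ball w R) z / cmod (z - w) * (2 / cmod (b - a)))"
      by simp
  qed
qed simp

lemma AE_radial_grad:
  "AE z in lborel. radial R w grad z = (\<Sum>a\<in>S. \<Sum>b\<in>S - {a}. radial R w (gradE a b) z)"
  using AE_grad_eq
proof eventually_elim
  fix z assume "grad z = (\<Sum>a\<in>S. \<Sum>b\<in>S - {a}. gradE a b z)"
  then show "radial R w grad z = (\<Sum>a\<in>S. \<Sum>b\<in>S - {a}. radial R w (gradE a b) z)"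
    by (simp add: radial_def sum_distrib_left sum_divide_distrib del: times_complex.sel complex_cnj_diff)
qed

lemma grad_measurable [measurable]: "grad \<in> borel_measurable borel"
proof -
  have [measurable]: "Measurable.pred borel (outside a)" for a
    unfolding outside_def by (intro pred_intros_finite) auto
  show ?thesis unfolding grad_def by measurable
qed

lemma radial_grad:
  shows "integrable lborel (radial R w grad)"
    and "(LBINT z. radial R w grad z) = (\<Sum>a\<in>S. \<Sum>b\<in>S - {a}. LBINT z. radial R w (gradE a b) z)"
proof -
  have i: "integrable lborel (\<lambda>z. \<Sum>a\<in>S. \<Sum>b\<in>S - {a}. radial R w (gradE a b) z)"
    by (intro Bochner_Integration.integrable_sum integrable_radial_gradE) auto
  show "integrable lborel (radial R w grad)"
    by (rule Bochner_Integration.integrable_cong_AE_imp[OF i])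
       (use AE_radial_grad[of R w] in \<open>auto simp: eq_commute\<close>)
  have "(LBINT z. radial R w grad z) = (LBINT z. (\<Sum>a\<in>S. \<Sum>b\<in>S - {a}. radial R w (gradE a b) z))"
    by (intro integral_cong_AE) (use AE_radial_grad in auto)
  also have "\<dots> = (\<Sum>a\<in>S. \<Sum>b\<in>S - {a}. LBINT z. radial R w (gradE a b) z)"
    by (subst Bochner_Integration.integral_sum;
        (intro Bochner_Integration.integrable_sum integrable_radial_gradE sum.cong refl Bochner_Integration.integral_sum)?) auto
  finally show "(LBINT z. radial R w grad z) = (\<Sum>a\<in>S. \<Sum>b\<in>S - {a}. LBINT z. radial R w (gradE a b) z)" .
qed

section \<open>Edge densities as functions of arc length\<close>

definition edge_density :: "complex \<Rightarrow> complex \<Rightarrow> real \<Rightarrow> real" where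
  "edge_density a b t = indicator {t. bisector a b t \<in> vor_edge S a b} t * mu_weight S a b (bisector a b t)"

lemma vor_edge_iff:
  assumes "a \<in> S" "b \<in> S"
  shows "z \<in> vor_edge S a b \<longleftrightarrow> (\<forall>c\<in>S. cmod (z - a) \<le> cmod (z - c)) \<and> (\<forall>c\<in>S. cmod (z - b) \<le> cmod (z - c))"
proof -
  have "Phi S z = cmod (z - a) \<longleftrightarrow> (\<forall>c\<in>S. cmod (z - a) \<le> cmod (z - c))" if "a \<in> S" for a
    unfolding Phi_def using that by (subst Min_eq_iff) auto
  then show ?thesis using assms by (simp add: vor_edge_def)
qed

lemma bisector_measurable [measurable]: "bisector a b \<in> borel_measurable borel"
  unfolding bisector_def by measurable

lemma edge_density_measurable [measurable]:
  assumes "a \<in> S" "b \<in> S"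
  shows "edge_density a b \<in> borel_measurable borel"
proof -
  have "Measurable.pred borel (\<lambda>t. \<forall>c\<in>S. cmod (bisector a b t - a') \<le> cmod (bisector a b t - c))" for a'
    by (intro pred_intros_finite) auto
  then have [measurable]: "{t. bisector a b t \<in> vor_edge S a b} \<in> sets borel"
    unfolding vor_edge_iff[OF assms] by measurable
  show ?thesis unfolding edge_density_def mu_weight_def by measurable
qed

lemma edge_density_nonneg: "edge_density a b t \<ge> 0"
  using omega_pos by (auto simp: edge_density_def mu_weight_def indicator_def)

text \<open>The choice \<open>p = (b - a) / 2\<close> puts the arc length parametrisation of the
  bisector at \<open>s = 1\<close>, so Fubini in the pencil at \<open>a\<close> produces the edge
  integral directly.\<close>

lemma bisector_pencil: "bisector a b t = pencil a ((b - a) / 2) t 1"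
proof -
  have "(b - a) / 2 / of_real (cmod ((b - a) / 2)) = (b - a) / of_real (cmod (b - a))"
    by (simp add: norm_divide)
  then show ?thesis unfolding bisector_def pencil_def
    by (simp add: field_simps)
qed

end

text \<open>Only the sum of the integrals is known to converge. Each of the sequences is increasing
  and bounded by \<open>L\<close> minus the initial values of the others, so it converges by
  itself.\<close>

lemma sum_monotone_convergence:
  fixes f :: "'i \<Rightarrow> nat \<Rightarrow> 'a \<Rightarrow> real"
  assumes I: "finite I" and int: "\<And>i n. i \<in> I \<Longrightarrow> integrable M (f i n)"
    and mono: "\<And>i. i \<in> I \<Longrightarrow> AE x in M. mono (\<lambda>n. f i n x)"
    and lim: "\<And>i. i \<in> I \<Longrightarrow> AE x in M. (\<lambda>n. f i n x) \<longlonglongrightarrow> g i x"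
    and meas: "\<And>i. i \<in> I \<Longrightarrow> g i \<in> borel_measurable M"
    and L: "(\<lambda>n. \<Sum>i\<in>I. LINT x|M. f i n x) \<longlonglongrightarrow> L"
  shows "\<And>i. i \<in> I \<Longrightarrow> integrable M (g i)" and "(\<Sum>i\<in>I. LINT x|M. g i x) = L"
proof -
  define A where "A = (\<lambda>i n. LINT x|M. f i n x)"
  have inc: "incseq (A i)" if "i \<in> I" for i
    unfolding A_def incseq_def
  proof safe
    fix m n :: nat assume "m \<le> n"
    show "(LINT x|M. f i m x) \<le> (LINT x|M. f i n x)"
      using mono[OF that] \<open>m \<le> n\<close> int[OF that]
      by (intro integral_mono_AE) (auto elim!: eventually_mono dest: monoD)
  qed
  have "incseq (\<lambda>n. \<Sum>i\<in>I. A i n)"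
    using inc by (auto simp: incseq_def intro!: sum_mono)
  then have le_L: "(\<Sum>i\<in>I. A i n) \<le> L" for n
    using L by (intro incseq_le) (auto simp: A_def)
  have "\<exists>B. A i \<longlonglongrightarrow> B" if i: "i \<in> I" for i
  proof -
    have "A i n \<le> L - (\<Sum>j\<in>I - {i}. A j 0)" for n
    proof -
      have "A i n + (\<Sum>j\<in>I - {i}. A j 0) \<le> A i n + (\<Sum>j\<in>I - {i}. A j n)"
        using inc by (intro add_left_mono sum_mono) (auto simp: incseq_def)
      also have "\<dots> = (\<Sum>j\<in>I. A j n)" using i I by (subst sum.remove[of I i]) auto
      finally show ?thesis using le_L[of n] by simp
    qed
    with inc[OF i] show ?thesis by (metis incseq_convergent)
  qed
  then obtain B where B: "\<And>i. i \<in> I \<Longrightarrow> A i \<longlonglongrightarrow> B i" by metis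
  show 1: "integrable M (g i)" if "i \<in> I" for i
    using int[OF that] mono[OF that] lim[OF that] B[OF that] meas[OF that]
    unfolding A_def by (rule integrable_monotone_convergence)
  have 2: "(LINT x|M. g i x) = B i" if "i \<in> I" for i
    using int[OF that] mono[OF that] lim[OF that] B[OF that] meas[OF that]
    unfolding A_def by (rule integral_monotone_convergence)
  have "(\<lambda>n. \<Sum>i\<in>I. A i n) \<longlonglongrightarrow> (\<Sum>i\<in>I. B i)" using B by (intro tendsto_sum)
  then have "(\<Sum>i\<in>I. B i) = L" using L by (intro LIMSEQ_unique) (auto simp: A_def)
  then show "(\<Sum>i\<in>I. LINT x|M. g i x) = L" using 2 by simp
qed

lemma integrable_AE_eq:
  fixes f g :: "'a \<Rightarrow> 'b::{banach, second_countable_topology}"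
  assumes "integrable M f" "g \<in> borel_measurable M" "AE x in M. f x = g x"
  shows "integrable M g"
  by (rule Bochner_Integration.integrable_cong_AE_imp[OF assms(1,2)]) (use assms(3) in eventually_elim, simp)

context sites
begin

text \<open>On the ray \<open>a + s * v\<close> the integrand with its Jacobian is
  \<open>- c\<close> times the derivative of \<open>kap R\<close> in \<open>s\<close>, where
  \<open>c\<close> depends only on the ray. If the bisector point \<open>a + v\<close> lies on the
  edge, the ray belongs to the support of \<open>gradE a b\<close> from \<open>s = 1\<close> on,
  otherwise it misses it. Integration from 1 to infinity leaves \<open>c\<close> times the value of
  \<open>kap R\<close> at the edge.\<close>

lemma radial_gradE_edge:
  assumes ab: "a \<in> S" "b \<in> S" "a \<noteq> b" and R: "R > 0"
  shows "integrable lborel (\<lambda>t. edge_density a b t * kap R (cmod (bisector a b t - w)))"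
    and "(LBINT z. radial R w (gradE a b) z) =
      \<omega> * pi * (LBINT t. edge_density a b t * kap R (cmod (bisector a b t - w)))"
proof -
  define p where "p = (b - a) / 2"
  have p: "p \<noteq> 0" using ab by (simp add: p_def)
  have ba: "b - a = 2 * p" by (simp add: p_def)
  let ?J = "radial R w (gradE a b)"
  have J: "integrable lborel ?J" using ab by (intro integrable_radial_gradE)
  note int = integrable_pencil(1)[OF p J, of a]
  note eq = integrable_pencil(2)[OF p J, of a]
  \<comment> \<open>The parameter of the line through \<open>w\<close>. On every other line
    \<open>kap R\<close> is continuous from the bisector outwards.\<close>
  define t0 where "t0 = cmod p * (Im ((w - a) / p) / Re ((w - a) / p))"
  have ae_eq: "AE t in lborel. (LBINT s. \<bar>s\<bar> * cmod p * ?J (pencil a p t s))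
     = \<omega> * pi * (edge_density a b t * kap R (cmod (bisector a b t - w)))"
    using AE_lborel_singleton[of t0] lborel_pair.AE_integrable_fst'[OF int]
  proof eventually_elim
    fix t assume t: "t \<noteq> t0"
      and int_t: "integrable lborel (\<lambda>s. (\<lambda>(t, s). \<bar>s\<bar> * cmod p * ?J (pencil a p t s)) (t, s))"
    define v where "v = p + of_real t * (\<i> * p / of_real (cmod p))"
    have P: "pencil a p t s = a + of_real s * v" for s by (simp add: pencil_def v_def)
    have \<beta>: "bisector a b t = a + v" unfolding bisector_pencil p_def[symmetric] P by simp
    have vp: "v / p = 1 + \<i> * of_real (t / cmod p)"
      unfolding v_def add_divide_distrib using p by simp
    have v: "v \<noteq> 0"
    proof
      assume "v = 0"
      then have "Re (v / p) = 0" by simp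
      then show False unfolding vp by simp
    qed
    have v_sym: "cmod (v - (b - a)) = cmod v"
    proof -
      have eq: "cmod (v / p - 2) = cmod (v / p)" unfolding vp by (simp add: cmod_def)
      have "cmod (v - (b - a)) = cmod (p * (v / p - 2))" using p by (simp add: ba right_diff_distrib mult.commute)
      also have "\<dots> = cmod (p * (v / p))" unfolding norm_mult eq ..
      also have "p * (v / p) = v" using p by simp
      finally show ?thesis .
    qed
    have avoid: "a + of_real s * v \<noteq> w" if "s \<ge> 1" for s
    proof
      assume "a + of_real s * v = w"
      then have "w - a = of_real s * v" by auto
      then have "(w - a) / p = of_real s * (v / p)" by simp
      then have "Re ((w - a) / p) = s" "Im ((w - a) / p) = s * (t / cmod p)"
        unfolding vp by simp_all
      then have "t0 = t" using that p by (simp add: t0_def)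
      with t show False by simp
    qed
    define E where "E \<longleftrightarrow> bisector a b t \<in> vor_edge S a b"
    have E_iff: "E \<longleftrightarrow> (\<forall>c\<in>S - {a}. \<not> 1 < 2 * Re (v / (c - a)))"
    proof -
      have "E \<longleftrightarrow> (\<forall>c\<in>S. cmod v \<le> cmod (v - (c - a)))"
        unfolding E_def vor_edge_iff[OF ab(1,2)] \<beta> using v_sym by (simp add: algebra_simps)
      also have "\<dots> \<longleftrightarrow> (\<forall>c\<in>S - {a}. \<not> cmod (v - (c - a)) < cmod v)" by force
      also have "\<dots> \<longleftrightarrow> (\<forall>c\<in>S - {a}. \<not> 1 < 2 * Re (v / (c - a)))"
        by (intro ball_cong refl) (subst cmod_diff_less_iff, auto)
      finally show ?thesis .
    qed
    have Re_b: "Re (v / (b - a)) = 1 / 2"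
    proof -
      have "v / (b - a) = (v / p) / 2" unfolding ba by simp
      then have "Re (v / (b - a)) = Re ((v / p) / 2)" by (rule arg_cong)
      then show ?thesis unfolding vp by simp
    qed
    \<comment> \<open>Along the ray all real parts scale with \<open>s\<close>, and the one for
      \<open>b\<close> is \<open>s / 2\<close>. So lying beyond the bisector means
      \<open>s > 1\<close>, while maximality of \<open>b\<close> does not depend on
      \<open>s > 0\<close> and amounts to \<open>E\<close>.\<close>
    have behind_iff: "behind a b (a + of_real s * v) \<longleftrightarrow> s > 1 \<and> E" for s
    proof -
      have sc: "Re ((a + of_real s * v - a) / (c - a)) = s * Re (v / (c - a))" for c
      proof -
        have "(a + of_real s * v - a) / (c - a) = of_real s * (v / (c - a))" by simp
        then show ?thesis by (simp only: Re_complex_of_real times_complex.sel Im_complex_of_real)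
      qed
      show ?thesis
      proof (cases "s > 1")
        case True
        then show ?thesis unfolding behind_def sc Re_b E_iff by (auto simp: not_less mult.commute)
      next
        case False
        then show ?thesis unfolding behind_def sc Re_b by auto
      qed
    qed
    show "(LBINT s. \<bar>s\<bar> * cmod p * ?J (pencil a p t s))
      = \<omega> * pi * (edge_density a b t * kap R (cmod (bisector a b t - w)))"
    proof (cases E)
      case False
      then have "?J (pencil a p t s) = 0" for s
        by (simp add: radial_def gradE_def P behind_iff)
      moreover have "edge_density a b t = 0" using False by (simp add: edge_density_def E_def)
      ultimately show ?thesis by simp
    next
      case True
      define D where "D = (\<lambda>s. - (indicator (ball w R) (a + of_real s * v) *
         (Re (cnj v * (a + of_real s * v - w)) / (cmod (a + of_real s * v - w))\<^sup>2)))"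
      define c where "c = cmod p / (cmod v)\<^sup>2"
      \<comment> \<open>From here on the ray is outside the disc and \<open>kap R\<close> vanishes;
        the summand 2 keeps \<open>s1\<close> beyond the starting point 1.\<close>
      define s1 where "s1 = 2 + (R + cmod (a - w)) / cmod v"
      have c: "c \<noteq> 0" using p v by (simp add: c_def)
      have s1: "s1 \<ge> 1" using R v by (simp add: s1_def add_nonneg_nonneg)
      have far: "cmod (a + of_real s * v - w) \<ge> R" if "s \<ge> s1" for s
      proof -
        have "s \<ge> (R + cmod (a - w)) / cmod v" using that by (simp add: s1_def)
        then have "R + cmod (a - w) \<le> s * cmod v" using v by (simp add: pos_divide_le_eq)
        also have "\<dots> \<le> cmod (of_real s * v)" by (simp add: norm_mult mult_right_mono)
        also have "\<dots> \<le> cmod (a + of_real s * v - w) + cmod (a - w)"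
          using norm_triangle_ineq4[of "a + of_real s * v - w" "a - w"] by simp
        finally show ?thesis by simp
      qed
      have form: "\<bar>s\<bar> * cmod p * ?J (pencil a p t s) = indicator {1<..<s1} s * (- c * D s)" for s
      proof (cases "s > 1")
        case s: True
        define Q where "Q = a + of_real s * v - w"
        define N where "N = (cmod (of_real s * v))\<^sup>2"
        define X where "X = Re (cnj v * Q)"
        have N: "N = s\<^sup>2 * (cmod v)\<^sup>2" by (simp add: N_def norm_mult power_mult_distrib)
        have ReQ: "Re (cnj Q * (of_real s * v / of_real N)) = X * (s / N)"
        proof -
          have "cnj Q * (of_real s * v / of_real N) = of_real (s / N) * (cnj Q * v)" by simp
          then have "Re (cnj Q * (of_real s * v / of_real N)) = (s / N) * Re (cnj Q * v)"
            by (metis Re_complex_of_real scaleR_complex.sel(1) scaleR_conv_of_real)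
          also have "Re (cnj Q * v) = X" by (simp add: X_def algebra_simps)
          finally show ?thesis by (simp only: mult.commute)
        qed
        have "gradE a b (a + of_real s * v) = of_real s * v / of_real N"
          using s True by (simp add: gradE_def behind_iff N_def)
        then have "?J (pencil a p t s) = indicator (ball w R) (a + of_real s * v) * (X * (s / N) / (cmod Q)\<^sup>2)"
          unfolding P radial_def Q_def[symmetric] by (simp only: ReQ)
        moreover have "s * cmod p * (s / N) = c" using s v by (simp add: c_def N power2_eq_square)
        ultimately have "\<bar>s\<bar> * cmod p * ?J (pencil a p t s) = c * (indicator (ball w R) (a + of_real s * v) * (X / (cmod Q)\<^sup>2))"
          using s by auto
        then have "\<bar>s\<bar> * cmod p * ?J (pencil a p t s) = - c * D s"
          by (simp add: D_def X_def Q_def)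
        moreover have "D s = 0" if "s \<ge> s1" using far[OF that] by (simp add: D_def dist_norm norm_minus_commute)
        ultimately show ?thesis using s by (auto simp: indicator_def)
      next
        case False
        then show ?thesis by (simp add: radial_def gradE_def P behind_iff)
      qed
      have ID: "set_integrable lborel {1<..<s1} D"
      proof -
        have "integrable lborel (\<lambda>s. (- 1 / c) * (indicator {1<..<s1} s * (- c * D s)))"
          using int_t by (intro integrable_mult_right) (simp only: split_conv form)
        then show ?thesis unfolding set_integrable_def using c by (simp add: mult_ac)
      qed
      have FT: "(LBINT s:{1<..<s1}. D s) =
         kap R (cmod (a + of_real s1 * v - w)) - kap R (cmod (a + of_real 1 * v - w))"
      proof (rule FTC_open_interval[OF s1 _ finite_line_circle[OF v] _ ID])
        show "continuous_on {1..s1} (\<lambda>s. kap R (cmod (a + of_real s * v - w)))"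
          using avoid R by (intro continuous_on_kap_line) auto
        show "((\<lambda>s. kap R (cmod (a + of_real s * v - w))) has_real_derivative D s) (at s)"
          if "s \<in> {1<..<s1} - {s. cmod (a + of_real s * v - w) = R}" for s
          unfolding D_def using avoid[of s] R that by (intro kap_deriv) auto
      qed
      have "(LBINT s. \<bar>s\<bar> * cmod p * ?J (pencil a p t s)) = - c * (LBINT s:{1<..<s1}. D s)"
        unfolding form set_lebesgue_integral_def by (simp add: mult.left_commute)
      also have "\<dots> = c * kap R (cmod (bisector a b t - w))"
        unfolding FT using kap_eq_0[OF R far[of s1]] by (simp add: \<beta>)
      \<comment> \<open>On the bisector both distances equal \<open>cmod v\<close>, and
        \<open>cmod (a - b) = 2 * cmod p\<close>.\<close>
      also have "c = \<omega> * pi * edge_density a b t"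
      proof -
        have "(bisector a b t - a) * (bisector a b t - b) = v * (v - (b - a))" by (simp add: \<beta>)
        then have "edge_density a b t = 1 / (2 * \<omega> * pi) * (cmod (a - b) / (cmod v * cmod (v - (b - a))))"
          using True unfolding edge_density_def E_def mu_weight_def by (simp add: norm_mult)
        also have "cmod (a - b) = 2 * cmod p"
          by (subst norm_minus_commute) (simp add: ba norm_mult)
        finally have ed: "edge_density a b t = 1 / (2 * \<omega> * pi) * (2 * cmod p / (cmod v * cmod v))"
          unfolding v_sym .
        have "x / y = o' * pi * (1 / (2 * o' * pi) * (2 * x / y))" if "o' > 0" for o' x y :: real
          using that by simp
        from this[OF omega_pos] show ?thesis unfolding c_def ed power2_eq_square .
      qed
      finally show ?thesis by simp
    qed
  qed
  have iy: "integrable lborel (\<lambda>t. LBINT s. \<bar>s\<bar> * cmod p * ?J (pencil a p t s))"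
    using lborel_pair.integrable_fst'[OF int] by simp
  have [measurable]: "edge_density a b \<in> borel_measurable borel" using ab by simp
  have "integrable lborel (\<lambda>t. \<omega> * pi * (edge_density a b t * kap R (cmod (bisector a b t - w))))"
    by (rule integrable_AE_eq[OF iy _ ae_eq]) simp
  then show "integrable lborel (\<lambda>t. edge_density a b t * kap R (cmod (bisector a b t - w)))"
    using omega_pos by (subst (asm) integrable_mult_left_iff) auto
  have "(LBINT z. ?J z) = (LBINT t. \<omega> * pi * (edge_density a b t * kap R (cmod (bisector a b t - w))))"
    unfolding eq by (intro integral_cong_AE) (use iy ae_eq in auto)
  then show "(LBINT z. ?J z) =
      \<omega> * pi * (LBINT t. edge_density a b t * kap R (cmod (bisector a b t - w)))"
    by simp
qed

section \<open>Jensen's formula for the Voronoi measure and its limit for large radii\<close>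

definition pairs :: "(complex \<times> complex) set" where
  "pairs = (SIGMA a:S. S - {a})"

lemma finite_pairs [simp]: "finite pairs" by (simp add: pairs_def)

lemma muS_int_eq:
  "muS_int S f = (\<Sum>(a, b)\<in>pairs. LBINT t. edge_density a b t * f (bisector a b t)) / 2"
proof -
  have "{(a, b). a \<in> S \<and> b \<in> S \<and> a \<noteq> b} = pairs" by (auto simp: pairs_def)
  then show ?thesis unfolding muS_int_def edge_density_def by (simp add: mult.assoc)
qed

text \<open>Each edge is reached by rays from both of its sites, and \<open>muS_int\<close> halves
  the sum over ordered pairs; this turns the factor \<open>pi\<close> of a single pair into
  \<open>2 * pi\<close>.\<close>

lemma jensen_Psi:
  assumes R: "R > 0"
  shows "integrable lborel (jensen R (Psi S) w)"
    and "(LBINT y. jensen R (Psi S) w y) = 2 * pi * muS_int S (\<lambda>t. kap R (cmod (t - w)))"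
proof -
  have e: "jensen R (Psi S) w = (\<lambda>y. jensen R psi0 w y / \<omega>)"
    by (simp add: jensen_def Psi_eq_psi0 fun_eq_iff add_divide_distrib diff_divide_distrib left_diff_distrib distrib_right)
  show "integrable lborel (jensen R (Psi S) w)"
    unfolding e by (intro Bochner_Integration.integrable_divide line_green(1)[OF R psi0_measurable radial_grad(1) AE_psi0_line])
  have "(LBINT y. jensen R psi0 w y) = (LBINT z. radial R w grad z)"
    by (rule line_green(2)[OF R psi0_measurable radial_grad(1) AE_psi0_line])
  also have "\<dots> = (\<Sum>a\<in>S. \<Sum>b\<in>S - {a}. LBINT z. radial R w (gradE a b) z)"
    by (rule radial_grad(2))
  also have "\<dots> = (\<Sum>a\<in>S. \<Sum>b\<in>S - {a}. \<omega> * pi * (LBINT t. edge_density a b t * kap R (cmod (bisector a b t - w))))"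
    by (intro sum.cong refl radial_gradE_edge(2) R) auto
  also have "\<dots> = \<omega> * pi * (\<Sum>(a, b)\<in>pairs. LBINT t. edge_density a b t * kap R (cmod (bisector a b t - w)))"
    by (simp add: pairs_def sum.Sigma sum_distrib_left split_beta)
  finally show "(LBINT y. jensen R (Psi S) w y) = 2 * pi * muS_int S (\<lambda>t. kap R (cmod (t - w)))"
    unfolding e muS_int_eq using omega_pos by simp
qed

text \<open>\<open>Psi S z\<close> is the average of log|z - j| over all sites but the nearest, and
  each of these is asymptotic to log|z - w|. Bounding the error by a sum over all of
  \<open>S\<close> removes the dependence on which site is nearest.\<close>

lemma Psi_at_infinity: "((\<lambda>z. Psi S z - ln (cmod (z - w))) \<longlongrightarrow> 0) at_infinity"
proof -
  have l: "((\<lambda>z. ln (cmod (z - j)) - ln (cmod (z - w))) \<longlongrightarrow> 0) at_infinity" for j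
  proof -
    have inf: "filterlim (\<lambda>z. z - w) at_infinity at_infinity"
      using tendsto_add_filterlim_at_infinity[OF tendsto_const[of "- w"] filterlim_ident[of at_infinity]]
      by simp
    have "((\<lambda>z. 1 + (w - j) / (z - w)) \<longlongrightarrow> 1 + 0) at_infinity"
      by (intro tendsto_add tendsto_const tendsto_divide_0[OF tendsto_const inf])
    then have "((\<lambda>z. ln (cmod (1 + (w - j) / (z - w)))) \<longlongrightarrow> ln (cmod (1 + 0))) at_infinity"
      by (intro tendsto_ln tendsto_norm) auto
    moreover have "eventually (\<lambda>z. ln (cmod (1 + (w - j) / (z - w))) = ln (cmod (z - j)) - ln (cmod (z - w))) at_infinity"
    proof -
      have "eventually (\<lambda>z. z \<noteq> w) at_infinity" "eventually (\<lambda>z. z \<noteq> j) at_infinity"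
        using eventually_not_equal_at_infinity by auto
      then show ?thesis
      proof eventually_elim
        fix z assume z: "z \<noteq> w" "z \<noteq> j"
        then have "1 + (w - j) / (z - w) = (z - j) / (z - w)" by (simp add: field_simps)
        then show "ln (cmod (1 + (w - j) / (z - w))) = ln (cmod (z - j)) - ln (cmod (z - w))"
          using z by (simp add: norm_divide ln_div)
      qed
    qed
    ultimately show ?thesis by (simp add: tendsto_cong)
  qed
  have b: "eventually (\<lambda>z. norm (Psi S z - ln (cmod (z - w))) \<le>
      (\<Sum>j\<in>S. \<bar>ln (cmod (z - j)) - ln (cmod (z - w))\<bar>) / \<omega>) at_infinity"
  proof (rule always_eventually, rule allI)
    fix z
    obtain i where i: "i \<in> S" "\<And>b. b \<in> S \<Longrightarrow> cmod (z - i) \<le> cmod (z - b)"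
      using ex_nearest by blast
    have zj: "z \<noteq> j" if "j \<in> S - {i}" for j
    proof
      assume "z = j" then show False using i(2)[of j] that by auto
    qed
    have "psi0 z = ln (\<Prod>j\<in>S - {i}. cmod (z - j))"
      unfolding psi0_def by (subst Max_prod_nearest[OF i]) auto
    also have "\<dots> = (\<Sum>j\<in>S - {i}. ln (cmod (z - j)))"
      using zj by (intro ln_prod) auto
    finally have "psi0 z - \<omega> * ln (cmod (z - w)) = (\<Sum>j\<in>S - {i}. ln (cmod (z - j)) - ln (cmod (z - w)))"
      using i(1) card2 by (simp add: sum_subtractf of_nat_diff algebra_simps)
    also have "\<bar>\<dots>\<bar> \<le> (\<Sum>j\<in>S - {i}. \<bar>ln (cmod (z - j)) - ln (cmod (z - w))\<bar>)" by (rule sum_abs)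
    also have "\<dots> \<le> (\<Sum>j\<in>S. \<bar>ln (cmod (z - j)) - ln (cmod (z - w))\<bar>)" by (intro sum_mono2) auto
    finally have "\<bar>psi0 z - \<omega> * ln (cmod (z - w))\<bar> \<le> (\<Sum>j\<in>S. \<bar>ln (cmod (z - j)) - ln (cmod (z - w))\<bar>)" .
    moreover have "Psi S z - ln (cmod (z - w)) = (psi0 z - \<omega> * ln (cmod (z - w))) / \<omega>"
      unfolding Psi_eq_psi0 using omega_pos by (simp add: field_simps)
    ultimately show "norm (Psi S z - ln (cmod (z - w))) \<le> (\<Sum>j\<in>S. \<bar>ln (cmod (z - j)) - ln (cmod (z - w))\<bar>) / \<omega>"
      using omega_pos by (simp add: abs_divide divide_right_mono)
  qed
  have "((\<lambda>z. (\<Sum>j\<in>S. \<bar>ln (cmod (z - j)) - ln (cmod (z - w))\<bar>) / \<omega>) \<longlongrightarrow> (\<Sum>j\<in>S. \<bar>0\<bar>) / \<omega>) at_infinity"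
    by (intro tendsto_divide tendsto_const tendsto_sum tendsto_rabs l) (use omega_pos in auto)
  then have "((\<lambda>z. (\<Sum>j\<in>S. \<bar>ln (cmod (z - j)) - ln (cmod (z - w))\<bar>) / \<omega>) \<longlongrightarrow> 0) at_infinity" by simp
  from Lim_null_comparison[OF b this] show ?thesis .
qed

text \<open>On a large circle \<open>Psi S\<close> is nearly the constant \<open>ln R\<close>, so
  Jensen's formula evaluates the truncated potential up to a vanishing error.\<close>

lemma muS_kap_asymp:
  "((\<lambda>R. muS_int S (\<lambda>t. kap R (cmod (t - w))) - (ln R - Psi S w)) \<longlongrightarrow> 0) at_top"
proof (rule tendstoI)
  fix e :: real assume e: "e > 0"
  have "eventually (\<lambda>z. \<bar>Psi S z - ln (cmod (z - w))\<bar> < e / 2) at_infinity"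
    using tendstoD[OF Psi_at_infinity, of "e / 2" w] e by simp
  then obtain B where B: "\<And>z. cmod z \<ge> B \<Longrightarrow> \<bar>Psi S z - ln (cmod (z - w))\<bar> < e / 2"
    by (auto simp: eventually_at_infinity)
  show "eventually (\<lambda>R. dist (muS_int S (\<lambda>t. kap R (cmod (t - w))) - (ln R - Psi S w)) 0 < e) at_top"
    using eventually_ge_at_top[of "\<bar>B\<bar> + cmod w + 1"]
  proof eventually_elim
    fix R assume R: "R \<ge> \<bar>B\<bar> + cmod w + 1"
    then have R0: "R > 0" using norm_ge_zero[of w] by linarith
    have far: "\<bar>Psi S (w + z) - ln R\<bar> \<le> e / 2" if "cmod z = R" for z
    proof -
      have "cmod z \<le> cmod (w + z) + cmod w" using norm_triangle_ineq4[of "w + z" w] by simp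
      then have "cmod (w + z) \<ge> B" using that R by linarith
      from B[OF this] that show ?thesis by simp
    qed
    have f: "\<bar>jensen R (Psi S) w y - (2 * ln R - 2 * Psi S w) * inverse (1 + y\<^sup>2)\<bar> \<le> e * inverse (1 + y\<^sup>2)" for y
    proof -
      have "jensen R (Psi S) w y - (2 * ln R - 2 * Psi S w) * inverse (1 + y\<^sup>2)
        = ((Psi S (w + of_real R * dir y) - ln R) + (Psi S (w + - (of_real R * dir y)) - ln R)) * inverse (1 + y\<^sup>2)"
        by (simp add: jensen_def algebra_simps)
      also have "\<bar>\<dots>\<bar> = \<bar>(Psi S (w + of_real R * dir y) - ln R) + (Psi S (w + - (of_real R * dir y)) - ln R)\<bar> * inverse (1 + y\<^sup>2)"
        by (subst abs_mult) (simp add: add_nonneg_nonneg)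
      also have "\<dots> \<le> e * inverse (1 + y\<^sup>2)"
      proof (rule mult_right_mono)
        have "\<bar>Psi S (w + of_real R * dir y) - ln R\<bar> \<le> e / 2" "\<bar>Psi S (w + - (of_real R * dir y)) - ln R\<bar> \<le> e / 2"
          using R0 by (intro far; simp add: norm_mult)+
        then show "\<bar>(Psi S (w + of_real R * dir y) - ln R) + (Psi S (w + - (of_real R * dir y)) - ln R)\<bar> \<le> e"
          by linarith
      qed (simp add: add_nonneg_nonneg)
      finally show ?thesis .
    qed
    have "\<bar>2 * pi * (muS_int S (\<lambda>t. kap R (cmod (t - w))) - (ln R - Psi S w))\<bar>
      = \<bar>LBINT y. jensen R (Psi S) w y - (2 * ln R - 2 * Psi S w) * inverse (1 + y\<^sup>2)\<bar>"
      using jensen_Psi[OF R0, of w] integrable_cauchy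
      by (simp add: integral_cauchy algebra_simps)
    also have "\<dots> \<le> (LBINT y. e * inverse (1 + y\<^sup>2))"
      using f jensen_Psi(1)[OF R0, of w] integrable_cauchy
      by (intro order.trans[OF integral_abs_bound] integral_mono integrable_abs Bochner_Integration.integrable_diff) auto
    also have "\<dots> = e * pi" by (simp add: integral_cauchy)
    finally have "2 * pi * \<bar>muS_int S (\<lambda>t. kap R (cmod (t - w))) - (ln R - Psi S w)\<bar> \<le> e * pi"
      by (simp add: abs_mult)
    then have "pi * (2 * \<bar>muS_int S (\<lambda>t. kap R (cmod (t - w))) - (ln R - Psi S w)\<bar>) \<le> pi * e"
      by (simp add: mult_ac)
    then have "2 * \<bar>muS_int S (\<lambda>t. kap R (cmod (t - w))) - (ln R - Psi S w)\<bar> \<le> e"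
      by (rule mult_left_le_imp_le) simp
    then show "dist (muS_int S (\<lambda>t. kap R (cmod (t - w))) - (ln R - Psi S w)) 0 < e"
      using e by simp
  qed
qed

lemma AE_bisector_ne: 
  assumes "a \<noteq> b"
  shows "AE t in lborel. bisector a b t \<noteq> w"
proof -
  define c where "c = \<i> * (b - a) / of_real (cmod (b - a))"
  have c: "c \<noteq> 0" using assms by (simp add: c_def)
  have bis: "bisector a b t = (a + b) / 2 + of_real t * c" for t
    by (simp add: bisector_def c_def mult.assoc)
  show ?thesis
    using AE_lborel_singleton[of "Re ((w - (a + b) / 2) / c)"]
  proof eventually_elim
    fix t assume t: "t \<noteq> Re ((w - (a + b) / 2) / c)"
    show "bisector a b t \<noteq> w"
    proof
      assume "bisector a b t = w"
      then have "(w - (a + b) / 2) / c = of_real t" unfolding bis using c by (auto simp: field_simps)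
      with t show False by simp
    qed
  qed
qed

lemma pairsD: "(a, b) \<in> pairs \<Longrightarrow> a \<in> S \<and> b \<in> S \<and> a \<noteq> b"
  by (auto simp: pairs_def)

lemma kap_pow2: "x > 0 \<Longrightarrow> kap (2 ^ n) x = max 0 (real n * ln 2 - ln x)"
  by (simp add: kap_def ln_div ln_realpow)

lemma ln_pow2_at_top: "filterlim (\<lambda>n::nat. real n * ln 2 :: real) at_top at_top"
  by (rule filterlim_at_top_mult_tendsto_pos[OF tendsto_const _ filterlim_real_sequentially]) simp

section \<open>Mass and potential of the Voronoi measure\<close>

text \<open>A Bochner integral that does not exist has the value 0, so integrability on each edge is
  recorded separately.\<close>

definition muS_integrable :: "(complex \<Rightarrow> real) \<Rightarrow> bool" where
  "muS_integrable f \<longleftrightarrow>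
     (\<forall>(a, b)\<in>pairs. integrable lborel (\<lambda>t. edge_density a b t * f (bisector a b t)))"

lemma muS_integrableD:
  "muS_integrable f \<Longrightarrow> (a, b) \<in> pairs \<Longrightarrow>
    integrable lborel (\<lambda>t. edge_density a b t * f (bisector a b t))"
  by (auto simp: muS_integrable_def)

lemma muS_int_diff:
  assumes "muS_integrable f" "muS_integrable g"
  shows "muS_integrable (\<lambda>z. f z - g z)"
    and "muS_int S (\<lambda>z. f z - g z) = muS_int S f - muS_int S g"
proof -
  show "muS_integrable (\<lambda>z. f z - g z)"
    using assms by (auto simp: muS_integrable_def right_diff_distrib)
  have "(LBINT t. edge_density a b t * (f (bisector a b t) - g (bisector a b t))) =
      (LBINT t. edge_density a b t * f (bisector a b t)) -
      (LBINT t. edge_density a b t * g (bisector a b t))" if "(a, b) \<in> pairs" for a b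
    using muS_integrableD[OF assms(1) that] muS_integrableD[OF assms(2) that]
    by (simp add: right_diff_distrib)
  then have "(\<Sum>(a, b)\<in>pairs. LBINT t. edge_density a b t * (f (bisector a b t) - g (bisector a b t))) =
      (\<Sum>p\<in>pairs. (case p of (a, b) \<Rightarrow> LBINT t. edge_density a b t * f (bisector a b t)) -
        (case p of (a, b) \<Rightarrow> LBINT t. edge_density a b t * g (bisector a b t)))"
    by (intro sum.cong) auto
  then show "muS_int S (\<lambda>z. f z - g z) = muS_int S f - muS_int S g"
    unfolding muS_int_eq by (simp add: sum_subtractf diff_divide_distrib split_beta)
qed

lemma muS_int_cmult: "muS_int S (\<lambda>t. c * f t) = c * muS_int S f"
proof -
  have "(LBINT t. edge_density a b t * (c * f (bisector a b t))) =
    c * (LBINT t. edge_density a b t * f (bisector a b t))" for a b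
    by (subst integral_mult_right_zero[symmetric]) (simp add: mult.left_commute)
  then show ?thesis by (simp add: muS_int_eq sum_distrib_left split_beta)
qed

lemma AE_edge:
  assumes "p \<in> pairs" "\<And>z. z \<noteq> w \<Longrightarrow> P z"
  shows "AE t in lborel. P (bisector (fst p) (snd p) t)"
proof -
  have "fst p \<noteq> snd p" using assms(1) pairsD[of "fst p" "snd p"] by simp
  from AE_bisector_ne[OF this, of w] show ?thesis
    by eventually_elim (rule assms(2))
qed

text \<open>Each bisector passes through \<open>w\<close> for at most one parameter, so the default
  values of \<open>ln\<close> and \<open>kap\<close> at 0 are invisible to the measure.\<close>

lemma muS_int_cong:
  assumes [measurable]: "f \<in> borel_measurable borel" "g \<in> borel_measurable borel"
    and eq: "\<And>z. z \<noteq> w \<Longrightarrow> f z = g z"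
  shows "muS_int S f = muS_int S g"
proof -
  have "(LBINT t. edge_density a b t * f (bisector a b t)) =
      (LBINT t. edge_density a b t * g (bisector a b t))" if ab: "(a, b) \<in> pairs" for a b
  proof -
    have [measurable]: "edge_density a b \<in> borel_measurable borel" using pairsD[OF ab] by simp
    show ?thesis using AE_edge[OF ab, of w "\<lambda>z. f z = g z", OF eq]
      by (intro integral_cong_AE) auto
  qed
  then show ?thesis unfolding muS_int_eq by (intro arg_cong[where f = "\<lambda>x. x / 2"] sum.cong) auto
qed

lemma muS_integrable_kap: "R > 0 \<Longrightarrow> muS_integrable (\<lambda>z. kap R (cmod (z - w)))"
  unfolding muS_integrable_def using pairsD radial_gradE_edge(1) by auto

lemma muS_monotone_convergence:
  assumes int: "\<And>n. muS_integrable (f n)"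
    and mono: "\<And>z. z \<noteq> w \<Longrightarrow> mono (\<lambda>n. f n z)"
    and lim: "\<And>z. z \<noteq> w \<Longrightarrow> (\<lambda>n. f n z) \<longlonglongrightarrow> g z"
    and [measurable]: "g \<in> borel_measurable borel"
    and L: "(\<lambda>n. muS_int S (f n)) \<longlonglongrightarrow> L"
  shows "muS_integrable g" and "muS_int S g = L"
proof -
  define F where "F = (\<lambda>p n t. edge_density (fst p) (snd p) t * f n (bisector (fst p) (snd p) t))"
  define G where "G = (\<lambda>p t. edge_density (fst p) (snd p) t * g (bisector (fst p) (snd p) t))"
  have 1: "integrable lborel (F p n)" if "p \<in> pairs" for p n
    using muS_integrableD[OF int, of "fst p" "snd p"] that by (simp add: F_def)
  have 2: "AE t in lborel. mono (\<lambda>n. F p n t)" if "p \<in> pairs" for p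
    using AE_edge[OF that, of w "\<lambda>z. mono (\<lambda>n. f n z)", OF mono]
    by (rule eventually_mono) (auto simp: F_def mono_def intro!: mult_left_mono edge_density_nonneg)
  have 3: "AE t in lborel. (\<lambda>n. F p n t) \<longlonglongrightarrow> G p t" if "p \<in> pairs" for p
    using AE_edge[OF that, of w "\<lambda>z. (\<lambda>n. f n z) \<longlonglongrightarrow> g z", OF lim]
    by (rule eventually_mono) (auto simp: F_def G_def intro!: tendsto_mult_left)
  have 4: "G p \<in> borel_measurable lborel" if "p \<in> pairs" for p
    using that pairsD[of "fst p" "snd p"] by (simp add: G_def)
  have "(\<lambda>n. 2 * muS_int S (f n)) \<longlonglongrightarrow> 2 * L" by (intro tendsto_intros L)
  then have 5: "(\<lambda>n. \<Sum>p\<in>pairs. LBINT t. F p n t) \<longlonglongrightarrow> 2 * L"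
    by (simp add: muS_int_eq F_def split_beta)
  note mc = sum_monotone_convergence[OF finite_pairs 1 2 3 4 5]
  have "integrable lborel (G p)" if "p \<in> pairs" for p
    by (rule mc(1)) (use that in auto)
  then show "muS_integrable g" by (force simp: muS_integrable_def G_def)
  have "(\<Sum>p\<in>pairs. LBINT t. G p t) = 2 * L"
    by (rule mc(2)) auto
  then show "muS_int S g = L" by (simp add: muS_int_eq G_def split_beta)
qed

lemma muS_kap_pow2:
  "(\<lambda>n. muS_int S (\<lambda>z. kap (2 ^ n) (cmod (z - w))) - (real n * ln 2 - Psi S w)) \<longlonglongrightarrow> 0"
proof -
  have "filterlim (\<lambda>n::nat. 2 ^ n :: real) at_top sequentially"
    using filterlim_compose[OF exp_at_top ln_pow2_at_top] by (simp add: exp_of_nat_mult)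
  from filterlim_compose[OF muS_kap_asymp[of w] this] show ?thesis by (simp add: ln_realpow)
qed

text \<open>The kernels for the radii \<open>2 ^ Suc n\<close> and \<open>2 ^ n\<close> differ by
  exactly \<open>ln 2\<close> on the smaller punctured disc. Divided by \<open>ln 2\<close>, the
  differences increase to 1, and in their integrals the term \<open>Psi S 0\<close> cancels.\<close>

lemma muS_integrable_1: "muS_integrable (\<lambda>_. 1)"
  and muS_int_1: "muS_int S (\<lambda>_. 1) = 1"
proof -
  define K where "K = (\<lambda>n z. kap (2 ^ n) (cmod (z - (0 :: complex))))"
  define f where "f = (\<lambda>n z. (1 / ln 2) * (K (Suc n) z - K n z))"
  have iK: "muS_integrable (K n)" for n
    unfolding K_def by (rule muS_integrable_kap) simp
  note KK = muS_int_diff[OF iK iK]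
  \<comment> \<open>The expression is \<open>A + l - x\<close> clamped to the interval from 0 to
    \<open>l\<close>, hence increasing in \<open>A\<close>.\<close>
  have aux: "max 0 (A + l - x) - max 0 (A - x) \<le> max 0 (B + l - x) - max 0 (B - x)"
      "x \<le> A \<Longrightarrow> max 0 (A + l - x) - max 0 (A - x) = l"
    if "A \<le> B" "0 \<le> l" for A B l x :: real
    using that by (auto simp: max_def)
  have form: "f n z = (1 / ln 2) * (max 0 (real n * ln 2 + ln 2 - ln (cmod z)) - max 0 (real n * ln 2 - ln (cmod z)))"
    if "z \<noteq> 0" for n z
    using kap_pow2[of "cmod z" "Suc n"] kap_pow2[of "cmod z" n] that
    by (simp add: f_def K_def distrib_right add.commute)
  have int: "muS_integrable (f n)" for n
    using KK(1)[of "Suc n" n]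
    by (auto simp: muS_integrable_def f_def mult.left_commute[of _ "1 / ln 2"] simp del: times_divide_eq_left)
  have mono: "mono (\<lambda>n. f n z)" if "z \<noteq> 0" for z
    unfolding form[OF that] by (intro monoI mult_left_mono aux(1) mult_right_mono) auto
  have lim: "(\<lambda>n. f n z) \<longlonglongrightarrow> 1" if "z \<noteq> 0" for z
  proof (rule tendsto_eventually)
    have "eventually (\<lambda>n. real n * ln 2 \<ge> ln (cmod z)) sequentially"
      using ln_pow2_at_top by (auto simp: filterlim_at_top)
    then show "eventually (\<lambda>n. f n z = 1) sequentially"
      unfolding form[OF that] by eventually_elim (subst aux(2), auto)
  qed
  have mf: "muS_int S (f n) = (1 / ln 2) * (muS_int S (K (Suc n)) - muS_int S (K n))" for n
    unfolding f_def muS_int_cmult KK(2) ..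
  have "(\<lambda>n. (1 / ln 2) * ((muS_int S (K (Suc n)) - (real (Suc n) * ln 2 - Psi S 0)) -
      (muS_int S (K n) - (real n * ln 2 - Psi S 0)) + ln 2)) \<longlonglongrightarrow> (1 / ln 2) * (0 - 0 + ln 2)"
    unfolding K_def
    by (rule tendsto_mult[OF tendsto_const tendsto_add[OF tendsto_diff[OF LIMSEQ_Suc[OF muS_kap_pow2] muS_kap_pow2] tendsto_const]])
  then have L: "(\<lambda>n. muS_int S (f n)) \<longlonglongrightarrow> 1"
    unfolding mf by (simp add: algebra_simps)
  show "muS_integrable (\<lambda>_. 1)" "muS_int S (\<lambda>_. 1) = 1"
    by (rule muS_monotone_convergence[OF int mono lim _ L]; simp)+
qed

lemma integrable_edge_density: "(a, b) \<in> pairs \<Longrightarrow> integrable lborel (edge_density a b)"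
  using muS_integrableD[OF muS_integrable_1] by simp

lemma muS_int_const: "muS_int S (\<lambda>_. c) = c"
  using muS_int_cmult[of c "\<lambda>_. 1"] muS_int_1 by simp

text \<open>Subtracting the difference of the kernels for the radii \<open>2 ^ n\<close> and 1 from
  \<open>n * ln 2\<close> gives the positive part of log|. - w| cut off at \<open>n * ln 2\<close>,
  an increasing sequence. As the mass is 1, the constants \<open>n * ln 2\<close> cancel in the
  integrals; the kernel of radius 1 is the negative part, subtracted at the end.\<close>

lemma muS_potential: "muS_int S (\<lambda>t. ln (cmod (w - t))) = Psi S w"
proof -
  define K where "K = (\<lambda>R z. kap R (cmod (z - w)))"
  define f where "f = (\<lambda>n z. real n * ln 2 - (K (2 ^ n) z - K 1 z))"
  have iK: "muS_integrable (K R)" if "R > 0" for R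
    unfolding K_def by (rule muS_integrable_kap[OF that])
  have ic: "muS_integrable (\<lambda>_. c)" for c
    by (auto simp: muS_integrable_def integrable_edge_density)
  have KK: "muS_integrable (\<lambda>z. K (2 ^ n) z - K 1 z)"
    "muS_int S (\<lambda>z. K (2 ^ n) z - K 1 z) = muS_int S (K (2 ^ n)) - muS_int S (K 1)" for n
    by (rule muS_int_diff; simp add: iK)+
  have f_eq: "f n z = min (real n * ln 2) (max 0 (ln (cmod (z - w))))" if "z \<noteq> w" for n z
  proof -
    have x: "cmod (z - w) > 0" using that by simp
    have "A - (max 0 (A - X) - max 0 (- X)) = min A (max 0 X)" if "A \<ge> 0" for A X :: real
      using that by (auto simp: max_def min_def)
    from this[of "real n * ln 2" "ln (cmod (z - w))"] show ?thesis
      using kap_pow2[OF x, of n] kap_pow2[OF x, of 0] by (simp add: f_def K_def)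
  qed
  have int: "muS_integrable (f n)" for n
    unfolding f_def by (rule muS_int_diff(1)[OF ic KK(1)])
  have mono: "mono (\<lambda>n. f n z)" if "z \<noteq> w" for z
    unfolding f_eq[OF that] by (intro monoI min.mono mult_right_mono) auto
  have lim: "(\<lambda>n. f n z) \<longlonglongrightarrow> max 0 (ln (cmod (z - w)))" if "z \<noteq> w" for z
  proof (rule tendsto_eventually)
    have "eventually (\<lambda>n. real n * ln 2 \<ge> max 0 (ln (cmod (z - w)))) sequentially"
      using ln_pow2_at_top unfolding filterlim_at_top by blast
    then show "eventually (\<lambda>n. f n z = max 0 (ln (cmod (z - w)))) sequentially"
      unfolding f_eq[OF that] by eventually_elim (simp add: min_absorb2)
  qed
  have "muS_int S (f n) = Psi S w + muS_int S (K 1) - (muS_int S (K (2 ^ n)) - (real n * ln 2 - Psi S w))" for n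
    unfolding f_def by (subst muS_int_diff(2)[OF ic KK(1)]) (simp add: KK(2) muS_int_const)
  moreover have "(\<lambda>n. Psi S w + muS_int S (K 1) - (muS_int S (K (2 ^ n)) - (real n * ln 2 - Psi S w)))
      \<longlonglongrightarrow> Psi S w + muS_int S (K 1) - 0"
    unfolding K_def by (intro tendsto_intros muS_kap_pow2)
  ultimately have L: "(\<lambda>n. muS_int S (f n)) \<longlonglongrightarrow> Psi S w + muS_int S (K 1)" by simp
  note mc = muS_monotone_convergence[OF int mono lim _ L]
  have "muS_int S (\<lambda>t. ln (cmod (w - t))) = muS_int S (\<lambda>z. max 0 (ln (cmod (z - w))) - K 1 z)"
  proof (rule muS_int_cong[where w = w])
    show "ln (cmod (w - z)) = max 0 (ln (cmod (z - w))) - K 1 z" if "z \<noteq> w" for z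
      using kap_pow2[of "cmod (z - w)" 0] that by (simp add: K_def norm_minus_commute)
  qed (simp_all add: K_def)
  also have "\<dots> = muS_int S (\<lambda>z. max 0 (ln (cmod (z - w)))) - muS_int S (K 1)"
    by (rule muS_int_diff(2)[OF mc(1)]) (simp_all add: iK)
  also have "muS_int S (\<lambda>z. max 0 (ln (cmod (z - w)))) = Psi S w + muS_int S (K 1)"
    by (rule mc(2)) simp_all
  finally show ?thesis by simp
qed

end

section \<open>Numerators of the derivatives\<close>

text \<open>The numerator over the denominator \<open>P ^ Suc n\<close>. The quotient rule in
  \<open>Qn\<close> squares the denominator each time, which only adds a common factor.\<close>

fun deriv_numer :: "complex poly \<Rightarrow> complex poly \<Rightarrow> nat \<Rightarrow> complex poly" where
  "deriv_numer P R 0 = R"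
| "deriv_numer P R (Suc n) =
     pderiv (deriv_numer P R n) * P - smult (of_nat (Suc n)) (deriv_numer P R n * pderiv P)"

lemma Qn_deriv_numer:
  assumes "P \<noteq> 0"
  shows "\<exists>E. E \<noteq> 0 \<and> Qn R P n = (deriv_numer P R n * E, P ^ Suc n * E)"
proof (induction n)
  case 0
  show ?case by (intro exI[of _ 1]) (simp add: Qn_def)
next
  case (Suc n)
  then obtain E where E: "E \<noteq> 0" "Qn R P n = (deriv_numer P R n * E, P ^ Suc n * E)" by blast
  let ?N = "deriv_numer P R n"
  have "Qn R P (Suc n) = rderiv (?N * E, P ^ Suc n * E)"
    using E(2) by (simp add: Qn_def)
  also have "\<dots> = (deriv_numer P R (Suc n) * (P ^ n * E * E), P ^ Suc (Suc n) * (P ^ n * E * E))"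
    unfolding rderiv_def fst_conv snd_conv pderiv_mult pderiv_power_Suc deriv_numer.simps
    by (simp add: algebra_simps del: of_nat_Suc)
  finally show ?case using E(1) assms by (intro exI[of _ "P ^ n * E * E"]) simp
qed

lemma deriv_numer_add: "deriv_numer P (R + R') n = deriv_numer P R n + deriv_numer P R' n"
  by (induction n) (simp_all add: pderiv_add algebra_simps smult_add_right)

lemma deriv_numer_smult: "deriv_numer P (smult c R) n = smult c (deriv_numer P R n)"
  by (induction n) (simp_all add: pderiv_smult algebra_simps smult_diff_right)

lemma deriv_numer_0: "deriv_numer P 0 n = 0"
  by (induction n) simp_all

lemma deriv_numer_sum: "deriv_numer P (\<Sum>i\<in>I. f i) n = (\<Sum>i\<in>I. deriv_numer P (f i) n)"
  by (induction I rule: infinite_finite_induct) (simp_all add: deriv_numer_add deriv_numer_0)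

text \<open>The polynomial part of \<open>R / P\<close> is differentiated as a polynomial and so
  disappears for \<open>n > degree T\<close>.\<close>

lemma deriv_numer_poly_part: "deriv_numer P (P * T) n = P ^ Suc n * (pderiv ^^ n) T"
proof (induction n)
  case (Suc n)
  show ?case unfolding deriv_numer.simps Suc.IH pderiv_mult pderiv_power_Suc
    by (simp add: algebra_simps del: of_nat_Suc)
qed simp

lemma higher_pderiv_eq_0: "n > degree (p :: complex poly) \<Longrightarrow> (pderiv ^^ n) p = 0"
  by (rule poly_eqI) (simp add: coeff_higher_pderiv coeff_eq_0)

text \<open>Here q/P = 1/(c (z - a)), whose n-th derivative (-1)^n n! / (c (z - a)^(n+1)) is brought
  to the denominator \<open>P ^ Suc n\<close>.\<close>

lemma deriv_numer_simple_pole: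
  assumes P: "P = smult c (q * [:-a, 1:])"
  shows "deriv_numer P q n = smult ((-1) ^ n * fact n * c ^ n) (q ^ Suc n)"
proof (induction n)
  case (Suc n)
  define k where "k = (-1) ^ n * fact n * c ^ n"
  have dP: "pderiv P = smult c (pderiv q * [:-a, 1:] + q)"
    unfolding P pderiv_smult pderiv_mult by (simp add: pderiv_pCons add.commute)
  have "deriv_numer P q (Suc n) = smult k (pderiv (q ^ Suc n) * P - smult (of_nat (Suc n)) (q ^ Suc n * pderiv P))"
    unfolding deriv_numer.simps Suc.IH k_def[symmetric]
    by (simp add: pderiv_smult smult_diff_right mult_ac del: of_nat_Suc)
  also have "pderiv (q ^ Suc n) * P - smult (of_nat (Suc n)) (q ^ Suc n * pderiv P)
    = smult (- (of_nat (Suc n) * c)) (q ^ Suc (Suc n))"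
  proof -
    have alg: "smult m u * v * smult c (q * X) - smult m (q * u * smult c (v * X + q)) = smult (- (m * c)) (q * q * u)"
      for m u v X by (simp add: algebra_simps smult_add_right smult_diff_right)
    show ?thesis
      unfolding pderiv_power_Suc dP
      by (subst P) (use alg[of "of_nat (Suc n)" "q ^ n" "pderiv q" "[:-a, 1:]"] in \<open>simp only: power_Suc mult.assoc\<close>)
  qed
  also have "smult k \<dots> = smult ((-1) ^ Suc n * fact (Suc n) * c ^ Suc n) (q ^ Suc (Suc n))"
    by (simp add: k_def mult_ac del: of_nat_Suc)
  finally show ?case .
qed simp

lemma coeff_mult_at_bounds:
  fixes p q :: "'a::comm_semiring_0 poly"
  assumes "degree p \<le> m" "degree q \<le> n"
  shows "coeff (p * q) (m + n) = coeff p m * coeff q n"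
proof -
  have "coeff (p * q) (m + n) = (\<Sum>i\<le>m + n. coeff p i * coeff q (m + n - i))" by (rule coeff_mult)
  also have "\<dots> = (\<Sum>i\<in>{m}. coeff p i * coeff q (m + n - i))"
  proof (rule sum.mono_neutral_right)
    show "\<forall>i\<in>{..m + n} - {m}. coeff p i * coeff q (m + n - i) = 0"
    proof
      fix i assume "i \<in> {..m + n} - {m}"
      then have "i < m \<or> i > m" by auto
      then show "coeff p i * coeff q (m + n - i) = 0"
        using assms by (auto simp: coeff_eq_0)
    qed
  qed auto
  finally show ?thesis by simp
qed

text \<open>The operator X d/dX is diagonal on monomials; working with it avoids the truncated
  subtraction in the degree of a derivative.\<close>

lemma coeff_X_pderiv: "coeff (pCons 0 (pderiv p)) n = of_nat n * coeff p n"
  by (cases n) (simp_all add: coeff_pderiv)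

lemma degree_X_pderiv: "degree (pCons 0 (pderiv p)) \<le> degree p"
  by (rule degree_le) (simp add: coeff_X_pderiv coeff_eq_0 del: coeff_pCons)

text \<open>The factors \<open>degree R - degree P - m\<close> never vanish: below the order of the pole there is no
  cancellation of leading terms in the quotient rule.\<close>

lemma deriv_numer_degree:
  assumes P: "degree P = d" "d \<ge> 1" and R: "R \<noteq> 0" "degree R = r" "r < d"
  shows "degree (deriv_numer P R n) = r + n * (d - 1) \<and>
    coeff (deriv_numer P R n) (r + n * (d - 1)) =
      lead_coeff R * lead_coeff P ^ n * (\<Prod>m<n. of_nat r - of_nat d - of_nat m)"
proof (induction n)
  case 0
  then show ?case using R by simp
next
  case (Suc n)
  define N where "N = deriv_numer P R n"
  define e where "e = r + n * (d - 1)"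
  have e: "degree N = e" using Suc.IH by (simp add: N_def e_def)
  have Suc_e: "Suc (r + Suc n * (d - 1)) = e + d" using P by (simp add: e_def)
  define N' where "N' = deriv_numer P R (Suc n)"
  have N': "pCons 0 N' = pCons 0 (pderiv N) * P - smult (of_nat (Suc n)) (N * pCons 0 (pderiv P))"
    unfolding N'_def deriv_numer.simps N_def[symmetric] by (simp add: algebra_simps smult_diff_right)
  have c1: "coeff (pCons 0 (pderiv N) * P) (e + d) = of_nat e * coeff N e * lead_coeff P"
    using degree_X_pderiv[of N] P e
    by (subst coeff_mult_at_bounds) (auto simp: coeff_X_pderiv simp del: coeff_pCons)
  have c2: "coeff (N * pCons 0 (pderiv P)) (e + d) = coeff N e * (of_nat d * lead_coeff P)"
    using degree_X_pderiv[of P] P e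
    by (subst coeff_mult_at_bounds) (auto simp: coeff_X_pderiv simp del: coeff_pCons)
  have "coeff N' (r + Suc n * (d - 1)) = coeff (pCons 0 N') (e + d)"
    unfolding Suc_e[symmetric] by simp
  also have "\<dots> = coeff N e * lead_coeff P * (of_nat e - of_nat (Suc n) * of_nat d)"
    unfolding N' coeff_diff coeff_smult c1 c2 by (simp add: algebra_simps)
  also have "(of_nat e - of_nat (Suc n) * of_nat d :: complex) = of_nat r - of_nat d - of_nat n"
  proof -
    have "(of_nat e :: complex) = of_nat r + of_nat n * (of_nat d - 1)"
      unfolding e_def of_nat_add of_nat_mult using P by (simp add: of_nat_diff)
    then show ?thesis by (simp add: algebra_simps)
  qed
  finally have coeff: "coeff N' (r + Suc n * (d - 1)) = coeff N e * lead_coeff P * (of_nat r - of_nat d - of_nat n)" .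
  have N_e: "coeff N e = lead_coeff R * lead_coeff P ^ n * (\<Prod>m<n. of_nat r - of_nat d - of_nat m)"
    using Suc.IH by (simp add: N_def e_def)
  have ne: "(of_nat r - of_nat d - of_nat m :: complex) \<noteq> 0" for m
  proof -
    have "(of_nat r - of_nat d - of_nat m :: complex) = - of_nat (d - r + m)"
      using R by (simp add: of_nat_diff)
    moreover have "d - r + m \<noteq> 0" using R by simp
    ultimately show ?thesis by (simp only: neg_equal_0_iff_equal of_nat_eq_0_iff) simp
  qed
  have "lead_coeff P \<noteq> 0" using P by auto
  then have nz: "coeff N' (r + Suc n * (d - 1)) \<noteq> 0"
    unfolding coeff N_e using ne R by auto
  have "degree (pCons 0 N') \<le> e + d"
    unfolding N' using degree_X_pderiv[of N] degree_X_pderiv[of P] P e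
    by (intro degree_diff_le order.trans[OF degree_smult_le] order.trans[OF degree_mult_le] add_mono) auto
  then have "degree N' \<le> r + Suc n * (d - 1)"
    unfolding Suc_e[symmetric] by (cases "N' = 0") auto
  with nz have "degree N' = r + Suc n * (d - 1)" by (simp add: le_antisym le_degree)
  then show ?case unfolding N'_def[symmetric] coeff N_e by (simp add: mult_ac)
qed

text \<open>Lower and upper bounds that differ by a power of \<open>n\<close>: on the scale \<open>1 / n\<close> the leading
  coefficient does not influence the logarithmic potentials.\<close>

lemma rising_ratio_bounds:
  assumes "k \<ge> 1"
  shows "1 \<le> (\<Prod>m<n. (real k + real m) / real (Suc m))"
    and "(\<Prod>m<n. (real k + real m) / real (Suc m)) \<le> real (Suc n) ^ k"
proof -
  show "1 \<le> (\<Prod>m<n. (real k + real m) / real (Suc m))"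
    using assms by (intro prod_ge_1) auto
  show "(\<Prod>m<n. (real k + real m) / real (Suc m)) \<le> real (Suc n) ^ k"
  proof (induction n)
    case (Suc n)
    \<comment> \<open>Bernoulli's inequality absorbs the next factor into the quotient of
      consecutive \<open>k\<close>-th powers.\<close>
    have "(real k + real n) / real (Suc n) \<le> 1 + real k * (1 / real (Suc n))"
      by (simp add: field_simps)
    also have "\<dots> \<le> (1 + 1 / real (Suc n)) ^ k"
      by (rule Bernoulli_inequality) (simp add: field_simps)
    also have "1 + 1 / real (Suc n) = real (Suc (Suc n)) / real (Suc n)"
      by (simp add: field_simps)
    finally have *: "(real k + real n) / real (Suc n) \<le> (real (Suc (Suc n)) / real (Suc n)) ^ k" .
    have "(\<Prod>m<Suc n. (real k + real m) / real (Suc m)) \<le> real (Suc n) ^ k * (real (Suc (Suc n)) / real (Suc n)) ^ k"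
      unfolding prod.lessThan_Suc using Suc.IH *
      by (intro mult_mono) (simp_all add: divide_nonneg_nonneg del: of_nat_Suc)
    also have "\<dots> = real (Suc (Suc n)) ^ k"
      by (simp add: power_divide del: of_nat_Suc)
    finally show ?case .
  qed simp
qed

section \<open>Zero counting and the numerator in lowest terms\<close>

definition zc_mean :: "complex poly \<Rightarrow> (complex \<Rightarrow> real) \<Rightarrow> real" where
  "zc_mean N f = (\<Sum>a\<in>{z. poly N z = 0}. real (order a N) * f a) / real (degree N)"

lemma zc_int_eq: "zc_int F f = zc_mean (red_numer F) f"
  by (simp add: zc_int_def zc_mean_def Let_def)

lemma zc_mean_smult: "c \<noteq> 0 \<Longrightarrow> zc_mean (smult c N) f = zc_mean N f"
  by (simp add: zc_mean_def order_smult)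

lemma coprime_if_no_common_root:
  fixes p q :: "complex poly"
  assumes "q \<noteq> 0" "\<And>a. poly q a = 0 \<Longrightarrow> poly p a \<noteq> 0"
  shows "coprime p q"
proof (rule coprimeI)
  fix c assume c: "c dvd p" "c dvd q"
  show "is_unit c"
  proof (rule ccontr)
    assume "\<not> is_unit c"
    moreover have "c \<noteq> 0" using c assms by auto
    ultimately have "degree c \<noteq> 0" by (simp add: is_unit_iff_degree)
    then have "\<not> constant (poly c)" by (simp add: constant_degree)
    then obtain a where "poly c a = 0" using fundamental_theorem_of_algebra by blast
    then have "poly q a = 0" "poly p a = 0" using c by (auto simp: dvd_def)
    then show False using assms(2) by blast
  qed
qed

text \<open>The \<open>gcd\<close> is normalised to be monic, so cancelling \<open>E\<close> leaves
  its leading coefficient, a constant that does not move the zeros.\<close>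

lemma red_numer_common_factor:
  fixes M D E :: "complex poly"
  assumes "coprime M D" "E \<noteq> 0"
  shows "\<exists>k. k \<noteq> 0 \<and> red_numer (M * E, D * E) = smult k M"
proof -
  have "gcd (M * E) (D * E) = normalize E"
    using assms(1) by (simp add: gcd_mult_right coprime_iff_gcd_eq_1 gcd.commute)
  then have "red_numer (M * E, D * E) = M * E div normalize E"
    by (simp add: red_numer_def)
  also have "\<dots> = M * (E div normalize E)"
    by (rule div_mult_swap[symmetric]) simp
  also have "\<dots> = smult (lead_coeff E) M"
    by (simp add: unit_factor_poly_def monom_0)
  finally show ?thesis using assms(2) by (intro exI[of _ "lead_coeff E"]) simp
qed

text \<open>Up to a constant, the numerator of the n-th derivative of the partial fractions sum of
  \<open>c i / (z - i)\<close> over the common denominator, the product of all (z -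
  j)^(n+1).\<close>

definition numer_sum :: "complex set \<Rightarrow> (complex \<Rightarrow> complex) \<Rightarrow> nat \<Rightarrow> complex poly" where
  "numer_sum S c n = (\<Sum>i\<in>S. smult (c i) ((\<Prod>j\<in>S - {i}. [:-j, 1:]) ^ Suc n))"

text \<open>Once \<open>n > degree (R div P)\<close>, only the partial fractions of
  \<open>R mod P\<close> remain. Leading terms may cancel in their sum, so degree and leading
  coefficient are taken from the quotient rule instead; \<open>r\<close> is the degree of
  \<open>R mod P\<close>.\<close>

lemma Qn_structure:
  fixes R P :: "complex poly"
  assumes cop: "coprime R P" and P: "degree P = d" "d \<ge> 2"
    and card: "card {z. poly P z = 0} = d" and S_def: "S = {z. poly P z = 0}"
  shows "\<exists>c r k C n0. (\<forall>i\<in>S. c i \<noteq> 0) \<and> C > 0 \<and> (\<forall>n\<ge>n0.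
     (\<forall>f. zc_int (Qn R P n) f = zc_mean (numer_sum S c n) f) \<and>
     degree (numer_sum S c n) = r + n * (d - 1) \<and>
     C \<le> cmod (lead_coeff (numer_sum S c n)) \<and>
     cmod (lead_coeff (numer_sum S c n)) \<le> C * real (Suc n) ^ k)"
proof -
  define l where "l = lead_coeff P"
  define q where "q = (\<lambda>i. \<Prod>j\<in>S - {i}. [:-j, 1:])"
  have P0: "P \<noteq> 0" and l: "l \<noteq> 0" using P by (auto simp: l_def)
  have fin: "finite S" unfolding S_def using P0 by (rule poly_roots_finite)
  \<comment> \<open>The two sides have equal degree and leading coefficient, so their difference has
    degree below \<open>d\<close>; with its \<open>d\<close> zeros it must vanish.\<close>
  have P_prod: "P = smult l (\<Prod>j\<in>S. [:-j, 1:])"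
  proof (rule ccontr)
    assume ne: "P \<noteq> smult l (\<Prod>j\<in>S. [:-j, 1:])"
    define D where "D = P - smult l (\<Prod>j\<in>S. [:-j, 1:])"
    have deg: "degree (\<Prod>j\<in>S. [:-j, 1:]) = d"
      using card by (subst degree_prod_eq_sum_degree) (auto simp: S_def)
    have "lead_coeff (\<Prod>j\<in>S. [:-j, 1:]) = 1" by (simp add: lead_coeff_prod)
    then have "coeff D d = 0" using deg P by (simp add: D_def l_def)
    moreover have "degree D \<le> d" unfolding D_def using deg P l by (intro degree_diff_le) auto
    moreover have "D \<noteq> 0" using ne by (simp add: D_def)
    ultimately have "degree D < d" by (metis le_neq_implies_less leading_coeff_0_iff)
    have "S \<subseteq> {z. poly D z = 0}" using fin by (auto simp: D_def S_def poly_prod)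
    then have "d \<le> card {z. poly D z = 0}"
      using card \<open>D \<noteq> 0\<close> poly_roots_finite[of D] by (metis S_def card_mono)
    with card_poly_roots_bound[OF \<open>D \<noteq> 0\<close>] \<open>degree D < d\<close> show False by simp
  qed
  have P_q: "P = smult l (q i * [:-i, 1:])" if "i \<in> S" for i
    using P_prod that fin prod.remove[of S i "\<lambda>j. [:-j, 1:]"] by (simp add: q_def mult.commute del: mult_pCons_left mult_pCons_right)
  have q_self: "poly (q i) i \<noteq> 0" for i using fin by (simp add: q_def poly_prod)
  have q_other: "poly (q i) a = 0" if "a \<in> S" "a \<noteq> i" for a i
    using fin that by (auto simp: q_def poly_prod)
  have Ra: "poly R a \<noteq> 0" if "a \<in> S" for a
  proof
    assume "poly R a = 0"
    then have "[:-a, 1:] dvd R" "[:-a, 1:] dvd P" using that by (auto simp: S_def poly_eq_0_iff_dvd)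
    then have "is_unit [:-a, 1:]" using cop coprime_common_divisor by blast
    then show False by (simp add: is_unit_iff_degree)
  qed
  have dPa: "poly (pderiv P) a \<noteq> 0" if "a \<in> S" for a
  proof -
    have "pderiv P = smult l (pderiv (q a) * [:-a, 1:] + q a)"
      by (subst P_q[OF that], unfold pderiv_smult pderiv_mult) (simp add: pderiv_pCons add.commute)
    then show ?thesis using l q_self by simp
  qed
  \<comment> \<open>At a simple zero of \<open>P\<close> the recursion only multiplies by
    \<open>- of_nat (Suc n) * poly (pderiv P) a\<close>. Hence the fraction over
    \<open>P ^ Suc n\<close> is already in lowest terms.\<close>
  have Ma: "poly (deriv_numer P R n) a \<noteq> 0" if "a \<in> S" for a n
  proof (induction n)
    case (Suc n)
    have "poly P a = 0" using that by (simp add: S_def)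
    then show ?case using Suc dPa[OF that] by (simp del: of_nat_Suc)
  qed (use Ra[OF that] in simp)
  have red: "zc_int (Qn R P n) f = zc_mean (deriv_numer P R n) f" for n f
  proof -
    obtain E where E: "E \<noteq> 0" "Qn R P n = (deriv_numer P R n * E, P ^ Suc n * E)"
      using Qn_deriv_numer[OF P0] by blast
    have "coprime (deriv_numer P R n) (P ^ Suc n)"
      using P0 Ma by (intro coprime_if_no_common_root) (auto simp: S_def)
    from red_numer_common_factor[OF this E(1)] E(2) show ?thesis
      by (metis zc_int_eq zc_mean_smult)
  qed
  \<comment> \<open>Lagrange interpolation: with these coefficients the sum agrees with
    \<open>R\<close>, hence with \<open>R mod P\<close>, at the \<open>d\<close> sites, and both
    have degree below \<open>d\<close>.\<close>
  define c where "c = (\<lambda>i. poly R i / poly (q i) i)"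
  have c: "\<forall>i\<in>S. c i \<noteq> 0" using Ra q_self by (simp add: c_def)
  define T where "T = R div P"
  define R0 where "R0 = R mod P"
  have R_eq: "R = P * T + R0" by (simp add: T_def R0_def)
  have R0_sum: "R0 = (\<Sum>i\<in>S. smult (c i) (q i))"
  proof (rule poly_eqI_degree[of S])
    fix a assume a: "a \<in> S"
    have "poly (\<Sum>i\<in>S. smult (c i) (q i)) a = (\<Sum>i\<in>S. c i * poly (q i) a)" by (simp add: poly_sum)
    also have "\<dots> = c a * poly (q a) a"
    proof -
      have "(\<Sum>i\<in>S - {a}. c i * poly (q i) a) = 0"
        using q_other[OF a] by (intro sum.neutral) fastforce
      then show ?thesis by (subst sum.remove[OF fin a]) simp
    qed
    also have "\<dots> = poly R a" using q_self by (simp add: c_def)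
    also have "\<dots> = poly R0 a" using a by (subst R_eq) (simp add: S_def)
    finally show "poly R0 a = poly (\<Sum>i\<in>S. smult (c i) (q i)) a" ..
  next
    show "degree R0 < card S"
      using degree_mod_less[OF P0, of R] P card by (auto simp: R0_def S_def)
    have "degree (q i) \<le> d - 1" if "i \<in> S" for i
      using that card fin unfolding q_def by (subst degree_prod_eq_sum_degree) (auto simp: S_def)
    then have "degree (\<Sum>i\<in>S. smult (c i) (q i)) \<le> d - 1"
      using fin by (intro degree_sum_le) (auto intro: order.trans[OF degree_smult_le])
    then show "degree (\<Sum>i\<in>S. smult (c i) (q i)) < card S" using P card by (auto simp: S_def)
  qed
  have R0_ne: "R0 \<noteq> 0"
  proof
    assume R00: "R0 = 0"
    obtain a where a: "a \<in> S"
      using card P fin by (metis S_def card.empty ex_in_conv not_numeral_le_zero)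
    have "poly R a = 0" using a by (subst R_eq) (simp add: S_def R00)
    with Ra[OF a] show False ..
  qed
  define r where "r = degree R0"
  have r: "r < d" using degree_mod_less[OF P0, of R] P R0_ne by (auto simp: R0_def r_def)
  \<comment> \<open>The order of vanishing of \<open>R0 / P\<close> at infinity. The factors in the
    leading coefficient have modulus \<open>k + m\<close>, and \<open>fact n\<close> divides out to
    leave the product in \<open>rising_ratio_bounds\<close>.\<close>
  define k where "k = d - r"
  have k: "k \<ge> 1" using r by (simp add: k_def)
  have M_eq: "deriv_numer P R n = smult ((-1) ^ n * fact n * l ^ n) (numer_sum S c n)" if "n > degree T" for n
  proof -
    have "deriv_numer P R n = deriv_numer P R0 n"
      using that by (subst R_eq) (simp add: deriv_numer_add deriv_numer_poly_part higher_pderiv_eq_0)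
    also have "\<dots> = (\<Sum>i\<in>S. smult (c i) (deriv_numer P (q i) n))"
      by (simp add: R0_sum deriv_numer_sum deriv_numer_smult)
    also have "\<dots> = (\<Sum>i\<in>S. smult ((-1) ^ n * fact n * l ^ n) (smult (c i) (q i ^ Suc n)))"
      by (intro sum.cong refl) (simp add: deriv_numer_simple_pole[OF P_q] mult.commute del: power_Suc)
    also have "\<dots> = smult ((-1) ^ n * fact n * l ^ n) (\<Sum>i\<in>S. smult (c i) (q i ^ Suc n))"
      using fin by (induction S rule: finite_induct) (simp_all add: smult_add_right del: power_Suc)
    finally show ?thesis by (simp add: numer_sum_def q_def del: power_Suc)
  qed
  define C where "C = cmod (lead_coeff R0)"
  have C: "C > 0" using R0_ne by (simp add: C_def)
  have main: "(\<forall>f. zc_int (Qn R P n) f = zc_mean (numer_sum S c n) f) \<and>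
     degree (numer_sum S c n) = r + n * (d - 1) \<and>
     C \<le> cmod (lead_coeff (numer_sum S c n)) \<and>
     cmod (lead_coeff (numer_sum S c n)) \<le> C * real (Suc n) ^ k" if n: "n \<ge> Suc (degree T)" for n
  proof -
    define \<kappa> where "\<kappa> = (-1) ^ n * fact n * l ^ n"
    have \<kappa>: "\<kappa> \<noteq> 0" using l by (simp add: \<kappa>_def)
    have M: "deriv_numer P R n = smult \<kappa> (numer_sum S c n)" using M_eq[of n] n by (simp add: \<kappa>_def)
    have M0: "deriv_numer P R n = deriv_numer P R0 n"
      using n by (subst R_eq) (simp add: deriv_numer_add deriv_numer_poly_part higher_pderiv_eq_0)
    have dl: "degree (deriv_numer P R0 n) = r + n * (d - 1) \<and>
      coeff (deriv_numer P R0 n) (r + n * (d - 1)) = lead_coeff R0 * l ^ n * (\<Prod>m<n. of_nat r - of_nat d - of_nat m)"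
      unfolding l_def using P R0_ne r by (intro deriv_numer_degree) (auto simp: r_def)
    have deg: "degree (numer_sum S c n) = r + n * (d - 1)"
      using dl \<kappa> unfolding M0[symmetric] M by simp
    have "\<kappa> * lead_coeff (numer_sum S c n) = lead_coeff R0 * l ^ n * (\<Prod>m<n. of_nat r - of_nat d - of_nat m)"
      using dl unfolding M0[symmetric] M deg by simp
    then have "cmod \<kappa> * cmod (lead_coeff (numer_sum S c n)) = C * cmod l ^ n * (\<Prod>m<n. cmod (of_nat r - of_nat d - of_nat m))"
      by (metis C_def norm_mult norm_power prod_norm)
    also have "(\<Prod>m<n. cmod (of_nat r - of_nat d - of_nat m)) = (\<Prod>m<n. real k + real m)"
    proof (intro prod.cong refl)
      fix m
      have "(of_nat r - of_nat d - of_nat m :: complex) = - of_nat (k + m)"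
        using r by (simp add: k_def of_nat_diff)
      then have "cmod (of_nat r - of_nat d - of_nat m) = cmod (of_nat (k + m))"
        by (simp only: norm_minus_cancel)
      also have "\<dots> = real k + real m" by (subst norm_of_nat) simp
      finally show "cmod (of_nat r - of_nat d - of_nat m) = real k + real m" .
    qed
    also have "\<dots> = fact n * (\<Prod>m<n. (real k + real m) / real (Suc m))"
      by (simp add: prod_dividef fact_prod_Suc atLeast0LessThan)
    finally have "(fact n * cmod l ^ n) * cmod (lead_coeff (numer_sum S c n)) =
        (fact n * cmod l ^ n) * (C * (\<Prod>m<n. (real k + real m) / real (Suc m)))"
      by (simp add: \<kappa>_def norm_mult norm_power)
    then have lc: "cmod (lead_coeff (numer_sum S c n)) = C * (\<Prod>m<n. (real k + real m) / real (Suc m))"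
      using l by (subst (asm) mult_cancel_left) auto
    show ?thesis unfolding lc
      using deg C rising_ratio_bounds[OF k, of n] red zc_mean_smult[OF \<kappa>] by (auto simp: M)
  qed
  show ?thesis using c C main by blast
qed

section \<open>Convergence of the potentials\<close>

lemma sum_order_complex:
  fixes N :: "complex poly"
  assumes "N \<noteq> 0"
  shows "(\<Sum>a\<in>{z. poly N z = 0}. order a N) = degree N"
proof -
  have "degree N = degree (smult (lead_coeff N) (\<Prod>z\<in>{z. poly N z = 0}. [:-z, 1:] ^ order z N))"
    by (subst complex_poly_decompose) simp
  also have "\<dots> = degree (\<Prod>z\<in>{z. poly N z = 0}. [:-z, 1:] ^ order z N)"
    using assms by simp
  also have "\<dots> = (\<Sum>z\<in>{z. poly N z = 0}. order z N)"
    by (subst degree_prod_eq_sum_degree) (simp_all add: degree_power_eq)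
  finally show ?thesis ..
qed

lemma zc_mean_const:
  assumes "degree N > 0"
  shows "zc_mean N (\<lambda>_. c) = c"
proof -
  have "N \<noteq> 0" using assms by auto
  then have "(\<Sum>a\<in>{z. poly N z = 0}. real (order a N) * c) = real (degree N) * c"
    by (simp flip: sum_order_complex sum_distrib_right)
  then show ?thesis using assms by (simp add: zc_mean_def)
qed

lemma zc_mean_add: "zc_mean N (\<lambda>t. f t + g t) = zc_mean N f + zc_mean N g"
  by (simp add: zc_mean_def distrib_left sum.distrib add_divide_distrib)

lemma zc_mean_diff: "zc_mean N (\<lambda>t. f t - g t) = zc_mean N f - zc_mean N g"
  by (simp add: zc_mean_def right_diff_distrib sum_subtractf diff_divide_distrib)

lemma zc_mean_cmult: "zc_mean N (\<lambda>t. c * f t) = c * zc_mean N f"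
  by (simp add: zc_mean_def sum_distrib_left mult.left_commute)

lemma zc_mean_mono: "(\<And>t. f t \<le> g t) \<Longrightarrow> zc_mean N f \<le> zc_mean N g"
  unfolding zc_mean_def by (intro divide_right_mono sum_mono mult_left_mono) auto

lemma zc_mean_nonneg: "(\<And>t. 0 \<le> f t) \<Longrightarrow> 0 \<le> zc_mean N f"
  unfolding zc_mean_def by (intro divide_nonneg_nonneg sum_nonneg mult_nonneg_nonneg) auto

lemma zc_mean_diff_le:
  assumes "\<And>t. \<bar>f t - g t\<bar> \<le> h t"
  shows "\<bar>zc_mean N f - zc_mean N g\<bar> \<le> zc_mean N h"
proof -
  have "f t - g t \<le> h t" "g t - f t \<le> h t" for t using assms[of t] by auto
  then have "zc_mean N (\<lambda>t. f t - g t) \<le> zc_mean N h" "zc_mean N (\<lambda>t. g t - f t) \<le> zc_mean N h"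
    by (auto intro!: zc_mean_mono)
  then show ?thesis by (simp add: zc_mean_diff abs_le_iff)
qed

lemma ln_cmod_poly:
  fixes N :: "complex poly"
  assumes "poly N z \<noteq> 0"
  shows "ln (cmod (poly N z)) = ln (cmod (lead_coeff N)) + real (degree N) * zc_mean N (\<lambda>t. ln (cmod (z - t)))"
proof -
  have N0: "N \<noteq> 0" using assms by auto
  then have fin: "finite {z. poly N z = 0}" by (rule poly_roots_finite)
  have ne: "z \<noteq> a" if "a \<in> {z. poly N z = 0}" for a using assms that by auto
  have "poly N z = poly (smult (lead_coeff N) (\<Prod>z\<in>{z. poly N z = 0}. [:-z, 1:] ^ order z N)) z"
    by (subst complex_poly_decompose) simp
  also have "\<dots> = lead_coeff N * (\<Prod>a\<in>{z. poly N z = 0}. (z - a) ^ order a N)"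
    by (simp add: poly_prod poly_power)
  finally have "cmod (poly N z) = cmod (lead_coeff N) * (\<Prod>a\<in>{z. poly N z = 0}. cmod (z - a) ^ order a N)"
    by (simp add: norm_mult norm_power flip: prod_norm)
  then have "ln (cmod (poly N z)) = ln (cmod (lead_coeff N)) + ln (\<Prod>a\<in>{z. poly N z = 0}. cmod (z - a) ^ order a N)"
    using N0 ne fin by (simp add: ln_mult)
  also have "ln (\<Prod>a\<in>{z. poly N z = 0}. cmod (z - a) ^ order a N) = (\<Sum>a\<in>{z. poly N z = 0}. real (order a N) * ln (cmod (z - a)))"
  proof -
    have "ln (\<Prod>a\<in>{z. poly N z = 0}. cmod (z - a) ^ order a N) = (\<Sum>a\<in>{z. poly N z = 0}. ln (cmod (z - a) ^ order a N))"
      using fin ne by (intro ln_prod) auto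
    then show ?thesis using ne by (simp add: ln_realpow)
  qed
  also have "\<dots> = real (degree N) * zc_mean N (\<lambda>t. ln (cmod (z - t)))"
  proof (cases "degree N = 0")
    case True
    then have "\<forall>a\<in>{z. poly N z = 0}. order a N = 0" using sum_order_complex[OF N0] fin by simp
    then show ?thesis using True by simp
  qed (simp add: zc_mean_def)
  finally show ?thesis .
qed

lemma kap_borel_measurable2 [measurable (raw)]:
  "f \<in> borel_measurable M \<Longrightarrow> (\<lambda>x. kap R (f x)) \<in> borel_measurable M"
  by (rule measurable_compose[OF _ kap_measurable])

lemma zc_mean_measurable [measurable (raw)]:
  assumes "\<And>t. (\<lambda>z. f z t) \<in> borel_measurable M"
  shows "(\<lambda>z. zc_mean N (f z)) \<in> borel_measurable M"
  unfolding zc_mean_def using assms by measurable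

lemma integrable_zc_mean:
  assumes "\<And>t. integrable M (\<lambda>z. f z t)"
  shows "integrable M (\<lambda>z. zc_mean N (f z))"
    and "(LINT z|M. zc_mean N (f z)) = zc_mean N (\<lambda>t. LINT z|M. f z t)"
  unfolding zc_mean_def using assms by auto

text \<open>What matters is that the bound is uniform in \<open>w\<close> and tends to 0 with
  \<open>R\<close>.\<close>

lemma integral_kap_le:
  assumes "R > 0"
  shows "(LBINT z. kap R (cmod (z - w))) \<le> 2 * pi * R\<^sup>2"
proof -
  have "(LBINT z. kap R (cmod (z - w))) \<le> (LBINT z. R * (indicator (ball w R) z / cmod (z - w)))"
  proof (rule integral_mono)
    show "integrable lborel (\<lambda>z. kap R (cmod (z - w)))" by (rule integrable_kap[OF assms])
    show "integrable lborel (\<lambda>z. R * (indicator (ball w R) z / cmod (z - w)))"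
      by (intro integrable_mult_right integrable_inverse_ball)
    show "kap R (cmod (z - w)) \<le> R * (indicator (ball w R) z / cmod (z - w))" for z
      using kap_le[OF assms, of "cmod (z - w)"] kap_eq_0[OF assms, of "cmod (z - w)"]
      by (auto simp: indicator_def dist_norm norm_minus_commute)
  qed
  also have "\<dots> = R * (LBINT z. indicator (ball w R) z / cmod (z - w))"
    by (rule integral_mult_right_zero)
  also have "\<dots> \<le> R * (2 * R * pi)"
  proof (rule mult_left_mono)
    have "ennreal (LBINT z. indicator (ball w R) z / cmod (z - w)) \<le> ennreal (2 * R * pi)"
      using nn_integral_inverse_ball[OF assms, of w]
      by (subst (asm) nn_integral_eq_integral[OF integrable_inverse_ball]) auto
    then show "(LBINT z. indicator (ball w R) z / cmod (z - w)) \<le> 2 * R * pi"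
      using assms by (subst (asm) ennreal_le_iff) auto
  qed (use assms in simp)
  finally show ?thesis by (simp add: power2_eq_square mult_ac)
qed

lemma ln_eq_pos_minus_kap:
  fixes x :: real
  shows "x \<ge> 0 \<Longrightarrow> ln x = max 0 (ln x) - kap 1 x"
  by (cases "x = 0") (auto simp: kap_def ln_div max_def)

lemma set_integrable_bounded_on_compact:
  fixes f :: "'a::euclidean_space \<Rightarrow> real"
  assumes "compact K" "f \<in> borel_measurable borel" "\<And>z. z \<in> K \<Longrightarrow> \<bar>f z\<bar> \<le> B"
  shows "set_integrable lborel K f"
  unfolding set_integrable_def
proof (rule Bochner_Integration.integrable_bound)
  have K: "K \<in> sets borel" using assms(1) by (simp add: borel_compact)
  have "emeasure lborel K < \<infinity>" using assms(1) emeasure_bounded_finite[OF compact_imp_bounded] by (simp add: less_top)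
  then show "integrable lborel (\<lambda>x. B * indicat_real K x)" using K by simp
  show "(\<lambda>x. indicat_real K x *\<^sub>R f x) \<in> borel_measurable lborel" using K assms(2) by simp
  show "AE x in lborel. norm (indicat_real K x *\<^sub>R f x) \<le> norm (B * indicat_real K x)"
    using assms(3) by (auto simp: indicator_def intro: order.trans[OF _ abs_ge_self])
qed

lemma set_integrable_ln_cmod:
  assumes K: "compact K"
  shows "set_integrable lborel K (\<lambda>z. ln (cmod (z - t)))"
proof -
  obtain B where B: "\<And>z. z \<in> K \<Longrightarrow> cmod z \<le> B" "B > 0"
    using compact_imp_bounded[OF K] unfolding bounded_pos by blast
  have "set_integrable lborel K (\<lambda>z. max 0 (ln (cmod (z - t))))"
  proof (rule set_integrable_bounded_on_compact[OF K, where B = "B + cmod t"])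
    fix z assume "z \<in> K"
    have "ln (cmod (z - t)) \<le> B + cmod t" 
    proof (cases "z = t")
      case False
      then have "ln (cmod (z - t)) \<le> cmod (z - t)" using ln_bound[of "cmod (z - t)"] by simp
      also have "\<dots> \<le> B + cmod t" using norm_triangle_ineq4[of z t] B(1)[OF \<open>z \<in> K\<close>] by simp
      finally show ?thesis .
    qed (use B(2) in \<open>simp add: add_nonneg_nonneg\<close>)
    then show "\<bar>max 0 (ln (cmod (z - t)))\<bar> \<le> B + cmod t" using B(2) by (simp add: add_nonneg_nonneg)
  qed simp
  moreover have "set_integrable lborel K (\<lambda>z. kap 1 (cmod (z - t)))"
    unfolding set_integrable_def using K
    by (intro integrable_mult_indicator integrable_kap) (auto simp: borel_compact)
  ultimately have "set_integrable lborel K (\<lambda>z. max 0 (ln (cmod (z - t))) - kap 1 (cmod (z - t)))"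
    by (rule set_integral_diff)
  moreover have "(\<lambda>z. ln (cmod (z - t))) = (\<lambda>z. max 0 (ln (cmod (z - t))) - kap 1 (cmod (z - t)))"
    by (intro ext ln_eq_pos_minus_kap) simp
  ultimately show ?thesis by (rule ssubst[rotated])
qed

lemma set_integrable_zc_mean_ln:
  assumes "compact K"
  shows "set_integrable lborel K (\<lambda>z. zc_mean N (\<lambda>t. ln (cmod (z - t))))"
proof -
  have "integrable lborel (\<lambda>z. zc_mean N (\<lambda>t. indicator K z * ln (cmod (z - t))))"
    using set_integrable_ln_cmod[OF assms] unfolding set_integrable_def real_scaleR_def by (rule integrable_zc_mean(1))
  then show ?thesis unfolding set_integrable_def zc_mean_cmult real_scaleR_def .
qed

context sites
begin

lemma Psi_bounded_on_compact:
  assumes "compact K"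
  shows "\<exists>A. \<forall>z\<in>K. \<bar>Psi S z\<bar> \<le> A"
  using compact_imp_bounded[OF compact_continuous_image[OF continuous_on_Psi assms]]
  unfolding bounded_iff by auto

lemma set_integrable_Psi:
  assumes "compact K"
  shows "set_integrable lborel K (Psi S)"
  using Psi_bounded_on_compact[OF assms] set_integrable_bounded_on_compact[OF assms Psi_measurable] by blast

end

text \<open>These properties are all that the passage to \<open>L^1\<close> and weak convergence
  uses of the numerators. Zeros are excluded in the upper bound because the default
  \<open>ln 0 = 0\<close> makes the potential meaningless there.\<close>

locale zero_seq = sites +
  fixes N :: "nat \<Rightarrow> complex poly"
  assumes deg_pos: "degree (N n) > 0"
    and ptw: "AE z in lborel. (\<lambda>n. zc_mean (N n) (\<lambda>t. ln (cmod (z - t)))) \<longlonglongrightarrow> Psi S z"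
    and bdd: "\<exists>C. \<forall>n z. cmod z \<le> B \<longrightarrow> poly (N n) z \<noteq> 0 \<longrightarrow> zc_mean (N n) (\<lambda>t. ln (cmod (z - t))) \<le> C"
begin

abbreviation L :: "nat \<Rightarrow> complex \<Rightarrow> real" where
  "L n z \<equiv> zc_mean (N n) (\<lambda>t. ln (cmod (z - t)))"

lemma AE_not_zero: "AE z in lborel. \<forall>n. poly (N n) z \<noteq> 0"
proof -
  have "AE z in lborel. poly (N n) z \<noteq> 0" for n
  proof -
    have "N n \<noteq> 0" using deg_pos[of n] by auto
    from AE_lborel_finite[OF poly_roots_finite[OF this]] show ?thesis by simp
  qed
  then show ?thesis by (simp add: AE_all_countable)
qed

lemma L_measurable [measurable]: "L n \<in> borel_measurable borel"
  by measurable

text \<open>From below, \<open>L n\<close> may be truncated at \<open>- l\<close> at a cost in \<open>L\<^sup>1\<close> that does not depend on \<open>n\<close>.\<close>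

lemma L1_convergence:
  assumes K: "compact K"
  shows "(\<lambda>n. LBINT z:K. \<bar>L n z - Psi S z\<bar>) \<longlonglongrightarrow> 0"
proof (rule tendstoI)
  fix e :: real assume e: "e > 0"
  have Kb [measurable]: "K \<in> sets borel" using K by (simp add: borel_compact)
  obtain B where B: "\<And>z. z \<in> K \<Longrightarrow> cmod z \<le> B"
    using compact_imp_bounded[OF K] unfolding bounded_iff by blast
  obtain C where C: "\<And>n z. cmod z \<le> B \<Longrightarrow> poly (N n) z \<noteq> 0 \<Longrightarrow> L n z \<le> C"
    using bdd[of B] by blast
  obtain A where A: "\<And>z. z \<in> K \<Longrightarrow> \<bar>Psi S z\<bar> \<le> A"
    using Psi_bounded_on_compact[OF K] by blast
  have "((\<lambda>l. 2 * pi * (exp (- l))\<^sup>2) \<longlongrightarrow> 2 * pi * 0\<^sup>2) (at_top :: real filter)"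
    by (intro tendsto_intros filterlim_compose[OF exp_at_bot] filterlim_uminus_at_bot_at_top)
  then have "eventually (\<lambda>l. 2 * pi * (exp (- l))\<^sup>2 < e / 2) (at_top :: real filter)"
    using e by (intro order_tendstoD(2)) auto
  then have "eventually (\<lambda>l. 2 * pi * (exp (- l))\<^sup>2 < e / 2 \<and> l \<ge> A \<and> l \<ge> 0) (at_top :: real filter)"
    by (intro eventually_conj eventually_ge_at_top)
  \<comment> \<open>The truncation error is to stay below \<open>e / 2\<close>, and
    \<open>l \<ge> A\<close> puts \<open>Psi S\<close> above \<open>- l\<close> on \<open>K\<close>,
    so that truncation does not affect the limit.\<close>
  then obtain l where l: "2 * pi * (exp (- l))\<^sup>2 < e / 2" "l \<ge> A" "l \<ge> 0"
    using eventually_happens[of _ "at_top :: real filter"] by auto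
  define \<rho> where "\<rho> = exp (- l)"
  have \<rho>: "\<rho> > 0" by (simp add: \<rho>_def)
  \<comment> \<open>For \<open>x > 0\<close>, \<open>kap \<rho> x\<close> is exactly what truncating
    \<open>ln x\<close> at \<open>- l = ln \<rho>\<close> adds. At \<open>x = 0\<close> both
    logarithms have the default value 0, and the claim reads \<open>- l \<le> 0\<close>.\<close>
  have ln_ge: "- l - kap \<rho> x \<le> ln x" if "x \<ge> 0" for x
    using that l by (cases "x = 0") (auto simp: kap_def ln_div \<rho>_def max_def)
  define T where "T = (\<lambda>n z. zc_mean (N n) (\<lambda>t. kap \<rho> (cmod (z - t))))"
  have T0: "T n z \<ge> 0" for n z unfolding T_def by (intro zc_mean_nonneg) simp
  have LT: "L n z \<ge> - l - T n z" for n z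
  proof -
    have "zc_mean (N n) (\<lambda>t. - l - kap \<rho> (cmod (z - t))) \<le> L n z"
      by (intro zc_mean_mono ln_ge) simp
    then show ?thesis using zc_mean_const[OF deg_pos] by (simp add: zc_mean_diff T_def)
  qed
  have Ti: "integrable lborel (T n)" for n
    unfolding T_def by (intro integrable_zc_mean integrable_kap \<rho>)
  have T_le: "(LBINT z. T n z) \<le> 2 * pi * \<rho>\<^sup>2" for n
  proof -
    have "(LBINT z. T n z) = zc_mean (N n) (\<lambda>t. LBINT z. kap \<rho> (cmod (z - t)))"
      unfolding T_def by (intro integrable_zc_mean integrable_kap \<rho>)
    also have "\<dots> \<le> zc_mean (N n) (\<lambda>t. 2 * pi * \<rho>\<^sup>2)"
      by (intro zc_mean_mono integral_kap_le \<rho>)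
    finally show ?thesis using zc_mean_const[OF deg_pos] by simp
  qed
  define m where "m = (\<lambda>n z. max (L n z) (- l))"
  have [measurable]: "m n \<in> borel_measurable borel" for n unfolding m_def by measurable
  define Q where "Q = max \<bar>C\<bar> l + A"
  have m_bd: "\<bar>m n z - Psi S z\<bar> \<le> Q" if "z \<in> K" "poly (N n) z \<noteq> 0" for n z
    using C[OF B[OF that(1)] that(2)] A[OF that(1)] l unfolding m_def Q_def by (auto simp: max_def abs_le_iff)
  have Kfin: "integrable lborel (\<lambda>z. indicator K z * Q)"
  proof -
    have "emeasure lborel K < \<infinity>" using K emeasure_bounded_finite[OF compact_imp_bounded] by (simp add: less_top)
    then show ?thesis by simp
  qed
  have lim: "(\<lambda>n. LBINT z. indicator K z * \<bar>m n z - Psi S z\<bar>) \<longlonglongrightarrow> (LINT z|(lborel :: complex measure). 0 :: real)"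
  proof (rule integral_dominated_convergence[OF _ _ Kfin])
    show "AE z in lborel. (\<lambda>n. indicator K z * \<bar>m n z - Psi S z\<bar>) \<longlonglongrightarrow> 0"
      using ptw
    proof eventually_elim
      fix z assume *: "(\<lambda>n. L n z) \<longlonglongrightarrow> Psi S z"
      show "(\<lambda>n. indicator K z * \<bar>m n z - Psi S z\<bar>) \<longlonglongrightarrow> 0"
      proof (cases "z \<in> K")
        case True
        have "(\<lambda>n. \<bar>m n z - Psi S z\<bar>) \<longlonglongrightarrow> \<bar>max (Psi S z) (- l) - Psi S z\<bar>"
          unfolding m_def by (intro tendsto_intros *)
        moreover have "max (Psi S z) (- l) = Psi S z" using A[OF True] l by (auto simp: max_def abs_le_iff)
        ultimately show ?thesis using True by simp
      qed simp
    qed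
    show "AE z in lborel. norm (indicator K z * \<bar>m n z - Psi S z\<bar>) \<le> indicator K z * Q" for n
      using AE_not_zero by eventually_elim (use m_bd in \<open>auto simp: indicator_def\<close>)
  qed auto
  then have "eventually (\<lambda>n. (LBINT z. indicator K z * \<bar>m n z - Psi S z\<bar>) < e / 2) sequentially"
    using e by (intro order_tendstoD(2)) auto
  then show "eventually (\<lambda>n. dist (LBINT z:K. \<bar>L n z - Psi S z\<bar>) 0 < e) sequentially"
  proof eventually_elim
    fix n assume n: "(LBINT z. indicator K z * \<bar>m n z - Psi S z\<bar>) < e / 2"
    have mi: "integrable lborel (\<lambda>z. indicator K z * \<bar>m n z - Psi S z\<bar>)"
    proof (rule Bochner_Integration.integrable_bound[OF Kfin])
      show "AE z in lborel. norm (indicator K z * \<bar>m n z - Psi S z\<bar>) \<le> norm (indicator K z * Q)"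
        using AE_not_zero
      proof eventually_elim
        fix z assume nz: "\<forall>n. poly (N n) z \<noteq> 0"
        have "\<bar>m n z - Psi S z\<bar> \<le> \<bar>Q\<bar>" if "z \<in> K"
          using m_bd[OF that, of n] nz by (auto intro: order.trans[OF _ abs_ge_self])
        then show "norm (indicator K z * \<bar>m n z - Psi S z\<bar>) \<le> norm (indicator K z * Q)"
          by (auto simp: indicator_def)
      qed
    qed simp
    have "set_integrable lborel K (\<lambda>z. L n z - Psi S z)"
      by (intro set_integral_diff set_integrable_zc_mean_ln set_integrable_Psi K)
    then have Li: "set_integrable lborel K (\<lambda>z. \<bar>L n z - Psi S z\<bar>)" by (rule set_integrable_abs)
    \<comment> \<open>By \<open>LT\<close>, truncation changes \<open>L n\<close> by at most
      \<open>T n\<close>.\<close>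
    have "(LBINT z:K. \<bar>L n z - Psi S z\<bar>) \<le> (LBINT z. indicator K z * \<bar>m n z - Psi S z\<bar> + T n z)"
      unfolding set_lebesgue_integral_def
    proof (rule integral_mono)
      show "integrable lborel (\<lambda>z. indicator K z *\<^sub>R \<bar>L n z - Psi S z\<bar>)"
        using Li by (simp add: set_integrable_def)
      show "indicator K z *\<^sub>R \<bar>L n z - Psi S z\<bar> \<le> indicator K z * \<bar>m n z - Psi S z\<bar> + T n z" for z
        using LT[of n z] T0[of n z] by (auto simp: indicator_def m_def max_def)
    qed (use mi Ti in auto)
    also have "\<dots> = (LBINT z. indicator K z * \<bar>m n z - Psi S z\<bar>) + (LBINT z. T n z)"
      using mi Ti by simp
    also have "\<dots> < e / 2 + e / 2" using n T_le[of n] l(1) by (simp add: \<rho>_def)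
    finally have "(LBINT z:K. \<bar>L n z - Psi S z\<bar>) < e" by simp
    moreover have "(LBINT z:K. \<bar>L n z - Psi S z\<bar>) \<ge> 0"
      unfolding set_lebesgue_integral_def by (intro integral_nonneg_AE) auto
    ultimately show "dist (LBINT z:K. \<bar>L n z - Psi S z\<bar>) 0 < e" by simp
  qed
qed

end

section \<open>Weak convergence\<close>

lemma cball_borel_measurable [measurable]: "cball w R \<in> sets borel"
  by simp

lemma integral_kap_translate: "(LBINT w. kap R (cmod (w - t))) = (LBINT w. kap R (cmod w))"
proof -
  have "(LBINT w. kap R (cmod (w - t))) = (LINT w|distr lborel borel ((+) t). kap R (cmod (w - t)))"
    by (simp add: lborel_distr_plus)
  also have "\<dots> = (LBINT w. kap R (cmod w))"
    by (subst integral_distr) auto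
  finally show ?thesis .
qed

lemma integral_kap_pos:
  assumes R: "R > 0"
  shows "(LBINT w. kap R (cmod (w :: complex))) > 0"
proof -
  have "0 < ln 2 * measure lborel (ball (0 :: complex) (R / 2))"
    using content_ball_pos[of "R / 2" "0 :: complex"] R by simp
  also have "\<dots> = (LBINT w. ln 2 * indicator (ball (0 :: complex) (R / 2)) w)" by simp
  also have "\<dots> \<le> (LBINT w. kap R (cmod (w :: complex)))"
  proof (rule integral_mono_AE)
    show "integrable lborel (\<lambda>w. ln 2 * indicat_real (ball (0 :: complex) (R / 2)) w)"
      using emeasure_lborel_ball_finite[of "0 :: complex" "R / 2"] by simp
    show "integrable lborel (\<lambda>w :: complex. kap R (cmod w))"
      using integrable_kap[OF R, of 0] by simp
    show "AE w in lborel. ln 2 * indicat_real (ball (0 :: complex) (R / 2)) w \<le> kap R (cmod w)"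
      using AE_lborel_singleton[of "0 :: complex"]
    proof eventually_elim
      fix w :: complex assume w: "w \<noteq> 0"
      have "ln 2 \<le> kap R (cmod w)" if "cmod w < R / 2"
      proof -
        have "ln 2 \<le> ln (R / cmod w)" using that w R by (subst ln_le_cancel_iff) (auto simp: field_simps)
        then show ?thesis by (simp add: kap_def)
      qed
      then show "ln 2 * indicat_real (ball 0 (R / 2)) w \<le> kap R (cmod w)"
        by (auto simp: indicator_def)
    qed
  qed
  finally show ?thesis .
qed

context sites
begin

lemma muS_bounded_integrable:
  assumes [measurable]: "f \<in> borel_measurable borel" and M: "\<And>x. \<bar>f x\<bar> \<le> M"
  shows "muS_integrable f"
  unfolding muS_integrable_def
proof (safe, rule Bochner_Integration.integrable_bound)
  fix a b assume ab: "(a, b) \<in> pairs"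
  have [measurable]: "edge_density a b \<in> borel_measurable borel" using pairsD[OF ab] by simp
  show "integrable lborel (\<lambda>t. edge_density a b t * M)"
    using integrable_edge_density[OF ab] by simp
  show "(\<lambda>t. edge_density a b t * f (bisector a b t)) \<in> borel_measurable lborel" by measurable
  show "AE t in lborel. norm (edge_density a b t * f (bisector a b t)) \<le> norm (edge_density a b t * M)"
    using M edge_density_nonneg
    by (auto simp: abs_mult intro!: mult_left_mono intro: order.trans[OF M abs_ge_self])
qed

lemma muS_int_mono:
  assumes "muS_integrable f" "muS_integrable g" "\<And>z. f z \<le> g z"
  shows "muS_int S f \<le> muS_int S g"
  unfolding muS_int_eq using assms
  by (intro divide_right_mono sum_mono)
     (auto intro!: integral_mono mult_left_mono edge_density_nonneg dest: muS_integrableD)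

lemma muS_int_diff_le:
  assumes f: "muS_integrable f" and g: "muS_integrable g" and h: "muS_integrable h"
    and le: "\<And>x. \<bar>f x - g x\<bar> \<le> h x"
  shows "\<bar>muS_int S f - muS_int S g\<bar> \<le> muS_int S h"
proof -
  have "f x - g x \<le> h x" "g x - f x \<le> h x" for x using le[of x] by auto
  then have "muS_int S (\<lambda>x. f x - g x) \<le> muS_int S h" "muS_int S (\<lambda>x. g x - f x) \<le> muS_int S h"
    by (intro muS_int_mono muS_int_diff(1) f g h; simp)+
  then show ?thesis by (simp add: muS_int_diff f g abs_le_iff)
qed

text \<open>Not normalised; the division by the total mass of the kernel is made where
  \<open>f\<close> is approximated.\<close>

definition mollify :: "real \<Rightarrow> (complex \<Rightarrow> real) \<Rightarrow> complex \<Rightarrow> real" where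
  "mollify \<delta> f t = (LBINT w. f w * kap \<delta> (cmod (w - t)))"

lemma mollify_integrable:
  assumes \<delta>: "\<delta> > 0" and [measurable]: "f \<in> borel_measurable borel" and M: "\<And>x. \<bar>f x\<bar> \<le> M"
  shows "integrable lborel (\<lambda>w. f w * kap \<delta> (cmod (w - t)))"
    and "\<bar>LBINT w. \<bar>f w * kap \<delta> (cmod (w - t))\<bar>\<bar> \<le> M * (2 * pi * \<delta>\<^sup>2)"
proof -
  have ki: "integrable lborel (\<lambda>w. M * kap \<delta> (cmod (w - t)))"
    using integrable_kap[OF \<delta>] by simp
  have M0: "M \<ge> 0" using M[of 0] by linarith
  have le: "\<bar>f w * kap \<delta> (cmod (w - t))\<bar> \<le> M * kap \<delta> (cmod (w - t))" for w
    using M by (simp add: abs_mult mult_right_mono)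
  show i: "integrable lborel (\<lambda>w. f w * kap \<delta> (cmod (w - t)))"
    by (rule Bochner_Integration.integrable_bound[OF ki]) (use le M0 in \<open>auto simp: abs_mult\<close>)
  have "(LBINT w. \<bar>f w * kap \<delta> (cmod (w - t))\<bar>) \<le> (LBINT w. M * kap \<delta> (cmod (w - t)))"
    using i ki le by (intro integral_mono) auto
  also have "\<dots> = M * (LBINT w. kap \<delta> (cmod (w - t)))" by simp
  also have "\<dots> \<le> M * (2 * pi * \<delta>\<^sup>2)"
    by (intro mult_left_mono integral_kap_le \<delta> M0)
  finally show "\<bar>LBINT w. \<bar>f w * kap \<delta> (cmod (w - t))\<bar>\<bar> \<le> M * (2 * pi * \<delta>\<^sup>2)"
    by (subst abs_of_nonneg) (auto intro!: integral_nonneg_AE)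
qed

lemma mollify_measurable [measurable]:
  assumes [measurable]: "f \<in> borel_measurable borel"
  shows "mollify \<delta> f \<in> borel_measurable borel"
  unfolding mollify_def by measurable

text \<open>Fubini exchanges the two integrations, so that the measure meets only truncated
  logarithms centred at \<open>w\<close>.\<close>

lemma muS_int_mollify:
  assumes \<delta>: "\<delta> > 0" and [measurable]: "f \<in> borel_measurable borel" and M: "\<And>x. \<bar>f x\<bar> \<le> M"
  shows "integrable lborel (\<lambda>w. f w * muS_int S (\<lambda>t. kap \<delta> (cmod (t - w))))"
    and "muS_int S (mollify \<delta> f) = (LBINT w. f w * muS_int S (\<lambda>t. kap \<delta> (cmod (t - w))))"
proof -
  define P where "P = (\<lambda>a b t w. edge_density a b t * (f w * kap \<delta> (cmod (w - bisector a b t))))"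
  have int: "integrable (lborel \<Otimes>\<^sub>M lborel) (\<lambda>(t, w). P a b t w)" if ab: "(a, b) \<in> pairs" for a b
  proof -
    have [measurable]: "edge_density a b \<in> borel_measurable borel" using pairsD[OF ab] by simp
    show ?thesis
    proof (rule lborel_pair.Fubini_integrable)
      show "(\<lambda>(t, w). P a b t w) \<in> borel_measurable (lborel \<Otimes>\<^sub>M lborel)"
        unfolding P_def by measurable
      show "AE t in lborel. integrable lborel (\<lambda>w. case (t, w) of (t, w) \<Rightarrow> P a b t w)"
        unfolding P_def using mollify_integrable(1)[OF \<delta> assms(2) M] by simp
      show "integrable lborel (\<lambda>t. LBINT w. norm (case (t, w) of (t, w) \<Rightarrow> P a b t w))"
      proof (rule Bochner_Integration.integrable_bound)
        show "integrable lborel (\<lambda>t. edge_density a b t * (M * (2 * pi * \<delta>\<^sup>2)))"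
          using integrable_edge_density[OF ab] by simp
        show "(\<lambda>t. LBINT w. norm (case (t, w) of (t, w) \<Rightarrow> P a b t w)) \<in> borel_measurable lborel"
          unfolding P_def by measurable
        show "AE t in lborel. norm (LBINT w. norm (case (t, w) of (t, w) \<Rightarrow> P a b t w))
            \<le> norm (edge_density a b t * (M * (2 * pi * \<delta>\<^sup>2)))"
        proof (rule AE_I2)
          fix t
          have "(LBINT w. norm (case (t, w) of (t, w) \<Rightarrow> P a b t w))
            = edge_density a b t * (LBINT w. \<bar>f w * kap \<delta> (cmod (w - bisector a b t))\<bar>)"
            unfolding P_def using edge_density_nonneg[of a b t] by (simp add: abs_mult)
          then have "norm (LBINT w. norm (case (t, w) of (t, w) \<Rightarrow> P a b t w))
            = edge_density a b t * \<bar>LBINT w. \<bar>f w * kap \<delta> (cmod (w - bisector a b t))\<bar>\<bar>"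
            using edge_density_nonneg[of a b t] by (simp add: abs_mult)
          also have "\<dots> \<le> edge_density a b t * (M * (2 * pi * \<delta>\<^sup>2))"
            using mollify_integrable(2)[OF \<delta> assms(2) M] by (intro mult_left_mono edge_density_nonneg)
          finally show "norm (LBINT w. norm (case (t, w) of (t, w) \<Rightarrow> P a b t w))
            \<le> norm (edge_density a b t * (M * (2 * pi * \<delta>\<^sup>2)))"
            by (rule order.trans) simp
        qed
      qed
    qed
  qed
  have inner: "(LBINT t. P a b t w) = f w * (LBINT t. edge_density a b t * kap \<delta> (cmod (bisector a b t - w)))" for a b w
    unfolding P_def by (subst integral_mult_right_zero[symmetric]) (simp add: mult.left_commute norm_minus_commute)
  have iw: "integrable lborel (\<lambda>w. f w * (LBINT t. edge_density a b t * kap \<delta> (cmod (bisector a b t - w))))"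
    if ab: "(a, b) \<in> pairs" for a b
    using lborel_pair.integrable_snd[OF int[OF ab]] unfolding inner by simp
  have sum_form: "f w * muS_int S (\<lambda>t. kap \<delta> (cmod (t - w))) =
     (\<Sum>p\<in>pairs. f w * (LBINT t. edge_density (fst p) (snd p) t * kap \<delta> (cmod (bisector (fst p) (snd p) t - w)))) / 2" for w
    unfolding muS_int_eq by (simp add: sum_distrib_left split_beta)
  show "integrable lborel (\<lambda>w. f w * muS_int S (\<lambda>t. kap \<delta> (cmod (t - w))))"
    unfolding sum_form using iw by (intro Bochner_Integration.integrable_divide Bochner_Integration.integrable_sum) auto
  have outer: "(LBINT t. edge_density a b t * mollify \<delta> f (bisector a b t)) =
     (LBINT w. f w * (LBINT t. edge_density a b t * kap \<delta> (cmod (bisector a b t - w))))"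
    if ab: "(a, b) \<in> pairs" for a b
  proof -
    have "(LBINT t. edge_density a b t * mollify \<delta> f (bisector a b t)) = (LBINT t. LBINT w. P a b t w)"
      unfolding P_def mollify_def by simp
    also have "\<dots> = (LBINT w. LBINT t. P a b t w)"
      by (rule lborel_pair.Fubini_integral[OF int[OF ab], symmetric])
    finally show ?thesis unfolding inner .
  qed
  have "(LBINT w. f w * muS_int S (\<lambda>t. kap \<delta> (cmod (t - w)))) =
    (\<Sum>p\<in>pairs. LBINT w. f w * (LBINT t. edge_density (fst p) (snd p) t * kap \<delta> (cmod (bisector (fst p) (snd p) t - w)))) / 2"
    unfolding sum_form using iw by (simp add: Bochner_Integration.integral_sum)
  also have "\<dots> = (\<Sum>p\<in>pairs. LBINT t. edge_density (fst p) (snd p) t * mollify \<delta> f (bisector (fst p) (snd p) t)) / 2"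
    using outer by (intro arg_cong[where f = "\<lambda>x. x / 2"] sum.cong) auto
  finally show "muS_int S (mollify \<delta> f) = (LBINT w. f w * muS_int S (\<lambda>t. kap \<delta> (cmod (t - w))))"
    unfolding muS_int_eq by (simp add: split_beta)
qed

end

context zero_seq
begin

lemma jensen_L:
  assumes \<delta>: "\<delta> > 0" and w: "poly (N n) w \<noteq> 0"
  shows "integrable lborel (jensen \<delta> (L n) w)"
    and "(LBINT y. jensen \<delta> (L n) w y) = 2 * pi * zc_mean (N n) (\<lambda>t. kap \<delta> (cmod (w - t)))"
proof -
  let ?Z = "{z. poly (N n) z = 0}"
  have ne: "w \<noteq> a" if "a \<in> ?Z" for a using w that by auto
  have e: "jensen \<delta> (L n) w y =
     (\<Sum>a\<in>?Z. real (order a (N n)) * jensen \<delta> (\<lambda>z. ln (cmod (z - a))) w y) / real (degree (N n))" for y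
  proof -
    have "jensen \<delta> (L n) w y = zc_mean (N n) (\<lambda>t. jensen \<delta> (\<lambda>z. ln (cmod (z - t))) w y)"
      unfolding jensen_def
      by (simp add: zc_mean_add zc_mean_diff zc_mean_cmult mult.commute[of _ "inverse _"] del: mult_1_left)
    then show ?thesis by (simp add: zc_mean_def)
  qed
  show "integrable lborel (jensen \<delta> (L n) w)"
    unfolding e[abs_def] using jensen_log(1)[OF ne \<delta>]
    by (intro Bochner_Integration.integrable_divide Bochner_Integration.integrable_sum integrable_mult_right)
  have "(LBINT y. jensen \<delta> (L n) w y) =
    (\<Sum>a\<in>?Z. real (order a (N n)) * (LBINT y. jensen \<delta> (\<lambda>z. ln (cmod (z - a))) w y)) / real (degree (N n))"
    unfolding e using jensen_log(1)[OF ne \<delta>] by (simp add: Bochner_Integration.integral_sum)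
  also have "\<dots> = zc_mean (N n) (\<lambda>t. 2 * pi * kap \<delta> (cmod (w - t)))"
    unfolding zc_mean_def using jensen_log(2)[OF ne \<delta>] by (intro arg_cong2[where f = "(/)"] sum.cong) auto
  finally show "(LBINT y. jensen \<delta> (L n) w y) = 2 * pi * zc_mean (N n) (\<lambda>t. kap \<delta> (cmod (w - t)))"
    unfolding zc_mean_cmult .
qed

text \<open>By Jensen's formula for \<open>L n\<close> and for \<open>Psi S\<close>, both sides of the difference are circle
  means of the potentials, so that it is controlled by the \<open>L\<^sup>1\<close> distance of the potentials.\<close>

lemma mollify_estimate:
  assumes \<delta>: "\<delta> > 0" and [measurable]: "f \<in> borel_measurable borel" and M: "\<And>x. \<bar>f x\<bar> \<le> M"
    and supp: "\<And>x. cmod x > B \<Longrightarrow> f x = 0"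
  shows "\<bar>zc_mean (N n) (mollify \<delta> f) - muS_int S (mollify \<delta> f)\<bar>
    \<le> 2 * M * (LBINT z:cball 0 (B + \<delta>). \<bar>L n z - Psi S z\<bar>)"
proof -
  have M0: "M \<ge> 0" using M[of 0] by linarith
  define H where "H = (\<lambda>z. L n z - Psi S z)"
  have [measurable]: "H \<in> borel_measurable borel" unfolding H_def by measurable
  define D where "D = (\<lambda>w. zc_mean (N n) (\<lambda>t. kap \<delta> (cmod (w - t))) - muS_int S (\<lambda>t. kap \<delta> (cmod (t - w))))"
  have i1: "integrable lborel (\<lambda>w. f w * zc_mean (N n) (\<lambda>t. kap \<delta> (cmod (w - t))))"
    and e1: "zc_mean (N n) (mollify \<delta> f) = (LBINT w. f w * zc_mean (N n) (\<lambda>t. kap \<delta> (cmod (w - t))))"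
    using integrable_zc_mean[of lborel "\<lambda>w t. f w * kap \<delta> (cmod (w - t))" "N n"] mollify_integrable(1)[OF \<delta> assms(2) M]
    unfolding zc_mean_cmult mollify_def by auto
  note i2 = muS_int_mollify(1)[OF \<delta> assms(2) M]
  note e2 = muS_int_mollify(2)[OF \<delta> assms(2) M]
  have iD: "integrable lborel (\<lambda>w. f w * D w)"
    using Bochner_Integration.integrable_diff[OF i1 i2] by (simp add: D_def right_diff_distrib)
  have eD: "zc_mean (N n) (mollify \<delta> f) - muS_int S (mollify \<delta> f) = (LBINT w. f w * D w)"
    unfolding e1 e2 D_def right_diff_distrib by (rule Bochner_Integration.integral_diff[OF i1 i2, symmetric])
  \<comment> \<open>The disc is enlarged by \<open>\<delta>\<close> so that for
    \<open>cmod w \<le> B\<close> it contains \<open>w\<close> and both points at distance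
    \<open>\<delta>\<close> from it.\<close>
  define G where "G = (\<lambda>z. ennreal \<bar>H z\<bar> * indicator (cball 0 (B + \<delta>)) z)"
  have [measurable]: "G \<in> borel_measurable borel" unfolding G_def by measurable
  define c where "c = (\<lambda>y :: real. ennreal (inverse (1 + y\<^sup>2)))"
  have [measurable]: "c \<in> borel_measurable borel" unfolding c_def by measurable
  define J where "J = (\<lambda>w y. (G (w + of_real \<delta> * dir y) + G (w - of_real \<delta> * dir y) + 2 * G w) * c y)"
  have [measurable]: "(\<lambda>(w, y). J w y) \<in> borel_measurable (lborel \<Otimes>\<^sub>M lborel)"
    unfolding J_def by measurable
  have bound: "AE w in lborel. ennreal (2 * pi * \<bar>f w * D w\<bar>) \<le> ennreal M * (\<integral>\<^sup>+y. J w y \<partial>lborel)"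
    using AE_not_zero
  proof eventually_elim
    fix w assume "\<forall>n. poly (N n) w \<noteq> 0"
    then have nz: "poly (N n) w \<noteq> 0" by simp
    show "ennreal (2 * pi * \<bar>f w * D w\<bar>) \<le> ennreal M * (\<integral>\<^sup>+y. J w y \<partial>lborel)"
    proof (cases "cmod w \<le> B")
      case True
      have Hi: "integrable lborel (jensen \<delta> H w)"
        and He: "(LBINT y. jensen \<delta> H w y) = 2 * pi * D w"
      proof -
        have "jensen \<delta> H w = (\<lambda>y. jensen \<delta> (L n) w y - jensen \<delta> (Psi S) w y)"
          by (simp add: jensen_def H_def fun_eq_iff algebra_simps)
        then show "integrable lborel (jensen \<delta> H w)"
          and "(LBINT y. jensen \<delta> H w y) = 2 * pi * D w"
          using jensen_L[OF \<delta> nz] jensen_Psi[OF \<delta>, of w] by (simp_all add: D_def right_diff_distrib)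
      qed
      have in_ball: "w \<in> cball 0 (B + \<delta>)" "w + of_real \<delta> * dir y \<in> cball 0 (B + \<delta>)"
        "w - of_real \<delta> * dir y \<in> cball 0 (B + \<delta>)" for y
        using True \<delta> norm_triangle_ineq[of w "of_real \<delta> * dir y"] norm_triangle_ineq4[of w "of_real \<delta> * dir y"]
        by (auto simp: norm_mult)
      have "ennreal (2 * pi * \<bar>D w\<bar>) = ennreal \<bar>LBINT y. jensen \<delta> H w y\<bar>"
        by (simp add: He abs_mult)
      also have "\<dots> \<le> (\<integral>\<^sup>+y. ennreal \<bar>jensen \<delta> H w y\<bar> \<partial>lborel)"
        using integral_norm_bound_ennreal[OF Hi] by simp
      also have "\<dots> \<le> (\<integral>\<^sup>+y. J w y \<partial>lborel)"
      proof (rule nn_integral_mono)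
        fix y
        have "\<bar>jensen \<delta> H w y\<bar> \<le> (\<bar>H (w + of_real \<delta> * dir y)\<bar> + \<bar>H (w - of_real \<delta> * dir y)\<bar> + 2 * \<bar>H w\<bar>) * inverse (1 + y\<^sup>2)"
          unfolding jensen_def by (subst abs_mult) (auto intro!: mult_mono add_nonneg_nonneg)
        then have "ennreal \<bar>jensen \<delta> H w y\<bar> \<le> ennreal ((\<bar>H (w + of_real \<delta> * dir y)\<bar> + \<bar>H (w - of_real \<delta> * dir y)\<bar> + 2 * \<bar>H w\<bar>) * inverse (1 + y\<^sup>2))"
          by (rule ennreal_leI)
        also have "\<dots> = J w y"
          unfolding J_def G_def c_def using in_ball by (simp add: ennreal_mult ennreal_plus add_nonneg_nonneg)
        finally show "ennreal \<bar>jensen \<delta> H w y\<bar> \<le> J w y" .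
      qed
      finally have *: "ennreal (2 * pi * \<bar>D w\<bar>) \<le> (\<integral>\<^sup>+y. J w y \<partial>lborel)" .
      have "ennreal (2 * pi * \<bar>f w * D w\<bar>) \<le> ennreal (M * (2 * pi * \<bar>D w\<bar>))"
        using M[of w] by (intro ennreal_leI) (simp add: abs_mult mult_right_mono)
      also have "\<dots> = ennreal M * ennreal (2 * pi * \<bar>D w\<bar>)" using M0 by (simp add: ennreal_mult)
      also have "\<dots> \<le> ennreal M * (\<integral>\<^sup>+y. J w y \<partial>lborel)" by (intro mult_left_mono *) simp
      finally show ?thesis .
    qed (use supp in simp)
  qed
  \<comment> \<open>By translation invariance the terms of \<open>J\<close> integrate to 1, 1 and 2
    times the integral of \<open>G\<close>. The resulting factor 4, times the total
    \<open>pi\<close> of the slope density and divided by \<open>2 * pi\<close>, is the 2 in the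
    claim.\<close>
  have inner: "(\<integral>\<^sup>+w. J w y \<partial>lborel) = 4 * (\<integral>\<^sup>+z. G z \<partial>lborel) * c y" for y
  proof -
    have t1: "(\<integral>\<^sup>+w. G (w + of_real \<delta> * dir y) \<partial>lborel) = (\<integral>\<^sup>+z. G z \<partial>lborel)"
      using nn_integral_translate[of G "of_real \<delta> * dir y"] by (simp add: add.commute)
    have t2: "(\<integral>\<^sup>+w. G (w - of_real \<delta> * dir y) \<partial>lborel) = (\<integral>\<^sup>+z. G z \<partial>lborel)"
      using nn_integral_translate[of G "- (of_real \<delta> * dir y)"] by simp
    have "(\<integral>\<^sup>+w. J w y \<partial>lborel) = (\<integral>\<^sup>+w. G (w + of_real \<delta> * dir y) + G (w - of_real \<delta> * dir y) + 2 * G w \<partial>lborel) * c y"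
      unfolding J_def by (rule nn_integral_multc) measurable
    also have "(\<integral>\<^sup>+w. G (w + of_real \<delta> * dir y) + G (w - of_real \<delta> * dir y) + 2 * G w \<partial>lborel) =
       (\<integral>\<^sup>+z. G z \<partial>lborel) + (\<integral>\<^sup>+z. G z \<partial>lborel) + 2 * (\<integral>\<^sup>+z. G z \<partial>lborel)"
      by (subst nn_integral_add, measurable, subst nn_integral_add, measurable) (simp add: t1 t2 nn_integral_cmult)
    also have "\<dots> = 4 * (\<integral>\<^sup>+z. G z \<partial>lborel)"
      by (simp flip: mult_2 add: distrib_right[symmetric])
    finally show ?thesis .
  qed
  have Gi: "(\<integral>\<^sup>+z. G z \<partial>lborel) = ennreal (LBINT z:cball 0 (B + \<delta>). \<bar>H z\<bar>)"
  proof -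
    have "set_integrable lborel (cball 0 (B + \<delta>)) H"
      unfolding H_def by (intro set_integral_diff set_integrable_zc_mean_ln set_integrable_Psi compact_cball)
    then have "set_integrable lborel (cball 0 (B + \<delta>)) (\<lambda>z. \<bar>H z\<bar>)" by (rule set_integrable_abs)
    then have "(\<integral>\<^sup>+z. ennreal (indicator (cball 0 (B + \<delta>)) z *\<^sub>R \<bar>H z\<bar>) \<partial>lborel) = ennreal (LBINT z:cball 0 (B + \<delta>). \<bar>H z\<bar>)"
      unfolding set_integrable_def set_lebesgue_integral_def by (intro nn_integral_eq_integral) auto
    moreover have "G = (\<lambda>z. ennreal (indicator (cball 0 (B + \<delta>)) z *\<^sub>R \<bar>H z\<bar>))"
      by (auto simp: G_def fun_eq_iff indicator_def)
    ultimately show ?thesis by simp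
  qed
  define X where "X = (LBINT z:cball 0 (B + \<delta>). \<bar>H z\<bar>)"
  have X0: "X \<ge> 0" unfolding X_def set_lebesgue_integral_def by (intro integral_nonneg_AE) auto
  have c_int: "(\<integral>\<^sup>+y. c y \<partial>lborel) = ennreal pi"
    unfolding c_def using integrable_cauchy
    by (subst nn_integral_eq_integral) (auto simp: integral_cauchy add_nonneg_nonneg)
  have "ennreal (2 * pi * \<bar>LBINT w. f w * D w\<bar>) = ennreal \<bar>LBINT w. 2 * pi * (f w * D w)\<bar>"
    by (simp add: abs_mult)
  also have "\<dots> \<le> (\<integral>\<^sup>+w. ennreal (2 * pi * \<bar>f w * D w\<bar>) \<partial>lborel)"
    using integral_norm_bound_ennreal[OF integrable_mult_right[OF iD, of "2 * pi"]] by (simp add: abs_mult)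
  also have "\<dots> \<le> (\<integral>\<^sup>+w. ennreal M * (\<integral>\<^sup>+y. J w y \<partial>lborel) \<partial>lborel)"
    by (rule nn_integral_mono_AE[OF bound])
  also have "\<dots> = ennreal M * (\<integral>\<^sup>+w. \<integral>\<^sup>+y. J w y \<partial>lborel \<partial>lborel)"
    by (rule nn_integral_cmult) measurable
  also have "(\<integral>\<^sup>+w. \<integral>\<^sup>+y. J w y \<partial>lborel \<partial>lborel) = (\<integral>\<^sup>+y. \<integral>\<^sup>+w. J w y \<partial>lborel \<partial>lborel)"
    by (rule lborel_pair.Fubini') measurable
  also have "\<dots> = 4 * (\<integral>\<^sup>+z. G z \<partial>lborel) * (\<integral>\<^sup>+y. c y \<partial>lborel)"
    unfolding inner by (rule nn_integral_cmult) measurable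
  also have "\<dots> = ennreal (4 * X * pi)"
    unfolding Gi c_int X_def[symmetric] using X0 by (simp add: ennreal_mult)
  also have "ennreal M * \<dots> = ennreal (M * (4 * X * pi))"
    using M0 X0 by (simp add: ennreal_mult)
  finally have "2 * pi * \<bar>LBINT w. f w * D w\<bar> \<le> M * (4 * X * pi)"
    using M0 X0 by (subst (asm) ennreal_le_iff) auto
  then have "(2 * pi) * \<bar>LBINT w. f w * D w\<bar> \<le> (2 * pi) * (2 * M * X)" by (simp add: mult_ac)
  then have "\<bar>LBINT w. f w * D w\<bar> \<le> 2 * M * X"
    by (rule mult_left_le_imp_le) simp
  then show ?thesis unfolding eD X_def H_def .
qed

text \<open>The normalised mollification \<open>F\<close> is uniformly within \<open>e / 4\<close>
  of \<open>f\<close>, which costs at most \<open>e / 4\<close> for either measure because both have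
  mass 1. The rest is \<open>mollify_estimate\<close>.\<close>

lemma converges_compact_support:
  fixes f :: "complex \<Rightarrow> real"
  assumes cont: "continuous_on UNIV f" and supp: "\<And>x. cmod x > B \<Longrightarrow> f x = 0"
  shows "(\<lambda>n. zc_mean (N n) f) \<longlonglongrightarrow> muS_int S f"
proof (rule tendstoI)
  fix e :: real assume e: "e > 0"
  have [measurable]: "f \<in> borel_measurable borel" using cont by (rule borel_measurable_continuous_onI)
  have "bounded (f ` cball 0 (B + 1))"
    using cont by (intro compact_imp_bounded compact_continuous_image) (auto intro: continuous_on_subset)
  then obtain M where "M > 0" "\<forall>y\<in>f ` cball 0 (B + 1). norm y \<le> M" unfolding bounded_pos by blast
  then have M': "\<And>x. x \<in> cball 0 (B + 1) \<Longrightarrow> \<bar>f x\<bar> \<le> M" "M > 0" by auto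
  have M: "\<bar>f x\<bar> \<le> M" for x
    using M' supp[of x] by (cases "cmod x > B") auto
  have "uniformly_continuous_on (cball 0 (B + 1)) f"
    using cont by (intro compact_uniformly_continuous) (auto intro: continuous_on_subset)
  then obtain d where d: "d > 0" "\<And>x y. x \<in> cball 0 (B + 1) \<Longrightarrow> y \<in> cball 0 (B + 1) \<Longrightarrow> dist y x < d \<Longrightarrow> dist (f y) (f x) < e / 4"
    using e unfolding uniformly_continuous_on_def by (metis divide_pos_pos zero_less_numeral)
  \<comment> \<open>With \<open>\<delta> \<le> 1\<close>, two points closer than
    \<open>\<delta>\<close> either both lie in the disc of radius \<open>B + 1\<close>, or both lie
    outside radius \<open>B\<close>, where \<open>f\<close> vanishes.\<close>
  define \<delta> where "\<delta> = min d 1"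
  have \<delta>: "\<delta> > 0" using d by (simp add: \<delta>_def)
  have near: "\<bar>f w - f t\<bar> \<le> e / 4" if "cmod (w - t) < \<delta>" for w t
  proof (cases "w \<in> cball 0 (B + 1) \<and> t \<in> cball 0 (B + 1)")
    case True
    then show ?thesis using d(2)[of t w] that by (simp add: \<delta>_def dist_norm)
  next
    case False
    have "cmod w < cmod t + 1" "cmod t < cmod w + 1"
      using that norm_triangle_sub[of w t] norm_triangle_sub[of t w] by (auto simp: \<delta>_def norm_minus_commute)
    with False have "cmod w > B" "cmod t > B" by auto
    then show ?thesis using supp e by simp
  qed
  define c where "c = (LBINT w. kap \<delta> (cmod (w :: complex)))"
  have c: "c > 0" unfolding c_def by (rule integral_kap_pos[OF \<delta>])
  define F where "F = (\<lambda>t. (1 / c) * mollify \<delta> f t)"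
  have F_near: "\<bar>f t - F t\<bar> \<le> e / 4" for t
  proof -
    note i = mollify_integrable(1)[OF \<delta> _ M] integrable_kap[OF \<delta>]
    have "c * f t - mollify \<delta> f t = (LBINT w. f t * kap \<delta> (cmod (w - t)) - f w * kap \<delta> (cmod (w - t)))"
      unfolding mollify_def c_def using i by (simp add: integral_kap_translate)
    also have "\<bar>\<dots>\<bar> \<le> (LBINT w. \<bar>f t * kap \<delta> (cmod (w - t)) - f w * kap \<delta> (cmod (w - t))\<bar>)"
      by (rule integral_abs_bound)
    also have "\<dots> \<le> (LBINT w. (e / 4) * kap \<delta> (cmod (w - t)))"
    proof (rule integral_mono)
      fix w
      have "\<bar>f t * kap \<delta> (cmod (w - t)) - f w * kap \<delta> (cmod (w - t))\<bar> = \<bar>f w - f t\<bar> * kap \<delta> (cmod (w - t))"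
        by (simp add: abs_mult abs_minus_commute flip: left_diff_distrib)
      also have "\<dots> \<le> (e / 4) * kap \<delta> (cmod (w - t))"
      proof (cases "cmod (w - t) < \<delta>")
        case True
        then show ?thesis by (intro mult_right_mono near) auto
      qed (simp add: kap_eq_0[OF \<delta>])
      finally show "\<bar>f t * kap \<delta> (cmod (w - t)) - f w * kap \<delta> (cmod (w - t))\<bar> \<le> (e / 4) * kap \<delta> (cmod (w - t))" .
    qed (use i in auto)
    also have "\<dots> = (e / 4) * c" by (simp add: integral_kap_translate c_def)
    finally have "\<bar>c * f t - mollify \<delta> f t\<bar> \<le> (e / 4) * c" .
    moreover have "f t - F t = (c * f t - mollify \<delta> f t) / c" using c by (simp add: F_def field_simps)
    ultimately show ?thesis using c by (simp add: abs_divide pos_divide_le_eq)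
  qed
  have F_bd: "\<bar>F t\<bar> \<le> M + e / 4" for t using F_near[of t] M[of t] by linarith
  have 1: "\<bar>zc_mean (N n) f - zc_mean (N n) F\<bar> \<le> e / 4" for n
    using zc_mean_diff_le[of f F "\<lambda>_. e / 4" "N n"] F_near zc_mean_const[OF deg_pos] by simp
  have 2: "\<bar>muS_int S f - muS_int S F\<bar> \<le> e / 4"
  proof -
    have "F \<in> borel_measurable borel" unfolding F_def by measurable
    then have "\<bar>muS_int S f - muS_int S F\<bar> \<le> muS_int S (\<lambda>_. e / 4)"
      by (intro muS_int_diff_le F_near muS_bounded_integrable[OF _ M] muS_bounded_integrable[OF _ F_bd]
          muS_bounded_integrable[OF _ order.refl]) auto
    then show ?thesis by (simp add: muS_int_const)
  qed
  define X where "X = (\<lambda>n. LBINT z:cball 0 (B + \<delta>). \<bar>L n z - Psi S z\<bar>)"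
  have 3: "\<bar>zc_mean (N n) F - muS_int S F\<bar> \<le> (1 / c) * (2 * M * X n)" for n
  proof -
    have "zc_mean (N n) F - muS_int S F = (1 / c) * (zc_mean (N n) (mollify \<delta> f) - muS_int S (mollify \<delta> f))"
      unfolding F_def zc_mean_cmult muS_int_cmult by (simp add: right_diff_distrib)
    then have "\<bar>zc_mean (N n) F - muS_int S F\<bar> = (1 / c) * \<bar>zc_mean (N n) (mollify \<delta> f) - muS_int S (mollify \<delta> f)\<bar>"
      using c by (simp add: abs_mult)
    also have "\<dots> \<le> (1 / c) * (2 * M * X n)"
      unfolding X_def using c by (intro mult_left_mono mollify_estimate \<delta> M supp) auto
    finally show ?thesis .
  qed
  have "X \<longlonglongrightarrow> 0" unfolding X_def by (rule L1_convergence) simp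
  then have "(\<lambda>n. (1 / c) * (2 * M * X n)) \<longlonglongrightarrow> (1 / c) * (2 * M * 0)" by (intro tendsto_intros)
  then have "eventually (\<lambda>n. (1 / c) * (2 * M * X n) < e / 4) sequentially"
    using e by (intro order_tendstoD(2)) auto
  then show "eventually (\<lambda>n. dist (zc_mean (N n) f) (muS_int S f) < e) sequentially"
  proof eventually_elim
    fix n assume "(1 / c) * (2 * M * X n) < e / 4"
    then show "dist (zc_mean (N n) f) (muS_int S f) < e"
      unfolding dist_real_def using 1[of n] 2 3[of n] e by linarith
  qed
qed

section \<open>Tightness and bounded test functions\<close>

lemma muS_int_cutoff:
  "(\<lambda>m. muS_int S (\<lambda>z. max 0 (min 1 (real m - cmod z)))) \<longlonglongrightarrow> 1"
proof -
  define cut where "cut = (\<lambda>(m :: nat) z. max 0 (min 1 (real m - cmod z)))"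
  have [measurable]: "cut m \<in> borel_measurable borel" for m unfolding cut_def by measurable
  have cut: "0 \<le> cut m z" "cut m z \<le> 1" for m z by (auto simp: cut_def)
  have "(\<lambda>m. LBINT t. edge_density a b t * cut m (bisector a b t)) \<longlonglongrightarrow> (LBINT t. edge_density a b t * 1)"
    if ab: "(a, b) \<in> pairs" for a b
  proof (rule integral_dominated_convergence[where w = "edge_density a b"])
    have [measurable]: "edge_density a b \<in> borel_measurable borel" using pairsD[OF ab] by simp
    show "(\<lambda>t. edge_density a b t * 1) \<in> borel_measurable lborel" by measurable
    show "(\<lambda>t. edge_density a b t * cut m (bisector a b t)) \<in> borel_measurable lborel" for m by measurable
    show "integrable lborel (edge_density a b)" by (rule integrable_edge_density[OF ab])
    show "AE t in lborel. (\<lambda>m. edge_density a b t * cut m (bisector a b t)) \<longlonglongrightarrow> edge_density a b t * 1"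
    proof (rule AE_I2)
      fix t
      have "eventually (\<lambda>m. real m \<ge> cmod (bisector a b t) + 1) sequentially"
        using filterlim_real_sequentially by (auto simp: filterlim_at_top)
      then have "eventually (\<lambda>m. edge_density a b t * cut m (bisector a b t) = edge_density a b t * 1) sequentially"
        by eventually_elim (simp add: cut_def)
      then show "(\<lambda>m. edge_density a b t * cut m (bisector a b t)) \<longlonglongrightarrow> edge_density a b t * 1"
        by (rule tendsto_eventually)
    qed
    show "AE t in lborel. norm (edge_density a b t * cut m (bisector a b t)) \<le> edge_density a b t" for m
    proof (rule AE_I2)
      fix t
      show "norm (edge_density a b t * cut m (bisector a b t)) \<le> edge_density a b t"
        using cut edge_density_nonneg[of a b t] by (simp add: abs_mult mult_left_le)
    qed
  qed
  then have "(\<lambda>m. muS_int S (cut m)) \<longlonglongrightarrow> muS_int S (\<lambda>_. 1)"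
    unfolding muS_int_eq by (intro tendsto_divide tendsto_sum tendsto_const) auto
  then show ?thesis by (simp add: muS_int_1 cut_def)
qed

text \<open>Since all measures have mass 1, convergence for one cutoff function keeps mass from
  escaping: outside a fixed disc the limit, and eventually each zero-counting measure, has mass
  below \<open>\<eta>\<close>.\<close>

lemma weak_convergence:
  fixes f :: "complex \<Rightarrow> real"
  assumes cont: "continuous_on UNIV f" and bd: "bounded (range f)"
  shows "(\<lambda>n. zc_mean (N n) f) \<longlonglongrightarrow> muS_int S f"
proof (rule tendstoI)
  fix e :: real assume e: "e > 0"
  obtain M where M: "\<And>x. \<bar>f x\<bar> \<le> M" "M > 0"
    using bd unfolding bounded_pos by auto
  define \<eta> where "\<eta> = e / (4 * M)"
  have \<eta>: "\<eta> > 0" using e M by (simp add: \<eta>_def)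
  from order_tendstoD(1)[OF muS_int_cutoff, of "1 - \<eta>"] \<eta>
  obtain m where m: "muS_int S (\<lambda>z. max 0 (min 1 (real m - cmod z))) > 1 - \<eta>"
    using eventually_happens[of _ sequentially] by auto
  define cut where "cut = (\<lambda>z. max 0 (min 1 (real m - cmod z)))"
  have cut: "0 \<le> cut z" "cut z \<le> 1" for z by (auto simp: cut_def)
  have cutc: "continuous_on UNIV cut" unfolding cut_def by (intro continuous_intros)
  have cut0: "cut x = 0" if "cmod x > real m" for x using that by (simp add: cut_def)
  have [measurable]: "f \<in> borel_measurable borel" "cut \<in> borel_measurable borel"
    using cont cutc by (auto intro: borel_measurable_continuous_onI)
  have le: "\<bar>f x - f x * cut x\<bar> \<le> M * (1 - cut x)" for x
  proof -
    have "\<bar>f x - f x * cut x\<bar> = \<bar>f x\<bar> * (1 - cut x)"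
      using cut[of x] by (simp add: abs_mult flip: right_diff_distrib[of "f x" 1, simplified])
    then show ?thesis using M cut[of x] by (simp add: mult_right_mono)
  qed
  have bd': "\<bar>f x * cut x\<bar> \<le> M" "\<bar>M * (1 - cut x)\<bar> \<le> M" "\<bar>cut x\<bar> \<le> 1" "\<bar>1 - cut x\<bar> \<le> 1" for x
    using M(1)[of x] M(2) cut[of x] mult_mono[of "\<bar>f x\<bar>" M "cut x" 1]
    by (auto simp: abs_mult intro: mult_left_le)
  have mass: "muS_int S (\<lambda>x. 1 - cut x) < \<eta>"
  proof -
    have "muS_int S (\<lambda>x. 1 - cut x) = muS_int S (\<lambda>_. 1) - muS_int S cut"
      by (rule muS_int_diff(2)[OF muS_integrable_1 muS_bounded_integrable[OF _ bd'(3)]]) simp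
    then show ?thesis using m by (simp add: cut_def muS_int_1)
  qed
  have A: "\<bar>muS_int S f - muS_int S (\<lambda>x. f x * cut x)\<bar> < e / 4"
  proof -
    have "\<bar>muS_int S f - muS_int S (\<lambda>x. f x * cut x)\<bar> \<le> muS_int S (\<lambda>x. M * (1 - cut x))"
      by (intro muS_int_diff_le le muS_bounded_integrable[OF _ M(1)] muS_bounded_integrable[OF _ bd'(1)]
          muS_bounded_integrable[OF _ bd'(2)]) auto
    also have "\<dots> = M * muS_int S (\<lambda>x. 1 - cut x)" by (rule muS_int_cmult)
    also have "\<dots> < M * \<eta>" using mass M by simp
    finally show ?thesis using M by (simp add: \<eta>_def)
  qed
  have c1: "(\<lambda>n. zc_mean (N n) (\<lambda>x. f x * cut x)) \<longlonglongrightarrow> muS_int S (\<lambda>x. f x * cut x)"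
    by (rule converges_compact_support[where B = "real m"]) (use cut0 in \<open>auto intro!: continuous_intros cont cutc\<close>)
  have c2: "(\<lambda>n. zc_mean (N n) cut) \<longlonglongrightarrow> muS_int S cut"
    by (rule converges_compact_support[where B = "real m"]) (use cut0 in \<open>auto intro!: cutc\<close>)
  have "eventually (\<lambda>n. zc_mean (N n) cut > 1 - \<eta>) sequentially"
    by (rule order_tendstoD(1)[OF c2]) (use m in \<open>simp add: cut_def\<close>)
  moreover have "eventually (\<lambda>n. dist (zc_mean (N n) (\<lambda>x. f x * cut x)) (muS_int S (\<lambda>x. f x * cut x)) < e / 4) sequentially"
    using tendstoD[OF c1, of "e / 4"] e by simp
  ultimately show "eventually (\<lambda>n. dist (zc_mean (N n) f) (muS_int S f) < e) sequentially"
  proof eventually_elim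
    fix n assume 1: "zc_mean (N n) cut > 1 - \<eta>"
      and 2: "dist (zc_mean (N n) (\<lambda>x. f x * cut x)) (muS_int S (\<lambda>x. f x * cut x)) < e / 4"
    have "\<bar>zc_mean (N n) f - zc_mean (N n) (\<lambda>x. f x * cut x)\<bar> \<le> zc_mean (N n) (\<lambda>x. M * (1 - cut x))"
      by (rule zc_mean_diff_le[OF le])
    also have "\<dots> = M * (1 - zc_mean (N n) cut)"
      using zc_mean_const[OF deg_pos] by (simp add: zc_mean_cmult zc_mean_diff)
    also have "\<dots> < M * \<eta>" using 1 M by simp
    finally have "\<bar>zc_mean (N n) f - zc_mean (N n) (\<lambda>x. f x * cut x)\<bar> < e / 4" using M by (simp add: \<eta>_def)
    then show "dist (zc_mean (N n) f) (muS_int S f) < e"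
      using A 2 e unfolding dist_real_def by linarith
  qed
qed

end

context sites
begin

section \<open>Asymptotics of the numerators\<close>

text \<open>The bisector of \<open>a\<close> and \<open>b\<close> is the zero set of
  \<open>Re ((z - (a + b) / 2) / (b - a))\<close>, a line.\<close>

lemma AE_no_ties: "AE z in lborel. \<forall>a\<in>S. \<forall>b\<in>S. a \<noteq> b \<longrightarrow> cmod (z - a) \<noteq> cmod (z - b)"
proof (intro AE_finite_allI fin)
  fix a b
  show "AE z in lborel. a \<noteq> b \<longrightarrow> cmod (z - a) \<noteq> cmod (z - b)"
  proof (cases "a = b")
    case False
    then have "1 / (b - a) \<noteq> 0" by simp
    from AE_Re_mult_ne_0[OF this, of "(a + b) / 2"] show ?thesis
    proof eventually_elim
      fix z assume nz: "Re ((z - (a + b) / 2) * (1 / (b - a))) \<noteq> 0"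
      have "(z - (a + b) / 2) * (1 / (b - a)) = (z - a) / (b - a) - 1 / 2"
        using False by (simp add: field_simps)
      with nz have "Re ((z - a) / (b - a) - 1 / 2) \<noteq> 0" by (simp only: not_False_eq_True)
      then have ne: "2 * Re ((z - a) / (b - a)) \<noteq> 1" by simp
      have "(z - b) / (a - b) = 1 - (z - a) / (b - a)" using False by (simp add: field_simps)
      then have swap: "Re ((z - b) / (a - b)) = 1 - Re ((z - a) / (b - a))" by (simp only: minus_complex.sel one_complex.sel)
      have 1: "cmod (z - b) < cmod (z - a) \<longleftrightarrow> 1 < 2 * Re ((z - a) / (b - a))"
        using cmod_diff_less_iff[of "b - a" "z - a"] False by simp
      have 2: "cmod (z - a) < cmod (z - b) \<longleftrightarrow> 1 < 2 * Re ((z - b) / (a - b))"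
        using cmod_diff_less_iff[of "a - b" "z - b"] False by simp
      show "a \<noteq> b \<longrightarrow> cmod (z - a) \<noteq> cmod (z - b)"
      proof (intro impI notI)
        assume "cmod (z - a) = cmod (z - b)"
        then have "\<not> 1 < 2 * Re ((z - a) / (b - a))" "\<not> 1 < 2 * (1 - Re ((z - a) / (b - a)))"
          using 1 2 unfolding swap by (metis less_irrefl)+
        moreover have "\<not> 1 < 2 * x \<Longrightarrow> \<not> 1 < 2 * (1 - x) \<Longrightarrow> 2 * x = 1" for x :: real by simp
        ultimately show False using ne by blast
      qed
    qed
  qed simp
qed

definition cofactor :: "complex \<Rightarrow> complex \<Rightarrow> complex" where
  "cofactor i z = (\<Prod>j\<in>S - {i}. (z - j))"

lemma poly_numer_sum: "poly (numer_sum S c n) z = (\<Sum>i\<in>S. c i * cofactor i z ^ Suc n)"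
  by (simp add: numer_sum_def cofactor_def poly_sum poly_power poly_prod del: power_Suc)

text \<open>The two products differ in one factor, |z - i| against |z - j|; the common factors are
  nonzero because only the nearest site can equal \<open>z\<close>.\<close>

lemma cofactor_less:
  assumes i: "i \<in> S" and j: "j \<in> S" "j \<noteq> i" and less: "\<And>b. b \<in> S - {i} \<Longrightarrow> cmod (z - i) < cmod (z - b)"
  shows "cmod (cofactor j z) < cmod (cofactor i z)"
proof -
  define p where "p = cmod (\<Prod>k\<in>S - {i} - {j}. (z - k))"
  have "S - {j} - {i} = S - {i} - {j}" by auto
  then have "cmod (cofactor j z) = cmod (z - i) * p"
    unfolding cofactor_def p_def using i j by (subst prod.remove[of "S - {j}" i]) (auto simp: norm_mult)
  moreover have "cmod (cofactor i z) = cmod (z - j) * p"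
    unfolding cofactor_def p_def using i j by (subst prod.remove[of "S - {i}" j]) (auto simp: norm_mult)
  moreover have "p > 0"
  proof -
    have "z \<noteq> k" if "k \<in> S - {i} - {j}" for k using less[of k] that by auto
    then show ?thesis by (auto simp: p_def)
  qed
  ultimately show ?thesis using less[of j] j by simp
qed

text \<open>Divided by \<open>cofactor i z ^ Suc n\<close>, with \<open>i\<close> the nearest site,
  the sum tends to \<open>c i\<close>. As \<open>c i \<noteq> 0\<close>, the logarithm of this
  quotient stays bounded and, like that of the leading coefficient, which is O(log n), vanishes
  after division by the degree.\<close>

lemma potential_tendsto_Psi:
  assumes c: "\<forall>i\<in>S. c i \<noteq> 0" and C: "C > 0"
    and A: "\<And>n. n \<ge> n0 \<Longrightarrow> degree (numer_sum S c n) = r + n * (card S - 1) \<and>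
      C \<le> cmod (lead_coeff (numer_sum S c n)) \<and> cmod (lead_coeff (numer_sum S c n)) \<le> C * real (Suc n) ^ k"
    and z: "\<forall>a\<in>S. \<forall>b\<in>S. a \<noteq> b \<longrightarrow> cmod (z - a) \<noteq> cmod (z - b)"
  shows "(\<lambda>n. zc_mean (numer_sum S c n) (\<lambda>t. ln (cmod (z - t)))) \<longlonglongrightarrow> Psi S z"
proof -
  obtain i where i: "i \<in> S" "\<And>b. b \<in> S \<Longrightarrow> cmod (z - i) \<le> cmod (z - b)"
    using ex_nearest by blast
  have less: "cmod (z - i) < cmod (z - b)" if "b \<in> S - {i}" for b
  proof -
    have "b \<in> S" "i \<noteq> b" using that by auto
    then have "cmod (z - i) \<noteq> cmod (z - b)" using z i(1) by blast
    with i(2)[OF \<open>b \<in> S\<close>] show ?thesis by linarith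
  qed
  define a where "a = cofactor i z"
  have "z \<noteq> k" if "k \<in> S - {i}" for k using less[of k] that by auto
  then have a: "a \<noteq> 0" by (auto simp: a_def cofactor_def)
  have psi: "Psi S z = ln (cmod a) / \<omega>"
    using Max_prod_nearest[OF i] by (simp add: Psi_def a_def cofactor_def prod_norm)
  let ?W = "numer_sum S c"
  have lim: "(\<lambda>n. poly (?W n) z / a ^ Suc n) \<longlonglongrightarrow> c i"
  proof -
    have "(\<lambda>n. \<Sum>j\<in>S. c j * (cofactor j z / a) ^ Suc n) \<longlonglongrightarrow> (\<Sum>j\<in>S. if j = i then c i else 0)"
    proof (rule tendsto_sum)
      fix j assume j: "j \<in> S"
      show "(\<lambda>n. c j * (cofactor j z / a) ^ Suc n) \<longlonglongrightarrow> (if j = i then c i else 0)"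
      proof (cases "j = i")
        case True
        then show ?thesis using a by (simp add: a_def)
      next
        case False
        then have "cmod (cofactor j z / a) < 1"
          using cofactor_less[OF i(1) j False less] a by (simp add: a_def norm_divide)
        from LIMSEQ_Suc[OF LIMSEQ_power_zero[OF this]]
        have "(\<lambda>n. c j * (cofactor j z / a) ^ Suc n) \<longlonglongrightarrow> c j * 0"
          by (intro tendsto_mult tendsto_const)
        then show ?thesis using False by simp
      qed
    qed
    also have "(\<lambda>n. \<Sum>j\<in>S. c j * (cofactor j z / a) ^ Suc n) = (\<lambda>n. poly (?W n) z / a ^ Suc n)"
      by (simp add: poly_numer_sum sum_divide_distrib power_divide del: power_Suc)
    also have "(\<Sum>j\<in>S. if j = i then c i else 0) = c i" using i(1) by simp
    finally show ?thesis .
  qed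
  have ci: "c i \<noteq> 0" using c i(1) by blast
  \<comment> \<open>The degree of the numerator; \<open>Suc n / D n\<close> tends to
    \<open>1 / \<omega>\<close>, the normalisation of \<open>Psi S\<close>.\<close>
  define D where "D = (\<lambda>n. real r + real n * \<omega>)"
  have w: "\<omega> > 0" by (rule omega_pos)
  have T1: "(\<lambda>n. real (Suc n) / D n) \<longlonglongrightarrow> 1 / \<omega>"
    unfolding D_def inverse_eq_divide[symmetric] using w by real_asymp
  have T2: "(\<lambda>n. 1 / D n) \<longlonglongrightarrow> 0" unfolding D_def using w by real_asymp
  have T3: "(\<lambda>n. ln (real (Suc n)) / D n) \<longlonglongrightarrow> 0" unfolding D_def using w by real_asymp
  have lead: "(\<lambda>n. ln (cmod (lead_coeff (?W n))) / D n) \<longlonglongrightarrow> 0"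
  proof (rule Lim_null_comparison)
    have "(\<lambda>n. \<bar>ln C\<bar> * (1 / D n) + real k * (ln (real (Suc n)) / D n)) \<longlonglongrightarrow> \<bar>ln C\<bar> * 0 + real k * 0"
      by (rule tendsto_add[OF tendsto_mult[OF tendsto_const T2] tendsto_mult[OF tendsto_const T3]])
    then show "(\<lambda>n. \<bar>ln C\<bar> * (1 / D n) + real k * (ln (real (Suc n)) / D n)) \<longlonglongrightarrow> 0" by simp
    show "eventually (\<lambda>n. norm (ln (cmod (lead_coeff (?W n))) / D n) \<le> \<bar>ln C\<bar> * (1 / D n) + real k * (ln (real (Suc n)) / D n)) sequentially"
      using eventually_ge_at_top[of n0]
    proof eventually_elim
      fix n assume "n \<ge> n0"
      note An = A[OF this]
      define l where "l = cmod (lead_coeff (?W n))"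
      have l: "C \<le> l" "l \<le> C * real (Suc n) ^ k" using An by (auto simp: l_def)
      have "ln C \<le> ln l" using l C by (subst ln_le_cancel_iff) auto
      moreover have "ln l \<le> ln (C * real (Suc n) ^ k)" using l C by (subst ln_le_cancel_iff) auto
      moreover have "ln (C * real (Suc n) ^ k) = ln C + real k * ln (real (Suc n))"
        using C by (simp add: ln_mult ln_realpow)
      moreover have "real k * ln (real (Suc n)) \<ge> 0" by simp
      ultimately have "\<bar>ln l\<bar> \<le> \<bar>ln C\<bar> + real k * ln (real (Suc n))" by linarith
      moreover have "D n \<ge> 0" using w by (simp add: D_def)
      ultimately have "\<bar>ln l\<bar> / D n \<le> (\<bar>ln C\<bar> + real k * ln (real (Suc n))) / D n" by (intro divide_right_mono)
      then show "norm (ln (cmod (lead_coeff (?W n))) / D n) \<le> \<bar>ln C\<bar> * (1 / D n) + real k * (ln (real (Suc n)) / D n)"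
        using \<open>D n \<ge> 0\<close> by (simp add: l_def abs_divide add_divide_distrib)
    qed
  qed
  have lnlim: "(\<lambda>n. ln (cmod (poly (?W n) z / a ^ Suc n))) \<longlonglongrightarrow> ln (cmod (c i))"
    by (rule tendsto_ln[OF tendsto_norm[OF lim]]) (use ci in simp)
  define Y where "Y = (\<lambda>n. ln (cmod (poly (?W n) z / a ^ Suc n)) * (1 / D n) +
    (real (Suc n) / D n) * ln (cmod a) - ln (cmod (lead_coeff (?W n))) / D n)"
  have "Y \<longlonglongrightarrow> ln (cmod (c i)) * 0 + (1 / \<omega>) * ln (cmod a) - 0"
    unfolding Y_def
    by (rule tendsto_diff[OF tendsto_add[OF tendsto_mult[OF lnlim T2] tendsto_mult[OF T1 tendsto_const]] lead])
  moreover have "ln (cmod (c i)) * 0 + (1 / \<omega>) * ln (cmod a) - 0 = Psi S z" unfolding psi by simp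
  ultimately have L: "Y \<longlonglongrightarrow> Psi S z" by (simp only:)
  have "eventually (\<lambda>n. poly (?W n) z / a ^ Suc n \<noteq> 0) sequentially"
    using lim ci by (rule tendsto_imp_eventually_ne)
  then have "eventually (\<lambda>n. Y n = zc_mean (?W n) (\<lambda>t. ln (cmod (z - t)))) sequentially"
    using eventually_ge_at_top[of "max n0 1"]
  proof eventually_elim
    fix n assume nz: "poly (?W n) z / a ^ Suc n \<noteq> 0" and n: "n \<ge> max n0 1"
    then have pz: "poly (?W n) z \<noteq> 0" by auto
    have "degree (?W n) = r + n * (card S - 1)" using A[of n] n by auto
    then have deg: "real (degree (?W n)) = D n"
      unfolding D_def using card2 by (simp add: of_nat_diff)
    have Dp: "D n > 0" unfolding D_def using w n by (intro add_nonneg_pos mult_pos_pos) auto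
    have "ln (cmod (poly (?W n) z / a ^ Suc n)) = ln (cmod (poly (?W n) z)) - real (Suc n) * ln (cmod a)"
    proof -
      have "cmod (poly (?W n) z) \<noteq> 0" "cmod a ^ Suc n \<noteq> 0" "cmod a > 0" using pz a by simp_all
      then show ?thesis unfolding norm_divide norm_power
        by (simp only: ln_div ln_realpow simp_thms if_True)
    qed
    also have "ln (cmod (poly (?W n) z)) = ln (cmod (lead_coeff (?W n))) + D n * zc_mean (?W n) (\<lambda>t. ln (cmod (z - t)))"
      using ln_cmod_poly[OF pz] by (simp add: deg)
    finally have eq: "ln (cmod (poly (?W n) z / a ^ Suc n)) = ln (cmod (lead_coeff (?W n))) +
        D n * zc_mean (?W n) (\<lambda>t. ln (cmod (z - t))) - real (Suc n) * ln (cmod a)" .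
    have "(u + e * x - m * v) * (1 / e) + (m / e) * v - u / e = x" if "e > 0" for u e x m v :: real
      using that by (simp add: add_divide_distrib diff_divide_distrib)
    from this[OF Dp] show "Y n = zc_mean (?W n) (\<lambda>t. ln (cmod (z - t)))"
      unfolding Y_def eq .
  qed
  from Lim_transform_eventually[OF L this] show ?thesis .
qed

lemma potential_bounded_above:
  assumes C: "C > 0"
    and A: "\<And>n. n \<ge> n0 \<Longrightarrow> degree (numer_sum S c n) = r + n * (card S - 1) \<and>
      C \<le> cmod (lead_coeff (numer_sum S c n))"
  shows "\<exists>M. \<forall>n z. n \<ge> max n0 1 \<longrightarrow> cmod z \<le> B \<longrightarrow> poly (numer_sum S c n) z \<noteq> 0 \<longrightarrow>
    zc_mean (numer_sum S c n) (\<lambda>t. ln (cmod (z - t))) \<le> M"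
proof -
  \<comment> \<open>A bound for every factor \<open>cmod (z - j)\<close>, at least 1 so that powers
    may be raised to the exponent \<open>card S\<close>.\<close>
  define E where "E = 1 + \<bar>B\<bar> + (\<Sum>j\<in>S. cmod j)"
  have E1: "E \<ge> 1" unfolding E_def by (simp add: sum_nonneg)
  define G where "G = E ^ card S"
  have G1: "G \<ge> 1" unfolding G_def using E1 by simp
  define s where "s = (\<Sum>i\<in>S. cmod (c i)) + 1"
  have s: "s > 0" unfolding s_def by (simp add: add_nonneg_pos sum_nonneg)
  \<comment> \<open>The 2 comes from \<open>Suc n \<le> 2 * D\<close>: the degree \<open>D\<close>
    is at least \<open>n\<close>, and \<open>n \<ge> 1\<close>.\<close>
  define M where "M = \<bar>ln s\<bar> + 2 * ln G + \<bar>ln C\<bar>"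
  have "zc_mean (numer_sum S c n) (\<lambda>t. ln (cmod (z - t))) \<le> M"
    if n: "n \<ge> max n0 1" and z: "cmod z \<le> B" and nz: "poly (numer_sum S c n) z \<noteq> 0" for n z
  proof -
    define D where "D = real (degree (numer_sum S c n))"
    define l where "l = cmod (lead_coeff (numer_sum S c n))"
    have An: "degree (numer_sum S c n) = r + n * (card S - 1)" "C \<le> l"
      using A[of n] n by (auto simp: l_def)
    have "n * 1 \<le> n * (card S - 1)" using card2 by (intro mult_left_mono) auto
    then have "n \<le> degree (numer_sum S c n)" unfolding An(1) by linarith
    then have "D \<ge> real n" unfolding D_def by (rule of_nat_mono)
    then have D: "D \<ge> real n" "D \<ge> 1" using n by auto
    have cof: "cmod (cofactor i z) \<le> G" for i
    proof -
      have "cmod (cofactor i z) = (\<Prod>j\<in>S - {i}. cmod (z - j))" by (simp add: cofactor_def prod_norm)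
      also have "\<dots> \<le> (\<Prod>j\<in>S - {i}. E)"
      proof (intro prod_mono conjI)
        fix j assume "j \<in> S - {i}"
        then have "cmod j \<le> (\<Sum>j\<in>S. cmod j)" by (intro member_le_sum) auto
        then show "cmod (z - j) \<le> E" using z norm_triangle_ineq4[of z j] by (simp add: E_def)
      qed simp
      also have "\<dots> = E ^ card (S - {i})" by simp
      also have "\<dots> \<le> G" unfolding G_def using E1 by (intro power_increasing card_mono) auto
      finally show ?thesis .
    qed
    have "cmod (poly (numer_sum S c n) z) \<le> (\<Sum>i\<in>S. cmod (c i * cofactor i z ^ Suc n))"
      unfolding poly_numer_sum by (rule norm_sum)
    also have "\<dots> \<le> (\<Sum>i\<in>S. cmod (c i) * G ^ Suc n)"
      unfolding norm_mult norm_power by (intro sum_mono mult_left_mono power_mono cof) auto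
    also have "\<dots> \<le> s * G ^ Suc n"
      unfolding s_def sum_distrib_right[symmetric] using G1 by (intro mult_right_mono) auto
    finally have "ln (cmod (poly (numer_sum S c n) z)) \<le> ln (s * G ^ Suc n)"
      using nz s G1 by (subst ln_le_cancel_iff) (auto simp del: power_Suc)
    also have "\<dots> = ln s + real (Suc n) * ln G"
      using s G1 by (simp add: ln_mult ln_realpow del: power_Suc of_nat_Suc)
    finally have 1: "ln (cmod (poly (numer_sum S c n) z)) \<le> ln s + real (Suc n) * ln G" .
    have lnG: "ln G \<ge> 0" using G1 by simp
    have "ln C \<le> ln l" using An C by (subst ln_le_cancel_iff) auto
    moreover have "ln (cmod (poly (numer_sum S c n) z)) = ln l + D * zc_mean (numer_sum S c n) (\<lambda>t. ln (cmod (z - t)))"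
      unfolding l_def D_def by (rule ln_cmod_poly[OF nz])
    ultimately have "D * zc_mean (numer_sum S c n) (\<lambda>t. ln (cmod (z - t))) \<le> \<bar>ln s\<bar> + real (Suc n) * ln G + \<bar>ln C\<bar>"
      using 1 by linarith
    also have "\<dots> \<le> D * \<bar>ln s\<bar> + D * (2 * ln G) + D * \<bar>ln C\<bar>"
    proof -
      have "real (Suc n) \<le> D * 2" using D n by simp
      then have "real (Suc n) * ln G \<le> (D * 2) * ln G" using lnG by (rule mult_right_mono)
      moreover have "1 * \<bar>ln s\<bar> \<le> D * \<bar>ln s\<bar>" by (rule mult_right_mono[OF D(2)]) simp
      moreover have "1 * \<bar>ln C\<bar> \<le> D * \<bar>ln C\<bar>" by (rule mult_right_mono[OF D(2)]) simp
      ultimately show ?thesis by simp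
    qed
    also have "\<dots> = D * M" by (simp add: M_def distrib_left)
    finally show ?thesis using D by (subst (asm) mult_le_cancel_left_pos) auto
  qed
  then show ?thesis by blast
qed

text \<open>The shift by \<open>Suc n0\<close> skips the indices without known structure and makes
  the degree positive even if \<open>r = 0\<close>.\<close>

lemma zero_seq_numer_sum:
  assumes c: "\<forall>i\<in>S. c i \<noteq> 0" and C: "C > 0"
    and A: "\<And>n. n \<ge> n0 \<Longrightarrow> degree (numer_sum S c n) = r + n * (card S - 1) \<and>
      C \<le> cmod (lead_coeff (numer_sum S c n)) \<and> cmod (lead_coeff (numer_sum S c n)) \<le> C * real (Suc n) ^ k"
  shows "zero_seq S (\<lambda>n. numer_sum S c (n + Suc n0))"
proof (unfold_locales)
  fix n
  show "degree (numer_sum S c (n + Suc n0)) > 0"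
    using A[of "n + Suc n0"] card2 by simp
next
  show "AE z in lborel. (\<lambda>n. zc_mean (numer_sum S c (n + Suc n0)) (\<lambda>t. ln (cmod (z - t)))) \<longlonglongrightarrow> Psi S z"
    using AE_no_ties
  proof eventually_elim
    fix z assume "\<forall>a\<in>S. \<forall>b\<in>S. a \<noteq> b \<longrightarrow> cmod (z - a) \<noteq> cmod (z - b)"
    from potential_tendsto_Psi[OF c C A this, of n0]
    have "(\<lambda>n. zc_mean (numer_sum S c n) (\<lambda>t. ln (cmod (z - t)))) \<longlonglongrightarrow> Psi S z" by simp
    then show "(\<lambda>n. zc_mean (numer_sum S c (n + Suc n0)) (\<lambda>t. ln (cmod (z - t)))) \<longlonglongrightarrow> Psi S z"
      by (rule LIMSEQ_ignore_initial_segment)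
  qed
next
  fix B
  obtain M where "\<And>n z. n \<ge> max n0 1 \<Longrightarrow> cmod z \<le> B \<Longrightarrow> poly (numer_sum S c n) z \<noteq> 0 \<Longrightarrow>
    zc_mean (numer_sum S c n) (\<lambda>t. ln (cmod (z - t))) \<le> M"
    using potential_bounded_above[OF C, of n0 c r B] A by blast
  then show "\<exists>M. \<forall>n z. cmod z \<le> B \<longrightarrow> poly (numer_sum S c (n + Suc n0)) z \<noteq> 0 \<longrightarrow>
    zc_mean (numer_sum S c (n + Suc n0)) (\<lambda>t. ln (cmod (z - t))) \<le> M"
    by (intro exI[of _ M]) auto
qed

end

theorem theorem1p1:
  fixes R P :: "complex poly" and d :: nat
  assumes "coprime R P" and "degree P = d" and "d \<ge> 2"
    and "card {z. poly P z = 0} = d"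
  defines "S \<equiv> {z. poly P z = 0}"
  shows "muS_int S (\<lambda>_. 1) = 1
    \<and> (\<forall>f::complex \<Rightarrow> real. continuous_on UNIV f \<and> bounded (range f) \<longrightarrow>
          (\<lambda>n. zc_int (Qn R P (Suc n)) f) \<longlonglongrightarrow> muS_int S f)
    \<and> (\<forall>z. muS_int S (\<lambda>t. ln (cmod (z - t))) = Psi S z)
    \<and> (\<forall>K. compact K \<longrightarrow>
          set_integrable lborel K (Psi S)
          \<and> (\<forall>n. set_integrable lborel K (zc_pot (Qn R P (Suc n))))
          \<and> (\<lambda>n. LINT z:K|lborel. \<bar>zc_pot (Qn R P (Suc n)) z - Psi S z\<bar>) \<longlonglongrightarrow> 0)"
proof -
  have card: "card S = d" using assms(4) by (simp add: S_def)
  have "P \<noteq> 0" using assms(2,3) by auto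
  then have "finite S" unfolding S_def by (rule poly_roots_finite)
  then interpret sites S by unfold_locales (use card assms(3) in auto)
  obtain c r k C n0 where c: "\<forall>i\<in>S. c i \<noteq> 0" and C: "C > 0"
    and main: "\<And>n. n \<ge> n0 \<Longrightarrow> (\<forall>f. zc_int (Qn R P n) f = zc_mean (numer_sum S c n) f) \<and>
      degree (numer_sum S c n) = r + n * (d - 1) \<and> C \<le> cmod (lead_coeff (numer_sum S c n)) \<and>
      cmod (lead_coeff (numer_sum S c n)) \<le> C * real (Suc n) ^ k"
    using Qn_structure[OF assms(1-4) meta_eq_to_obj_eq[OF S_def]] by blast
  have "zero_seq S (\<lambda>n. numer_sum S c (n + Suc n0))"
    by (rule zero_seq_numer_sum[OF c C, of n0 r k], unfold card) (use main in blast)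
  then interpret zero_seq S "\<lambda>n. numer_sum S c (n + Suc n0)" .
  \<comment> \<open>The claim starts with the first derivative, at index \<open>Suc n\<close>;
    moving it by \<open>n0\<close> gives the sequence of the locale.\<close>
  have zc: "zc_int (Qn R P (Suc (n + n0))) f = zc_mean (numer_sum S c (n + Suc n0)) f" for n f
    using main[of "Suc (n + n0)"] by simp
  have "(\<lambda>n. zc_int (Qn R P (Suc n)) f) \<longlonglongrightarrow> muS_int S f"
    if "continuous_on UNIV f" "bounded (range f)" for f :: "complex \<Rightarrow> real"
    by (rule LIMSEQ_offset[where k = n0], unfold zc, rule weak_convergence[OF that])
  moreover have "(\<lambda>n. LINT z:K|lborel. \<bar>zc_pot (Qn R P (Suc n)) z - Psi S z\<bar>) \<longlonglongrightarrow> 0"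
    if "compact K" for K
    by (rule LIMSEQ_offset[where k = n0], unfold zc_pot_def zc, rule L1_convergence[OF that])
  \<comment> \<open>This concerns every \<open>n\<close>, so it rests on the finite sum of
    logarithms itself and not on the asymptotic form of the numerators.\<close>
  moreover have "set_integrable lborel K (zc_pot (Qn R P (Suc n)))" if "compact K" for K n
    unfolding zc_pot_def[abs_def] zc_int_eq by (rule set_integrable_zc_mean_ln[OF that])
  ultimately show ?thesis using muS_int_1 muS_potential set_integrable_Psi by blast
qed

end
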